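(* For a connected outerplanar graph $G$, the following statements are equivalent: (1) $G$ is $1$-perfectly orientable. (2) $G$ is $\{K_{2,3},F_1,F_2\}$-induced-minor-free. (3) Every block of $G$ is a $2$-tree, except possibly one, which is either $K_1$ or a hollowed $2$-tree. (4) $G$ can be constructed from either $K_1$ or a cycle by a sequence of operations $(A_1)$ and $(A_2')$, where $(A_1)$ is: add a new vertex adjacent to exactly one existing vertex; and $(A_2')$ is: add a new vertex adjacent to exactly two existing adjacent vertices $v,w$, where the edge $vw$ lies in at most one induced cycle of the current graph.
   Context: All graphs are finite and simple. An orientation of a graph $G$ is $1$-perfect if for every vertex $v$ the out-neighborhood of $v$ is a clique in $G$; $G$ is $1$-perfectly orientable if it has a $1$-perfect orientation. $H$ is an induced minor of $G$ if $H$ can be obtained from $G$ by vertex deletions and edge contractions; $G$ is $\mathcal F$-induced-minor-free if no member of $\mathcal F$ is an induced minor of $G$. $F_1$ is the graph consisting of two $4$-cycles sharing exactly one edge ($C_6$ plus a chord joining two antipodal vertices). $F_2$ is the graph consisting of two $4$-cycles sharing exactly one vertex. A block is a maximal biconnected subgraph (biconnected = connected with no cut vertex). $2$-trees: $K_2$ is a $2$-tree, and adding to a $2$-tree a new vertex adjacent to exactly two adjacent vertices yields a $2$-tree; there are no others. Hollowed $2$-trees: every cycle of length at least $4$ is a hollowed $2$-tree, and adding to a hollowed $2$-tree a new vertex adjacent to exactly two adjacent vertices yields a hollowed $2$-tree; there are no others. *)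

theory Defs
  imports "HOL-Analysis.Analysis"
begin

type_synonym 'a graph = "'a set \<times> 'a set set"

definition graph :: "'a graph \<Rightarrow> bool" where
  "graph G \<longleftrightarrow> finite (fst G) \<and>
     (\<forall>e\<in>snd G. \<exists>u v. u \<noteq> v \<and> u \<in> fst G \<and> v \<in> fst G \<and> e = {u, v})"

definition adj :: "'a graph \<Rightarrow> 'a \<Rightarrow> 'a \<Rightarrow> bool" where
  "adj G u v \<longleftrightarrow> {u, v} \<in> snd G"

definition connected_graph :: "'a graph \<Rightarrow> bool" where
  "connected_graph G \<longleftrightarrow> fst G \<noteq> {} \<and>
     (\<forall>u\<in>fst G. \<forall>v\<in>fst G. (adj G)\<^sup>*\<^sup>* u v)"

definition delete_vertex :: "'a graph \<Rightarrow> 'a \<Rightarrow> 'a graph" where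
  "delete_vertex G v = (fst G - {v}, {e \<in> snd G. v \<notin> e})"

definition contract_edge :: "'a graph \<Rightarrow> 'a \<Rightarrow> 'a \<Rightarrow> 'a graph" where
  "contract_edge G u v = (fst G - {v},
      {e \<in> snd G. v \<notin> e} \<union> {{u, w} | w. {v, w} \<in> snd G \<and> w \<noteq> u})"

definition induced_subgraph :: "'a graph \<Rightarrow> 'a set \<Rightarrow> 'a graph" where
  "induced_subgraph G S = (S, {e \<in> snd G. e \<subseteq> S})"

definition subgraph :: "'a graph \<Rightarrow> 'a graph \<Rightarrow> bool" where
  "subgraph H G \<longleftrightarrow> graph H \<and> fst H \<subseteq> fst G \<and> snd H \<subseteq> snd G"

definition graph_iso :: "'b graph \<Rightarrow> 'a graph \<Rightarrow> bool" where
  "graph_iso H G \<longleftrightarrow> (\<exists>f. bij_betw f (fst H) (fst G) \<and>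
     (\<forall>x\<in>fst H. \<forall>y\<in>fst H. {x, y} \<in> snd H \<longleftrightarrow> {f x, f y} \<in> snd G))"

inductive minor_step :: "'a graph \<Rightarrow> 'a graph \<Rightarrow> bool" where
  del: "v \<in> fst G \<Longrightarrow> minor_step G (delete_vertex G v)"
| con: "{u, v} \<in> snd G \<Longrightarrow> u \<noteq> v \<Longrightarrow> minor_step G (contract_edge G u v)"

definition induced_minor :: "'b graph \<Rightarrow> 'a graph \<Rightarrow> bool" where
  "induced_minor H G \<longleftrightarrow> (\<exists>G'. minor_step\<^sup>*\<^sup>* G G' \<and> graph_iso H G')"

definition K23 :: "nat graph" where
  "K23 = ({0,1,2,3,4}, {{i, j} | i j. i \<in> {0,1} \<and> j \<in> {2,3,4}})"

text \<open>F1: the 6-cycle 0-1-2-3-4-5-0 with the chord 0-3 (two 4-cycles sharing one edge).\<close>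
definition F1 :: "nat graph" where
  "F1 = ({0,1,2,3,4,5}, {{0,1},{1,2},{2,3},{3,4},{4,5},{5,0},{0,3}})"

text \<open>F2: the 4-cycles 0-1-2-3-0 and 0-4-5-6-0 sharing exactly vertex 0.\<close>
definition F2 :: "nat graph" where
  "F2 = ({0,1,2,3,4,5,6}, {{0,1},{1,2},{2,3},{3,0},{0,4},{4,5},{5,6},{6,0}})"

definition orientation :: "'a graph \<Rightarrow> ('a \<times> 'a) set \<Rightarrow> bool" where
  "orientation G D \<longleftrightarrow> (\<forall>(u, v)\<in>D. {u, v} \<in> snd G) \<and>
     (\<forall>u v. {u, v} \<in> snd G \<longrightarrow> ((u, v) \<in> D \<longleftrightarrow> (v, u) \<notin> D))"

definition one_perfect_orientation :: "'a graph \<Rightarrow> ('a \<times> 'a) set \<Rightarrow> bool" where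
  "one_perfect_orientation G D \<longleftrightarrow> orientation G D \<and>
     (\<forall>v\<in>fst G. \<forall>x y. (v, x) \<in> D \<and> (v, y) \<in> D \<and> x \<noteq> y \<longrightarrow> {x, y} \<in> snd G)"

definition one_perfectly_orientable :: "'a graph \<Rightarrow> bool" where
  "one_perfectly_orientable G \<longleftrightarrow> (\<exists>D. one_perfect_orientation G D)"

definition plane_drawing :: "'a graph \<Rightarrow> ('a \<Rightarrow> complex) \<Rightarrow> ('a set \<Rightarrow> real \<Rightarrow> complex) \<Rightarrow> bool" where
  "plane_drawing G f \<gamma> \<longleftrightarrow> inj_on f (fst G) \<and>
     (\<forall>e\<in>snd G. arc (\<gamma> e) \<and> {pathstart (\<gamma> e), pathfinish (\<gamma> e)} = f ` e \<and>
                 path_image (\<gamma> e) \<inter> f ` fst G = f ` e) \<and>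
     (\<forall>e\<in>snd G. \<forall>e'\<in>snd G. e \<noteq> e' \<longrightarrow>
                 path_image (\<gamma> e) \<inter> path_image (\<gamma> e') \<subseteq> f ` (e \<inter> e'))"

definition drawing_image :: "'a graph \<Rightarrow> ('a \<Rightarrow> complex) \<Rightarrow> ('a set \<Rightarrow> real \<Rightarrow> complex) \<Rightarrow> complex set" where
  "drawing_image G f \<gamma> = f ` fst G \<union> (\<Union>e\<in>snd G. path_image (\<gamma> e))"

definition outerplanar :: "'a graph \<Rightarrow> bool" where
  "outerplanar G \<longleftrightarrow> (\<exists>f \<gamma>. plane_drawing G f \<gamma> \<and>
     (\<forall>v\<in>fst G. f v \<in> closure (outside (drawing_image G f \<gamma>))))"

definition cut_vertex :: "'a graph \<Rightarrow> 'a \<Rightarrow> bool" where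
  "cut_vertex G v \<longleftrightarrow> v \<in> fst G \<and> (\<exists>u w. u \<in> fst G - {v} \<and> w \<in> fst G - {v} \<and>
     (adj G)\<^sup>*\<^sup>* u w \<and> \<not> (adj (delete_vertex G v))\<^sup>*\<^sup>* u w)"

definition biconnected :: "'a graph \<Rightarrow> bool" where
  "biconnected G \<longleftrightarrow> connected_graph G \<and> (\<forall>v. \<not> cut_vertex G v)"

definition block :: "'a graph \<Rightarrow> 'a graph \<Rightarrow> bool" where
  "block G B \<longleftrightarrow> subgraph B G \<and> biconnected B \<and>
     (\<forall>B'. subgraph B' G \<and> biconnected B' \<and> subgraph B B' \<longrightarrow> B' = B)"

definition is_K1 :: "'a graph \<Rightarrow> bool" where
  "is_K1 G \<longleftrightarrow> (\<exists>v. G = ({v}, {}))"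

definition cycle_graph :: "'a graph \<Rightarrow> nat \<Rightarrow> bool" where
  "cycle_graph G n \<longleftrightarrow> n \<ge> 3 \<and> (\<exists>xs. distinct xs \<and> length xs = n \<and>
     G = (set xs, {{xs ! i, xs ! (Suc i mod n)} | i. i < n}))"

definition add_vertex :: "'a graph \<Rightarrow> 'a \<Rightarrow> 'a set \<Rightarrow> 'a graph" where
  "add_vertex G x N = (insert x (fst G), snd G \<union> {{x, w} | w. w \<in> N})"

inductive two_tree :: "'a graph \<Rightarrow> bool" where
  base: "u \<noteq> v \<Longrightarrow> two_tree ({u, v}, {{u, v}})"
| step: "two_tree G \<Longrightarrow> x \<notin> fst G \<Longrightarrow> {u, v} \<in> snd G \<Longrightarrow>
         two_tree (add_vertex G x {u, v})"

inductive hollowed_two_tree :: "'a graph \<Rightarrow> bool" where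
  base: "cycle_graph G n \<Longrightarrow> n \<ge> 4 \<Longrightarrow> hollowed_two_tree G"
| step: "hollowed_two_tree G \<Longrightarrow> x \<notin> fst G \<Longrightarrow> {u, v} \<in> snd G \<Longrightarrow>
         hollowed_two_tree (add_vertex G x {u, v})"

definition induced_cycle :: "'a graph \<Rightarrow> 'a set \<Rightarrow> bool" where
  "induced_cycle G S \<longleftrightarrow> S \<subseteq> fst G \<and> (\<exists>n. cycle_graph (induced_subgraph G S) n)"

inductive constructible :: "'a graph \<Rightarrow> bool" where
  K1: "constructible ({v}, {})"
| cycle: "cycle_graph G n \<Longrightarrow> constructible G"
| A1: "constructible G \<Longrightarrow> x \<notin> fst G \<Longrightarrow> v \<in> fst G \<Longrightarrow>
       constructible (add_vertex G x {v})"
| A2': "constructible G \<Longrightarrow> x \<notin> fst G \<Longrightarrow> {v, w} \<in> snd G \<Longrightarrow>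
        card {S. induced_cycle G S \<and> v \<in> S \<and> w \<in> S} \<le> 1 \<Longrightarrow>
        constructible (add_vertex G x {v, w})"

end

theory Submission
  imports Defs "HOL-Complex_Analysis.Winding_Numbers"
begin

text \<open>All four conditions are compared with a single one: the graph has at most one induced cycle of
  length at least 4 (a hole). Outerplanarity enters only through the absence of a \<open>K\<^sub>4\<close> and of two
  vertices joined through three disjoint connected sets. Hence the attachments to a hole of a
  component of its complement form a clique, so two different holes can be contracted to \<open>F\<^sub>1\<close>
  or \<open>F\<^sub>2\<close>. Conversely, if there is at most one hole, Dirac's argument on chordal graphs yields,
  unless the graph is a hole or a single vertex, a simplicial vertex of degree 1 or 2. Removing it
  gives the construction sequence by induction, and likewise the structure of each block.\<close>

section \<open>Outerplanar drawings\<close>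

text \<open>Outerplanarity is given by arcs in the plane, so two combinatorial consequences are
  extracted once and the drawing is then forgotten. The exclusion of three disjoint connected sets
  between \<open>p\<close> and \<open>q\<close> is spent three times: on the attachments to a hole,
  which become pairwise adjacent and hence at most two; on a pair of holes, because removing so
  small a clique leaves a cycle connected, so that the rest of one hole lies in a single component
  beside the other; and on the side condition of (A2'), where a second induced cycle through
  \<open>vw\<close> would lead to a third link between \<open>v\<close> and \<open>w\<close> besides
  the new vertex and the first cycle. The exclusion of \<open>K_4\<close> bounds the degree of a
  simplicial vertex by 2. The combinatorial lemmas keep a fixed relation \<open>E\<close> and let
  only the vertex set shrink, so that induced subgraphs, components and deletions are all mere
  subsets.\<close>

definition arcs_between :: "complex \<Rightarrow> complex \<Rightarrow> (real \<Rightarrow> complex) \<Rightarrow> (real \<Rightarrow> complex) \<Rightarrow> bool" where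
  "arcs_between a b c d \<longleftrightarrow> arc c \<and> arc d \<and> pathstart c = a \<and> pathfinish c = b \<and>
     pathstart d = a \<and> pathfinish d = b \<and> path_image c \<inter> path_image d = {a, b}"

lemma arcs_between_sym: "arcs_between a b c d \<Longrightarrow> arcs_between a b d c"
  by (auto simp: arcs_between_def)

lemma arcs_between_loop:
  assumes "arcs_between a b c d"
  shows "simple_path (c +++ reversepath d)" "pathfinish (c +++ reversepath d) = pathstart (c +++ reversepath d)"
    "path_image (c +++ reversepath d) = path_image c \<union> path_image d"
  using assms unfolding arcs_between_def
  by (auto simp: simple_path_join_loop_eq arc_reversepath path_image_join)

lemma arcs_between_inside:
  assumes "arcs_between a b c d"
  shows "open (inside (path_image c \<union> path_image d))" "connected (inside (path_image c \<union> path_image d))"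
    "inside (path_image c \<union> path_image d) \<noteq> {}"
    "frontier (inside (path_image c \<union> path_image d)) = path_image c \<union> path_image d"
  using Jordan_inside_outside[OF arcs_between_loop(1,2)[OF assms]]
  unfolding arcs_between_loop(3)[OF assms] by auto

text \<open>The closed path \<open>c +++ reversepath d\<close> has winding number of norm 1 inside
  and 0 outside, and this number is the difference of those of the two arcs. Put in terms of single
  arcs, the criterion chains: among three arcs, equality for two pairs forces equality for the
  third.\<close>

lemma arcs_between_winding:
  assumes "arcs_between a b c d" "z \<notin> path_image c" "z \<notin> path_image d"
  shows "winding_number c z = winding_number d z \<longleftrightarrow> z \<notin> inside (path_image c \<union> path_image d)"
proof -
  note L = arcs_between_loop[OF assms(1)]
  have e: "winding_number (c +++ reversepath d) z = winding_number c z - winding_number d z"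
    using assms unfolding arcs_between_def
    by (subst winding_number_join) (auto simp: arc_imp_path winding_number_reversepath)
  show ?thesis
  proof (cases "z \<in> inside (path_image c \<union> path_image d)")
    case True
    then have "norm (winding_number (c +++ reversepath d) z) = 1"
      using simple_closed_path_norm_winding_number_inside[OF L(1)] L(3) by simp
    then show ?thesis using True e by auto
  next
    case False
    then have "z \<in> outside (path_image c \<union> path_image d)"
      using assms(2,3) inside_Un_outside by blast
    then have "winding_number (c +++ reversepath d) z = 0"
      by (metis L simple_path_imp_path winding_number_zero_in_outside)
    then show ?thesis using False e by auto
  qed
qed

text \<open>The arc without its ends is connected and misses the frontier of the interior, so one
  point inside brings all of it inside.\<close>

lemma arcs_between_crossing_subset:
  assumes "arcs_between a b c d" "arcs_between a b c e" "arcs_between a b d e"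
    and "path_image e \<inter> inside (path_image c \<union> path_image d) \<noteq> {}"
  shows "path_image e - {a, b} \<subseteq> inside (path_image c \<union> path_image d)"
proof -
  let ?I = "inside (path_image c \<union> path_image d)"
  have ab: "a \<in> path_image c" "b \<in> path_image c"
    using assms(1) by (auto simp: arcs_between_def)
  have "connected (path_image e - {a, b})"
    using assms(2) connected_simple_path_endless[of e] by (auto simp: arcs_between_def arc_imp_simple_path)
  moreover have "(path_image e - {a, b}) \<inter> frontier ?I = {}"
    using assms arcs_between_inside(4)[OF assms(1)] by (auto simp: arcs_between_def)
  moreover have "(path_image e - {a, b}) \<inter> ?I \<noteq> {}"
    using assms(4) ab inside_no_overlap[of "path_image c \<union> path_image d"] by blast
  ultimately show ?thesis
    using connected_Int_frontier[of "path_image e - {a,b}" ?I] by blast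
qed

text \<open>The first interior is connected and contains no point of the second loop, which is the
  frontier of the second interior. Used in both directions, this gives equality of the
  interiors.\<close>

lemma inside_eq_if_no_crossing:
  assumes "arcs_between a b c d" "arcs_between a b c e"
    and "path_image e \<inter> inside (path_image c \<union> path_image d) = {}"
    and "inside (path_image c \<union> path_image d) \<inter> inside (path_image c \<union> path_image e) \<noteq> {}"
  shows "inside (path_image c \<union> path_image d) \<subseteq> inside (path_image c \<union> path_image e)"
proof -
  have "inside (path_image c \<union> path_image d) \<inter> (path_image c \<union> path_image e) = {}"
    using assms(3) inside_no_overlap[of "path_image c \<union> path_image d"] by blast
  then show ?thesis
    using connected_Int_frontier[OF arcs_between_inside(2)[OF assms(1)] assms(4)] arcs_between_inside(4)[OF assms(2)]
    by blast
qed

text \<open>Outside the three arcs, the three differences of winding numbers add up to zero, so a point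
  inside one of the three loops lies inside a second one. Two loops whose interiors meet although no
  arc enters the interior of the other loop have the same interior, hence the same frontier.\<close>

lemma theta_crossing:
  assumes cd: "arcs_between a b c d" and ce: "arcs_between a b c e" and de: "arcs_between a b d e"
  shows "path_image e \<inter> inside (path_image c \<union> path_image d) \<noteq> {} \<or>
    path_image d \<inter> inside (path_image c \<union> path_image e) \<noteq> {} \<or>
    path_image c \<inter> inside (path_image d \<union> path_image e) \<noteq> {}"
proof (rule ccontr)
  assume "\<not> ?thesis"
  then have n: "path_image e \<inter> inside (path_image c \<union> path_image d) = {}"
    "path_image d \<inter> inside (path_image c \<union> path_image e) = {}"
    "path_image c \<inter> inside (path_image d \<union> path_image e) = {}" by auto
  \<comment> \<open>Stated for fresh arcs because it is used twice, with \<open>c\<close> and with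
    \<open>d\<close> as the arc common to both loops.\<close>
  have meet: "False" if cd: "arcs_between a b c d" and ce: "arcs_between a b c e" and de: "arcs_between a b d e"
    and n: "path_image e \<inter> inside (path_image c \<union> path_image d) = {}"
      "path_image d \<inter> inside (path_image c \<union> path_image e) = {}"
    and m: "inside (path_image c \<union> path_image d) \<inter> inside (path_image c \<union> path_image e) \<noteq> {}" for c d e
  proof -
    have "inside (path_image c \<union> path_image d) = inside (path_image c \<union> path_image e)"
      using inside_eq_if_no_crossing[OF cd ce n(1) m] inside_eq_if_no_crossing[OF ce cd n(2)] m by blast
    then have eq: "path_image c \<union> path_image d = path_image c \<union> path_image e"
      using arcs_between_inside(4)[OF cd] arcs_between_inside(4)[OF ce] by metis
    have "path_image d - {a, b} \<noteq> {}"
      using nonempty_simple_path_endless[OF arc_imp_simple_path, of d] cd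
      unfolding arcs_between_def by metis
    moreover have "path_image c \<inter> path_image d = {a, b}" "path_image d \<inter> path_image e = {a, b}"
      using cd de by (auto simp: arcs_between_def)
    ultimately show False using eq by blast
  qed
  obtain z where z: "z \<in> inside (path_image c \<union> path_image d)"
    using arcs_between_inside(3)[OF cd] by blast
  then have zn: "z \<notin> path_image c" "z \<notin> path_image d" "z \<notin> path_image e"
    using n(1) inside_no_overlap[of "path_image c \<union> path_image d"] by blast+
  then have "winding_number c z \<noteq> winding_number d z"
    using arcs_between_winding[OF cd] z by auto
  then have "z \<in> inside (path_image c \<union> path_image e) \<or> z \<in> inside (path_image d \<union> path_image e)"
    using arcs_between_winding[OF ce zn(1,3)] arcs_between_winding[OF de zn(2,3)] by metis
  then show False
  proof
    assume "z \<in> inside (path_image c \<union> path_image e)"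
    with z have "inside (path_image c \<union> path_image d) \<inter> inside (path_image c \<union> path_image e) \<noteq> {}" by blast
    from meet[OF cd ce de n(1,2) this] show False .
  next
    assume "z \<in> inside (path_image d \<union> path_image e)"
    with z have "inside (path_image d \<union> path_image c) \<inter> inside (path_image d \<union> path_image e) \<noteq> {}"
      by (auto simp: Un_commute)
    from meet[OF arcs_between_sym[OF cd] de ce _ n(3) this] show False
      using n(1) by (simp add: Un_commute)
  qed
qed

lemma theta_inside:
  assumes "arcs_between a b c d" "arcs_between a b c e" "arcs_between a b d e"
  shows "path_image e - {a, b} \<subseteq> inside (path_image c \<union> path_image d) \<or>
    path_image d - {a, b} \<subseteq> inside (path_image c \<union> path_image e) \<or>
    path_image c - {a, b} \<subseteq> inside (path_image d \<union> path_image e)"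
  using theta_crossing[OF assms] arcs_between_crossing_subset[OF assms]
    arcs_between_crossing_subset[OF assms(2,1) arcs_between_sym[OF assms(3)]]
    arcs_between_crossing_subset[OF assms(3) arcs_between_sym[OF assms(1)] arcs_between_sym[OF assms(2)]]
  by (auto simp: Un_commute)

text \<open>Enlarging a closed curve to \<open>X\<close> only shrinks the outside, so the outside of
  \<open>X\<close> misses the interior of the loop. That interior is open and therefore also misses
  the closure.\<close>

lemma outer_point_not_inside:
  assumes "arcs_between a b c d" "path_image c \<union> path_image d \<subseteq> X" "z \<in> closure (outside X)"
  shows "z \<notin> inside (path_image c \<union> path_image d)"
proof
  let ?I = "inside (path_image c \<union> path_image d)"
  assume "z \<in> ?I"
  moreover have "?I \<inter> outside X = {}"
    using outside_mono[OF assms(2)] inside_Int_outside by blast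
  ultimately show False
    using assms(3) arcs_between_inside(1)[OF assms(1)] open_Int_closure_eq_empty[of ?I "outside X"] by blast
qed

text \<open>The chord \<open>e\<close> divides the interior of the loop into two halves, and
  \<open>g\<close>, which misses \<open>e\<close>, runs within one of them. Both ends of
  \<open>g\<close> then lie in the closure of that half, although one of them sits on the arc
  opposite to it; by \<open>out\<close> this end is not interior to the half either.\<close>

lemma crossing_arcs_in_loop:
  assumes cd: "arcs_between a b c d" and ce: "arcs_between a b c e" and de: "arcs_between a b d e"
    and e: "path_image e - {a, b} \<subseteq> inside (path_image c \<union> path_image d)"
    and g: "arc g" "path_image g - {pathstart g, pathfinish g} \<subseteq> inside (path_image c \<union> path_image d)"
      "path_image g \<inter> path_image e = {}"
    and s: "pathstart g \<in> path_image c" "pathfinish g \<in> path_image d"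
    and out: "pathstart g \<notin> inside (path_image d \<union> path_image e)" "pathfinish g \<notin> inside (path_image c \<union> path_image e)"
  shows False
proof -
  let ?g = "path_image g - {pathstart g, pathfinish g}"
  have ab: "a \<noteq> b" using cd arc_distinct_ends by (force simp: arcs_between_def)
  have "path_image e \<inter> inside (path_image c \<union> path_image d) \<noteq> {}"
    using e nonempty_simple_path_endless[of e] ce by (fastforce simp: arcs_between_def arc_imp_simple_path)
  then obtain split: "inside (path_image c \<union> path_image e) \<inter> inside (path_image d \<union> path_image e) = {}"
    "inside (path_image c \<union> path_image e) \<union> inside (path_image d \<union> path_image e) \<union> (path_image e - {a,b})
      = inside (path_image c \<union> path_image d)"
    using split_inside_simple_closed_curve[of c a b d e] cd ce de ab
    unfolding arcs_between_def by (metis arc_imp_simple_path)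
  have g0: "connected ?g"
    by (rule connected_simple_path_endless[OF arc_imp_simple_path[OF g(1)]])
  have cl: "pathstart g \<in> closure ?g" "pathfinish g \<in> closure ?g"
  proof -
    have "path_image g \<subseteq> closure ?g"
    proof -
      have "simple_path g" using g(1) arc_imp_simple_path by blast
      then have "?g = g ` {0<..<1}" by (rule simple_path_endless)
      moreover have "g ` closure {0<..<1} \<subseteq> closure (g ` {0<..<1})"
        using g(1) by (intro continuous_image_closure_subset[of "{0..1}"]) (auto simp: arc_def path_def)
      ultimately show ?thesis by (simp add: path_image_def)
    qed
    then show "pathstart g \<in> closure ?g" "pathfinish g \<in> closure ?g" by auto
  qed
  have "?g \<subseteq> inside (path_image c \<union> path_image e) \<union> inside (path_image d \<union> path_image e)"
    using g(2,3) split(2) by blast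
  then have "?g \<subseteq> inside (path_image c \<union> path_image e) \<or> ?g \<subseteq> inside (path_image d \<union> path_image e)"
    using connectedD[OF g0 arcs_between_inside(1)[OF ce] arcs_between_inside(1)[OF de]] split(1) by blast
  then show False
  proof
    assume "?g \<subseteq> inside (path_image c \<union> path_image e)"
    then have "pathfinish g \<in> closure (inside (path_image c \<union> path_image e))"
      using cl(2) closure_mono by blast
    then have "pathfinish g \<in> path_image c"
      using closure_Un_frontier[of "inside (path_image c \<union> path_image e)"] arcs_between_inside(4)[OF ce] out g(3) by auto
    then have "pathfinish g \<in> {a, b}" using s(2) cd by (auto simp: arcs_between_def)
    then show False using g(3) ce by (auto simp: arcs_between_def)
  next
    assume "?g \<subseteq> inside (path_image d \<union> path_image e)"
    then have "pathstart g \<in> closure (inside (path_image d \<union> path_image e))"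
      using cl(1) closure_mono by blast
    then have "pathstart g \<in> path_image d"
      using closure_Un_frontier[of "inside (path_image d \<union> path_image e)"] arcs_between_inside(4)[OF de] out g(3) by auto
    then have "pathstart g \<in> {a, b}" using s(1) cd by (auto simp: arcs_between_def)
    then show False using g(3) ce by (auto simp: arcs_between_def)
  qed
qed

text \<open>Connectedness of a vertex set is expressed by cuts, which avoids reasoning about paths.\<close>

definition con :: "('a \<Rightarrow> 'a \<Rightarrow> bool) \<Rightarrow> 'a set \<Rightarrow> bool" where
  "con E A \<longleftrightarrow> (\<forall>X\<subseteq>A. X \<noteq> {} \<longrightarrow> X \<noteq> A \<longrightarrow> (\<exists>a\<in>X. \<exists>b\<in>A - X. E a b))"

lemma conI: "(\<And>X. X \<subseteq> A \<Longrightarrow> X \<noteq> {} \<Longrightarrow> X \<noteq> A \<Longrightarrow> \<exists>a\<in>X. \<exists>b\<in>A - X. E a b) \<Longrightarrow> con E A"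
  by (auto simp: con_def)

lemma conE:
  assumes "con E A" "X \<subseteq> A" "X \<noteq> {}" "X \<noteq> A"
  obtains a b where "a \<in> X" "b \<in> A" "b \<notin> X" "E a b"
  using assms unfolding con_def by blast

lemma con_closed_eq:
  assumes "con E A" "X \<subseteq> A" "X \<noteq> {}" "\<And>a b. a \<in> X \<Longrightarrow> b \<in> A \<Longrightarrow> E a b \<Longrightarrow> b \<in> X"
  shows "X = A"
  using conE[OF assms(1-3)] assms(4) by metis

lemma con_closed_subset:
  assumes "con E A" "A \<inter> X \<noteq> {}" "\<And>a b. a \<in> A \<inter> X \<Longrightarrow> b \<in> A \<Longrightarrow> E a b \<Longrightarrow> b \<in> X"
  shows "A \<subseteq> X"
  using con_closed_eq[OF assms(1), of "A \<inter> X"] assms(2,3) by blast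

lemma con_empty [simp]: "con E {}" and con_singleton [simp]: "con E {x}"
  by (auto simp: con_def)

text \<open>The link between cuts and walks: the set of vertices reached from \<open>u\<close> has
  no edge leaving it. Only the target of each step is required to lie in \<open>A\<close>, since the
  start already does.\<close>

lemma con_iff_rtranclp:
  "con E A \<longleftrightarrow> (\<forall>u\<in>A. \<forall>v\<in>A. (\<lambda>a b. E a b \<and> b \<in> A)\<^sup>*\<^sup>* u v)"
proof
  assume c: "con E A"
  show "\<forall>u\<in>A. \<forall>v\<in>A. (\<lambda>a b. E a b \<and> b \<in> A)\<^sup>*\<^sup>* u v"
  proof (intro ballI)
    fix u v assume u: "u \<in> A" "v \<in> A"
    let ?X = "{w\<in>A. (\<lambda>a b. E a b \<and> b \<in> A)\<^sup>*\<^sup>* u w}"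
    have "?X = A"
      by (rule con_closed_eq[OF c]) (use u in \<open>auto intro: rtranclp.rtrancl_into_rtrancl\<close>)
    then show "(\<lambda>a b. E a b \<and> b \<in> A)\<^sup>*\<^sup>* u v" using u by blast
  qed
next
  assume r: "\<forall>u\<in>A. \<forall>v\<in>A. (\<lambda>a b. E a b \<and> b \<in> A)\<^sup>*\<^sup>* u v"
  show "con E A"
  proof (rule conI, rule ccontr)
    fix X assume X: "X \<subseteq> A" "X \<noteq> {}" "X \<noteq> A" and n: "\<not> (\<exists>a\<in>X. \<exists>b\<in>A - X. E a b)"
    obtain u v where uv: "u \<in> X" "v \<in> A" "v \<notin> X" using X by blast
    then have "(\<lambda>a b. E a b \<and> b \<in> A)\<^sup>*\<^sup>* u v" using r X by blast
    then have "v \<in> X" by (induction rule: rtranclp_induct) (use uv n in auto)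
    with uv show False by blast
  qed
qed

text \<open>This excludes \<open>K_{2,3}\<close> as a minor whose two vertices of degree 3 are the
  single vertices \<open>p\<close> and \<open>q\<close>, with \<open>A\<close>, \<open>B\<close>,
  \<open>C\<close> as the other branch sets. Edges among \<open>A\<close>, \<open>B\<close>,
  \<open>C\<close> and the edge \<open>pq\<close> are permitted, so it is a condition on minors and
  not on induced minors.\<close>

definition theta_free :: "('a \<Rightarrow> 'a \<Rightarrow> bool) \<Rightarrow> 'a set \<Rightarrow> bool" where
  "theta_free E V \<longleftrightarrow> (\<forall>p\<in>V. \<forall>q\<in>V. \<forall>A B C. p \<noteq> q \<longrightarrow>
     A \<subseteq> V - {p, q} \<longrightarrow> B \<subseteq> V - {p, q} \<longrightarrow> C \<subseteq> V - {p, q} \<longrightarrow>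
     A \<inter> B = {} \<longrightarrow> A \<inter> C = {} \<longrightarrow> B \<inter> C = {} \<longrightarrow> con E A \<longrightarrow> con E B \<longrightarrow> con E C \<longrightarrow>
     (\<exists>x\<in>A. E p x) \<longrightarrow> (\<exists>x\<in>A. E q x) \<longrightarrow> (\<exists>x\<in>B. E p x) \<longrightarrow> (\<exists>x\<in>B. E q x) \<longrightarrow>
     (\<exists>x\<in>C. E p x) \<longrightarrow> (\<exists>x\<in>C. E q x) \<longrightarrow> False)"

definition K4_free :: "('a \<Rightarrow> 'a \<Rightarrow> bool) \<Rightarrow> 'a set \<Rightarrow> bool" where
  "K4_free E V \<longleftrightarrow> (\<forall>a\<in>V. \<forall>b\<in>V. \<forall>c\<in>V. \<forall>d\<in>V.
     E a b \<longrightarrow> E a c \<longrightarrow> E a d \<longrightarrow> E b c \<longrightarrow> E b d \<longrightarrow> E c d \<longrightarrow> False)"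

section \<open>Parts of a plane drawing as point sets\<close>

lemma graph_adj:
  assumes "graph G" "adj G u v"
  shows "u \<in> fst G" "v \<in> fst G" "u \<noteq> v"
  using assms unfolding graph_def adj_def by (fastforce simp: doubleton_eq_iff)+

lemma adj_sym: "adj G u v \<longleftrightarrow> adj G v u"
  by (simp add: adj_def insert_commute)

lemma graph_finite_edges:
  assumes "graph G" shows "finite (snd G)"
proof -
  have "snd G \<subseteq> Pow (fst G)" using assms by (auto simp: graph_def)
  then show ?thesis using assms finite_subset by (auto simp: graph_def)
qed

lemma drawing_edge:
  assumes "graph G" "plane_drawing G f \<gamma>" "adj G u v"
  shows "arc (\<gamma> {u, v})" "f u \<in> path_image (\<gamma> {u, v})" "f v \<in> path_image (\<gamma> {u, v})"
    "w \<in> fst G \<Longrightarrow> f w \<in> path_image (\<gamma> {u, v}) \<Longrightarrow> w = u \<or> w = v"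
    "{pathstart (\<gamma> {u, v}), pathfinish (\<gamma> {u, v})} = {f u, f v}"
proof -
  have e: "{u, v} \<in> snd G" using assms(3) by (simp add: adj_def)
  note d = assms(2)[unfolded plane_drawing_def]
  show "arc (\<gamma> {u, v})" using d e by blast
  show ends: "{pathstart (\<gamma> {u, v}), pathfinish (\<gamma> {u, v})} = {f u, f v}" using d e by auto
  then show "f u \<in> path_image (\<gamma> {u, v})" "f v \<in> path_image (\<gamma> {u, v})"
    by (metis insert_iff pathfinish_in_path_image pathstart_in_path_image singletonD)+
  assume w: "w \<in> fst G" "f w \<in> path_image (\<gamma> {u, v})"
  then have "f w \<in> f ` {u, v}" using d e by blast
  moreover have "inj_on f (fst G)" using d by blast
  ultimately show "w = u \<or> w = v"
    using w graph_adj[OF assms(1,3)] by (auto dest: inj_onD)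
qed

lemma drawing_edges_meet:
  assumes "plane_drawing G f \<gamma>" "e \<in> snd G" "e' \<in> snd G" "e \<noteq> e'"
    "z \<in> path_image (\<gamma> e)" "z \<in> path_image (\<gamma> e')"
  shows "z \<in> f ` (e \<inter> e')"
  using assms unfolding plane_drawing_def by blast

lemma path_connected_drawing:
  assumes G: "graph G" "plane_drawing G f \<gamma>" and c: "con (adj G) A"
  shows "path_connected (f ` A \<union> (\<Union>e\<in>{e\<in>snd G. e \<subseteq> A}. path_image (\<gamma> e)))"
    (is "path_connected ?X")
proof -
  have v: "path_component ?X (f u) (f w)" if "u \<in> A" "w \<in> A" for u w
  proof -
    have "(\<lambda>a b. adj G a b \<and> b \<in> A)\<^sup>*\<^sup>* u w" using c that by (auto simp: con_iff_rtranclp)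
    then have "w \<in> A \<and> path_component ?X (f u) (f w)"
    proof (induction rule: rtranclp_induct)
      case base then show ?case using \<open>u \<in> A\<close> by (auto simp: path_component_refl_eq)
    next
      case (step y z)
      have "path_connected (path_image (\<gamma> {y, z}))"
        using drawing_edge(1)[OF G, of y z] step by (simp add: arc_imp_path path_connected_path_image)
      moreover have "path_image (\<gamma> {y, z}) \<subseteq> ?X"
        using step by (auto simp: adj_def)
      moreover have "f y \<in> path_image (\<gamma> {y, z})" "f z \<in> path_image (\<gamma> {y, z})"
        using drawing_edge(2,3)[OF G, of y z] step by auto
      ultimately have "path_component ?X (f y) (f z)"
        unfolding path_connected_component by (meson path_component_of_subset)
      then show ?case using step(2,3) path_component_trans[of ?X "f u" "f y" "f z"] by blast
    qed
    then show ?thesis by blast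
  qed
  have e: "\<exists>u\<in>A. path_component ?X x (f u)" if xX: "x \<in> ?X" for x
  proof (cases "x \<in> f ` A")
    case True then show ?thesis using v by blast
  next
    case False
    then obtain e where e: "e \<in> snd G" "e \<subseteq> A" "x \<in> path_image (\<gamma> e)" using xX by blast
    then obtain a b where ab: "e = {a, b}" using G(1) by (auto simp: graph_def)
    then have adj: "adj G a b" using e by (simp add: adj_def)
    have "path_component (path_image (\<gamma> e)) x (f a)"
      using path_connected_path_image[of "\<gamma> e"] drawing_edge(1,2)[OF G adj] e(3) ab
      by (metis arc_imp_path path_connected_component)
    moreover have "path_image (\<gamma> e) \<subseteq> ?X" using e by blast
    ultimately show ?thesis using ab e(2) path_component_of_subset by blast
  qed
  show ?thesis
    unfolding path_connected_component
  proof (intro ballI)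
    fix x y assume xy: "x \<in> ?X" "y \<in> ?X"
    obtain u where u: "u \<in> A" "path_component ?X x (f u)" using e[OF xy(1)] by blast
    obtain w where w: "w \<in> A" "path_component ?X y (f w)" using e[OF xy(2)] by blast
    show "path_component ?X x y"
      by (rule path_component_trans[OF u(2) path_component_trans[OF v[OF u(1) w(1)] path_component_sym[OF w(2)]]])
  qed
qed

text \<open>Drawing \<open>A\<close> together with one edge at \<open>p\<close> and one at
  \<open>q\<close> gives a path-connected set, which contains an arc. The last conclusion matters
  most: the arc carries a vertex of \<open>A\<close>, and it is this vertex that an outerplanar
  drawing cannot enclose.\<close>

lemma arc_through:
  assumes G: "graph G" "plane_drawing G f \<gamma>" and c: "con (adj G) A"
    and pq: "p \<noteq> q" "p \<notin> A" "q \<notin> A" "\<exists>x\<in>A. adj G p x" "\<exists>x\<in>A. adj G q x"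
    and A: "A \<subseteq> fst G"
  obtains g where "arc g" "pathstart g = f p" "pathfinish g = f q"
    "path_image g \<subseteq> f ` insert p (insert q A) \<union>
       (\<Union>e\<in>{e\<in>snd G. e \<subseteq> insert p (insert q A) \<and> e \<inter> A \<noteq> {}}. path_image (\<gamma> e))"
    "\<exists>a\<in>A. f a \<in> path_image g"
proof -
  obtain x y where x: "x \<in> A" "adj G p x" and y: "y \<in> A" "adj G q y" using pq by blast
  let ?Y = "f ` A \<union> (\<Union>e\<in>{e\<in>snd G. e \<subseteq> A}. path_image (\<gamma> e))"
  let ?P = "path_image (\<gamma> {p, x})" and ?Q = "path_image (\<gamma> {q, y})"
  have dp: "arc (\<gamma> {p, x})" "f p \<in> ?P" "f x \<in> ?P" using drawing_edge[OF G x(2)] by auto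
  have dq: "arc (\<gamma> {q, y})" "f q \<in> ?Q" "f y \<in> ?Q" using drawing_edge[OF G y(2)] by auto
  have pcPY: "path_connected (?P \<union> ?Y)"
    by (rule path_connected_Un[OF path_connected_path_image[OF arc_imp_path[OF dp(1)]]
        path_connected_drawing[OF G c]]) (use dp(3) x in blast)
  have pc: "path_connected ((?P \<union> ?Y) \<union> ?Q)"
    by (rule path_connected_Un[OF pcPY path_connected_path_image[OF arc_imp_path[OF dq(1)]]])
      (use dq(3) y in blast)
  have pV: "p \<in> fst G" "q \<in> fst G" using graph_adj[OF G(1)] x y by blast+
  have inj: "inj_on f (fst G)" using G(2) by (simp add: plane_drawing_def)
  have ne: "f p \<noteq> f q" using inj pV pq(1) by (auto dest: inj_onD)
  obtain g where g: "arc g" "path_image g \<subseteq> (?P \<union> ?Y) \<union> ?Q" "pathstart g = f p" "pathfinish g = f q"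
    using pc ne dp(2) dq(2) unfolding path_connected_arcwise by blast
  have e: "{p, x} \<in> snd G" "{q, y} \<in> snd G" using x y by (auto simp: adj_def)
  have sub: "path_image g \<subseteq> f ` insert p (insert q A) \<union>
       (\<Union>e\<in>{e\<in>snd G. e \<subseteq> insert p (insert q A) \<and> e \<inter> A \<noteq> {}}. path_image (\<gamma> e))" (is "_ \<subseteq> ?Z")
  proof -
    have "e \<inter> A \<noteq> {}" if "e \<in> snd G" "e \<subseteq> A" for e using that G(1) by (auto simp: graph_def)
    then have "?Y \<subseteq> ?Z"
      by (intro Un_mono UN_mono image_mono) auto
    moreover have "?P \<subseteq> ?Z" "?Q \<subseteq> ?Z"
      by (rule le_supI2, rule UN_upper, use x y e in simp)+
    ultimately have "(?P \<union> ?Y) \<union> ?Q \<subseteq> ?Z" by simp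
    with g(2) show ?thesis by (rule subset_trans)
  qed
  \<comment> \<open>Otherwise the arc is covered by two closed sets, the first edge and all the
    rest. They meet only at drawn vertices of \<open>A\<close>, which the arc avoids, and each of
    them contains an end of the arc; so the arc would be disconnected.\<close>
  have "\<exists>a\<in>A. f a \<in> path_image g"
  proof (rule ccontr)
    assume n: "\<not> ?thesis"
    let ?R = "(\<Union>e\<in>{e\<in>snd G. e \<subseteq> A}. path_image (\<gamma> e)) \<union> ?Q"
    have cov: "path_image g \<subseteq> ?P \<union> ?R" using g(2) n by blast
    have "closed (path_image (\<gamma> e))" if "e \<in> snd G" for e
      using that G(2) unfolding plane_drawing_def by (blast intro: closed_arc_image)
    then have cl: "closed ?P" "closed ?R"
      using e graph_finite_edges[OF G(1)] by (auto intro!: closed_Union closed_Un)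
    have "?P \<inter> path_image (\<gamma> e) \<subseteq> f ` A" if "e \<in> snd G" "e \<subseteq> A \<or> e = {q, y}" for e
    proof
      fix z assume z: "z \<in> ?P \<inter> path_image (\<gamma> e)"
      have "p \<notin> e" using that(2) pq y by auto
      then have "z \<in> f ` ({p, x} \<inter> e)"
        using z e(1) that(1) by (intro drawing_edges_meet[OF G(2)]) auto
      then show "z \<in> f ` A" using \<open>p \<notin> e\<close> x by auto
    qed
    then have "?P \<inter> ?R \<subseteq> f ` A" using e by blast
    then have disj: "?P \<inter> ?R \<inter> path_image g = {}" using n by blast
    have "connected (path_image g)" using g(1) by (simp add: arc_imp_path connected_path_image)
    then have "?P \<inter> path_image g = {} \<or> ?R \<inter> path_image g = {}"
      using cl disj cov unfolding connected_closed by blast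
    moreover have "f p \<in> path_image g" "f q \<in> path_image g"
      using g(3,4) by (metis pathstart_in_path_image pathfinish_in_path_image)+
    ultimately show False using dp(2) dq(2) by blast
  qed
  from that[OF g(1,3,4) sub this] show ?thesis .
qed

text \<open>Disjointness of the edge families keeps whole edges out of the intersection. Two
  distinct edges, or an edge and a vertex, can meet only in a drawn vertex that belongs to
  both.\<close>

lemma drawing_sets_meet:
  assumes G: "graph G" "plane_drawing G f \<gamma>" and S: "S \<subseteq> fst G" "T \<subseteq> fst G"
    and E: "\<forall>e\<in>F. e \<in> snd G \<and> e \<subseteq> S" "\<forall>e\<in>H. e \<in> snd G \<and> e \<subseteq> T" "F \<inter> H = {}"
  shows "(f ` S \<union> (\<Union>e\<in>F. path_image (\<gamma> e))) \<inter> (f ` T \<union> (\<Union>e\<in>H. path_image (\<gamma> e))) \<subseteq> f ` (S \<inter> T)"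
proof -
  have inj: "inj_on f (fst G)" using G(2) by (simp add: plane_drawing_def)
  have vv: "f ` S \<inter> f ` T \<subseteq> f ` (S \<inter> T)" using inj S by (auto dest: inj_onD)
  have ve: "f ` U \<inter> path_image (\<gamma> e) \<subseteq> f ` (U \<inter> W)"
    if U: "U \<subseteq> fst G" "W \<subseteq> fst G" "e \<in> snd G" "e \<subseteq> W" for U W e
  proof -
    have "path_image (\<gamma> e) \<inter> f ` fst G = f ` e" using G(2) U(3) by (simp add: plane_drawing_def)
    then have "f ` U \<inter> path_image (\<gamma> e) \<subseteq> f ` U \<inter> f ` W" using U by blast
    also have "\<dots> \<subseteq> f ` (U \<inter> W)" using inj U by (auto dest: inj_onD)
    finally show ?thesis .
  qed
  have ee: "path_image (\<gamma> e) \<inter> path_image (\<gamma> e') \<subseteq> f ` (S \<inter> T)" if "e \<in> F" "e' \<in> H" for e e'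
  proof -
    have "e \<noteq> e'" using that E(3) by blast
    then have "path_image (\<gamma> e) \<inter> path_image (\<gamma> e') \<subseteq> f ` (e \<inter> e')"
      using that E(1,2) drawing_edges_meet[OF G(2), of e e'] by blast
    also have "\<dots> \<subseteq> f ` (S \<inter> T)"
      using that E(1,2) by (intro image_mono Int_mono) auto
    finally show ?thesis .
  qed
  show ?thesis
  proof
    fix z assume z: "z \<in> (f ` S \<union> (\<Union>e\<in>F. path_image (\<gamma> e))) \<inter> (f ` T \<union> (\<Union>e\<in>H. path_image (\<gamma> e)))"
    then consider "z \<in> f ` S" "z \<in> f ` T" | e where "z \<in> f ` S" "e \<in> H" "z \<in> path_image (\<gamma> e)"
      | e where "e \<in> F" "z \<in> path_image (\<gamma> e)" "z \<in> f ` T"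
      | e e' where "e \<in> F" "z \<in> path_image (\<gamma> e)" "e' \<in> H" "z \<in> path_image (\<gamma> e')"
      by auto
    then show "z \<in> f ` (S \<inter> T)"
    proof cases
      case 1 then show ?thesis using vv by blast
    next
      case 2 then show ?thesis using ve[OF S, of e] E(2) by blast
    next
      case 3 then show ?thesis using ve[OF S(2,1), of e] E(1) by blast
    next
      case 4 then show ?thesis using ee[of e e'] by blast
    qed
  qed
qed

text \<open>Arcs through \<open>A\<close>, \<open>B\<close> and \<open>C\<close> form a theta curve,
  and one of them runs inside the loop of the other two. It takes a vertex of its set along, but
  every vertex lies in the closure of the outside.\<close>

lemma outerplanar_theta_free:
  assumes "graph G" "outerplanar G"
  shows "theta_free (adj G) (fst G)"
  unfolding theta_free_def
proof (intro ballI allI impI)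
  fix p q A B C
  assume pq: "p \<in> fst G" "q \<in> fst G" "p \<noteq> q"
    and sub: "A \<subseteq> fst G - {p, q}" "B \<subseteq> fst G - {p, q}" "C \<subseteq> fst G - {p, q}"
    and disj: "A \<inter> B = {}" "A \<inter> C = {}" "B \<inter> C = {}"
    and cn: "con (adj G) A" "con (adj G) B" "con (adj G) C"
    and nb: "\<exists>x\<in>A. adj G p x" "\<exists>x\<in>A. adj G q x" "\<exists>x\<in>B. adj G p x" "\<exists>x\<in>B. adj G q x"
      "\<exists>x\<in>C. adj G p x" "\<exists>x\<in>C. adj G q x"
  obtain f \<gamma> where d: "plane_drawing G f \<gamma>"
    and out: "\<forall>v\<in>fst G. f v \<in> closure (outside (drawing_image G f \<gamma>))"
    using assms(2) by (auto simp: outerplanar_def)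
  have inj: "inj_on f (fst G)" using d by (simp add: plane_drawing_def)
  \<comment> \<open>An edge must meet \<open>D\<close> to count. This leaves out the edge
    \<open>pq\<close>, so disjoint sets \<open>D\<close> use disjoint edge families, as
    \<open>drawing_sets_meet\<close> demands.\<close>
  define X where "X D = f ` insert p (insert q D) \<union>
       (\<Union>e\<in>{e\<in>snd G. e \<subseteq> insert p (insert q D) \<and> e \<inter> D \<noteq> {}}. path_image (\<gamma> e))" for D
  have X: "X D \<subseteq> drawing_image G f \<gamma>" if "D \<subseteq> fst G - {p, q}" for D
    using that pq unfolding X_def drawing_image_def by blast
  have meet: "X D \<inter> X D' \<subseteq> {f p, f q}" if "D \<subseteq> fst G - {p, q}" "D' \<subseteq> fst G - {p, q}" "D \<inter> D' = {}" for D D'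
  proof -
    have "X D \<inter> X D' \<subseteq> f ` (insert p (insert q D) \<inter> insert p (insert q D'))"
      unfolding X_def using that pq by (intro drawing_sets_meet[OF assms(1) d]) auto
    also have "\<dots> \<subseteq> {f p, f q}" using that by auto
    finally show ?thesis .
  qed
  obtain g where g: "arc g" "pathstart g = f p" "pathfinish g = f q" "path_image g \<subseteq> X A" "\<exists>a\<in>A. f a \<in> path_image g"
    using arc_through[OF assms(1) d cn(1) pq(3) _ _ nb(1,2)] sub(1) unfolding X_def by blast
  obtain h where h: "arc h" "pathstart h = f p" "pathfinish h = f q" "path_image h \<subseteq> X B" "\<exists>a\<in>B. f a \<in> path_image h"
    using arc_through[OF assms(1) d cn(2) pq(3) _ _ nb(3,4)] sub(2) unfolding X_def by blast
  obtain k where k: "arc k" "pathstart k = f p" "pathfinish k = f q" "path_image k \<subseteq> X C" "\<exists>a\<in>C. f a \<in> path_image k"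
    using arc_through[OF assms(1) d cn(3) pq(3) _ _ nb(5,6)] sub(3) unfolding X_def by blast
  have pe: "f p \<in> path_image l \<and> f q \<in> path_image l" if "pathstart l = f p" "pathfinish l = f q" for l
    using that by (metis pathstart_in_path_image pathfinish_in_path_image)
  have gh: "arcs_between (f p) (f q) g h" and gk: "arcs_between (f p) (f q) g k" and hk: "arcs_between (f p) (f q) h k"
    using g h k meet[OF sub(1,2) disj(1)] meet[OF sub(1,3) disj(2)] meet[OF sub(2,3) disj(3)]
      pe[OF g(2,3)] pe[OF h(2,3)] pe[OF k(2,3)]
    unfolding arcs_between_def by blast+
  have no: False if ab: "arcs_between (f p) (f q) l m" "path_image l \<subseteq> X D" "path_image m \<subseteq> X D'"
      "D \<subseteq> fst G - {p, q}" "D' \<subseteq> fst G - {p, q}"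
      "path_image n - {f p, f q} \<subseteq> inside (path_image l \<union> path_image m)"
      and a': "\<exists>a\<in>D''. f a \<in> path_image n" and D'': "D'' \<subseteq> fst G - {p, q}" for l m n D D' D''
  proof -
    obtain a where a: "a \<in> D''" "f a \<in> path_image n" using a' by blast
    then have aV: "a \<in> fst G" "a \<noteq> p" "a \<noteq> q" using D'' by auto
    then have "f a \<notin> {f p, f q}" using inj pq by (auto dest: inj_onD)
    then have "f a \<in> inside (path_image l \<union> path_image m)" using a ab(6) by blast
    moreover have "path_image l \<union> path_image m \<subseteq> drawing_image G f \<gamma>" using X[OF ab(4)] X[OF ab(5)] ab(2,3) by blast
    ultimately show False using outer_point_not_inside[OF ab(1)] out aV by blast
  qed
  show False
    using theta_inside[OF gh gk hk] no[OF gh g(4) h(4) sub(1,2) _ k(5) sub(3)]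
      no[OF gk g(4) k(4) sub(1,3) _ h(5) sub(2)] no[OF hk h(4) k(4) sub(2,3) _ g(5) sub(1)] by blast
qed

lemma drawing_edge_arc:
  assumes "graph G" "plane_drawing G f \<gamma>" "adj G u v"
  obtains g where "arc g" "pathstart g = f u" "pathfinish g = f v" "path_image g = path_image (\<gamma> {u, v})"
proof -
  have "pathstart (\<gamma> {u, v}) = f u \<and> pathfinish (\<gamma> {u, v}) = f v \<or>
    pathstart (\<gamma> {u, v}) = f v \<and> pathfinish (\<gamma> {u, v}) = f u"
    using drawing_edge(5)[OF assms] by (auto simp: doubleton_eq_iff)
  then show ?thesis
    using that[of "\<gamma> {u, v}"] that[of "reversepath (\<gamma> {u, v})"] drawing_edge(1)[OF assms]
    by (auto simp: arc_reversepath)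
qed

text \<open>The routes from \<open>a\<close> to \<open>c\<close> over \<open>b\<close>, over
  \<open>d\<close> and along the edge \<open>ac\<close> form a theta curve, so one of them lies
  inside the loop of the others. The first two routes carry the vertices \<open>b\<close> and
  \<open>d\<close>, which no loop encloses; hence it is the edge.\<close>

lemma diamond_arcs:
  assumes G: "graph G" "plane_drawing G f \<gamma>"
    and out: "\<forall>v\<in>fst G. f v \<in> closure (outside (drawing_image G f \<gamma>))"
    and adj: "adj G a b" "adj G b c" "adj G a d" "adj G d c" "adj G a c" and bd: "b \<noteq> d"
  obtains l m e where "arcs_between (f a) (f c) l m" "arcs_between (f a) (f c) l e" "arcs_between (f a) (f c) m e"
    "path_image l = path_image (\<gamma> {a, b}) \<union> path_image (\<gamma> {b, c})"
    "path_image m = path_image (\<gamma> {a, d}) \<union> path_image (\<gamma> {d, c})"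
    "path_image e = path_image (\<gamma> {a, c})"
    "path_image e - {f a, f c} \<subseteq> inside (path_image l \<union> path_image m)"
    "\<forall>v\<in>fst G. f v \<notin> inside (path_image l \<union> path_image e) \<and> f v \<notin> inside (path_image m \<union> path_image e)"
proof -
  have V: "a \<in> fst G" "b \<in> fst G" "c \<in> fst G" "d \<in> fst G"
    and ne: "a \<noteq> b" "b \<noteq> c" "a \<noteq> d" "d \<noteq> c" "a \<noteq> c"
    using adj[THEN graph_adj(1)[OF G(1)]] adj[THEN graph_adj(2)[OF G(1)]] adj[THEN graph_adj(3)[OF G(1)]] by auto
  have E: "{a, b} \<in> snd G" "{b, c} \<in> snd G" "{a, d} \<in> snd G" "{d, c} \<in> snd G" "{a, c} \<in> snd G"
    using adj by (auto simp: adj_def)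
  have inj: "inj_on f (fst G)" using G(2) by (simp add: plane_drawing_def)
  have mt: "path_image (\<gamma> h) \<inter> path_image (\<gamma> h') \<subseteq> f ` (h \<inter> h')"
    if "h \<in> snd G" "h' \<in> snd G" "h \<noteq> h'" for h h'
    using drawing_edges_meet[OF G(2) that] by blast
  obtain ab where ab: "arc ab" "pathstart ab = f a" "pathfinish ab = f b" "path_image ab = path_image (\<gamma> {a, b})"
    using drawing_edge_arc[OF G adj(1)] .
  obtain bc where bc: "arc bc" "pathstart bc = f b" "pathfinish bc = f c" "path_image bc = path_image (\<gamma> {b, c})"
    using drawing_edge_arc[OF G adj(2)] .
  obtain ad where ad: "arc ad" "pathstart ad = f a" "pathfinish ad = f d" "path_image ad = path_image (\<gamma> {a, d})"
    using drawing_edge_arc[OF G adj(3)] .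
  obtain dc where dc: "arc dc" "pathstart dc = f d" "pathfinish dc = f c" "path_image dc = path_image (\<gamma> {d, c})"
    using drawing_edge_arc[OF G adj(4)] .
  obtain ac where ac: "arc ac" "pathstart ac = f a" "pathfinish ac = f c" "path_image ac = path_image (\<gamma> {a, c})"
    using drawing_edge_arc[OF G adj(5)] .
  \<comment> \<open>All ten pairs of the five edges. The odd entries give the common vertices and
    the even ones the distinctness, in the form that \<open>mt\<close> consumes below.\<close>
  have D: "{a, b} \<inter> {b, c} = {b}" "{a, b} \<noteq> {b, c}"
    "{a, d} \<inter> {d, c} = {d}" "{a, d} \<noteq> {d, c}"
    "{a, b} \<inter> {a, d} = {a}" "{a, b} \<noteq> {a, d}"
    "{a, b} \<inter> {d, c} = {}" "{a, b} \<noteq> {d, c}"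
    "{b, c} \<inter> {a, d} = {}" "{b, c} \<noteq> {a, d}"
    "{b, c} \<inter> {d, c} = {c}" "{b, c} \<noteq> {d, c}"
    "{a, b} \<inter> {a, c} = {a}" "{a, b} \<noteq> {a, c}"
    "{b, c} \<inter> {a, c} = {c}" "{b, c} \<noteq> {a, c}"
    "{a, d} \<inter> {a, c} = {a}" "{a, d} \<noteq> {a, c}"
    "{d, c} \<inter> {a, c} = {c}" "{d, c} \<noteq> {a, c}"
    using ne bd by auto
  have I: "path_image ab \<inter> path_image bc \<subseteq> {f b}"
    "path_image ad \<inter> path_image dc \<subseteq> {f d}"
    "path_image ab \<inter> path_image ad \<subseteq> {f a}"
    "path_image ab \<inter> path_image dc \<subseteq> {}"
    "path_image bc \<inter> path_image ad \<subseteq> {}"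
    "path_image bc \<inter> path_image dc \<subseteq> {f c}"
    "path_image ab \<inter> path_image ac \<subseteq> {f a}"
    "path_image bc \<inter> path_image ac \<subseteq> {f c}"
    "path_image ad \<inter> path_image ac \<subseteq> {f a}"
    "path_image dc \<inter> path_image ac \<subseteq> {f c}"
    using mt[OF E(1) E(2) D(2), unfolded D(1)]
      mt[OF E(3) E(4) D(4), unfolded D(3)]
      mt[OF E(1) E(3) D(6), unfolded D(5)]
      mt[OF E(1) E(4) D(8), unfolded D(7)]
      mt[OF E(2) E(3) D(10), unfolded D(9)]
      mt[OF E(2) E(4) D(12), unfolded D(11)]
      mt[OF E(1) E(5) D(14), unfolded D(13)]
      mt[OF E(2) E(5) D(16), unfolded D(15)]
      mt[OF E(3) E(5) D(18), unfolded D(17)]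
      mt[OF E(4) E(5) D(20), unfolded D(19)]
    unfolding ab(4) bc(4) ad(4) dc(4) ac(4) by simp_all
  let ?l = "ab +++ bc" and ?m = "ad +++ dc"
  have pl: "path_image ?l = path_image ab \<union> path_image bc" "path_image ?m = path_image ad \<union> path_image dc"
    using ab bc ad dc by (auto simp: path_image_join)
  have ends: "f a \<in> path_image ab" "f c \<in> path_image bc" "f a \<in> path_image ad" "f c \<in> path_image dc"
    "f a \<in> path_image ac" "f c \<in> path_image ac" "f b \<in> path_image ab" "f d \<in> path_image ad"
    using ab bc ad dc ac by (metis pathstart_in_path_image pathfinish_in_path_image)+
  have al: "arc ?l" "arc ?m"
    using ab bc ad dc I(1,2) by (auto intro!: arc_join)
  have "(path_image ab \<union> path_image bc) \<inter> (path_image ad \<union> path_image dc) = {f a, f c}"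
    "(path_image ab \<union> path_image bc) \<inter> path_image ac = {f a, f c}"
    "(path_image ad \<union> path_image dc) \<inter> path_image ac = {f a, f c}"
    using I(3-10) ends by blast+
  then have lm: "arcs_between (f a) (f c) ?l ?m" and le: "arcs_between (f a) (f c) ?l ac"
    and me: "arcs_between (f a) (f c) ?m ac"
    unfolding arcs_between_def pl using al ab bc ad dc ac by simp_all
  have sub: "path_image ?l \<subseteq> drawing_image G f \<gamma>" "path_image ?m \<subseteq> drawing_image G f \<gamma>" "path_image ac \<subseteq> drawing_image G f \<gamma>"
    unfolding pl ab(4) bc(4) ad(4) dc(4) ac(4) drawing_image_def using E by blast+
  have no: "f v \<notin> inside (path_image ?l \<union> path_image ac) \<and> f v \<notin> inside (path_image ?m \<union> path_image ac)"
    if "v \<in> fst G" for v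
    using outer_point_not_inside[OF le Un_least[OF sub(1,3)]] outer_point_not_inside[OF me Un_least[OF sub(2,3)]]
      out that by blast
  have "f b \<notin> {f a, f c}" "f d \<notin> {f a, f c}" using inj V ne by (auto dest: inj_onD)
  moreover have "f b \<in> path_image ?l" "f d \<in> path_image ?m" using ends pl by auto
  ultimately have "path_image ac - {f a, f c} \<subseteq> inside (path_image ?l \<union> path_image ?m)"
    using theta_inside[OF lm le me] no[OF V(2)] no[OF V(4)] by blast
  then show ?thesis
    using that[OF lm le me] no pl ab(4) bc(4) ad(4) dc(4) ac(4) by simp
qed

text \<open>The four-cycle \<open>a\<close>, \<open>b\<close>, \<open>c\<close>, \<open>d\<close> is
  one and the same loop whether it is cut at \<open>a\<close> and \<open>c\<close> or at
  \<open>b\<close> and \<open>d\<close>. So both diagonals are drawn in its interior, and without a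
  common vertex they would have to be disjoint, although their ends alternate.\<close>

lemma outerplanar_K4_free:
  assumes "graph G" "outerplanar G"
  shows "K4_free (adj G) (fst G)"
  unfolding K4_free_def
proof (intro ballI impI)
  fix a b c d
  assume V: "a \<in> fst G" "b \<in> fst G" "c \<in> fst G" "d \<in> fst G"
    and ab: "adj G a b" and ac: "adj G a c" and ad: "adj G a d" and bc: "adj G b c"
    and bd: "adj G b d" and cd: "adj G c d"
  obtain f \<gamma> where d: "plane_drawing G f \<gamma>"
    and out: "\<forall>v\<in>fst G. f v \<in> closure (outside (drawing_image G f \<gamma>))"
    using assms(2) by (auto simp: outerplanar_def)
  have ne: "a \<noteq> b" "b \<noteq> c" "a \<noteq> d" "d \<noteq> c" "a \<noteq> c" "b \<noteq> d"
    using graph_adj(3)[OF assms(1)] ab ac ad bc bd cd by metis+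
  have dc: "adj G d c" and ba: "adj G b a" using cd ab by (simp_all add: adj_sym)
  let ?I = "\<lambda>u v. path_image (\<gamma> {u, v})"
  obtain l m e where 1: "arcs_between (f a) (f c) l m" "arcs_between (f a) (f c) l e" "arcs_between (f a) (f c) m e"
    "path_image l = ?I a b \<union> ?I b c" "path_image m = ?I a d \<union> ?I d c" "path_image e = ?I a c"
    "path_image e - {f a, f c} \<subseteq> inside (path_image l \<union> path_image m)"
    "\<forall>v\<in>fst G. f v \<notin> inside (path_image l \<union> path_image e) \<and> f v \<notin> inside (path_image m \<union> path_image e)"
    using diamond_arcs[OF assms(1) d out ab bc ad dc ac ne(6)] .
  obtain l' m' g where 2: "arcs_between (f b) (f d) l' m'" "arcs_between (f b) (f d) l' g" "arcs_between (f b) (f d) m' g"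
    "path_image l' = ?I b a \<union> ?I a d" "path_image m' = ?I b c \<union> ?I c d" "path_image g = ?I b d"
    "path_image g - {f b, f d} \<subseteq> inside (path_image l' \<union> path_image m')"
    "\<forall>v\<in>fst G. f v \<notin> inside (path_image l' \<union> path_image g) \<and> f v \<notin> inside (path_image m' \<union> path_image g)"
    using diamond_arcs[OF assms(1) d out ba ad bc cd bd ne(5)] .
  have g: "arc g" "pathstart g = f b" "pathfinish g = f d" using 2(2) by (auto simp: arcs_between_def)
  have eq: "path_image l' \<union> path_image m' = path_image l \<union> path_image m"
    unfolding 1(4,5) 2(4,5) by (simp add: insert_commute Un_ac)
  have "path_image g \<inter> path_image e = {}"
    unfolding 1(6) 2(6)
  proof (rule equals0I, elim IntE)
    fix z assume "z \<in> ?I b d" "z \<in> ?I a c"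
    moreover have "{b, d} \<inter> {a, c} = {}" "{b, d} \<noteq> {a, c}" using ne by auto
    ultimately show False
      using drawing_edges_meet[OF d, of "{b, d}" "{a, c}" z] bd ac by (simp add: adj_def)
  qed
  moreover have "f b \<in> path_image l" "f d \<in> path_image m"
    using drawing_edge(3)[OF assms(1) d ab] drawing_edge(3)[OF assms(1) d ad] unfolding 1(4,5) by blast+
  ultimately show False
    using crossing_arcs_in_loop[OF 1(1,2,3,7) g(1), unfolded g(2,3)] 2(7) bspec[OF 1(8) V(2)] bspec[OF 1(8) V(4)]
    unfolding eq by blast
qed

section \<open>Connected sets and induced cycles\<close>

lemma con_Un:
  assumes "con E A" "con E B" "symp E"
    and "A \<inter> B \<noteq> {} \<or> (\<exists>a\<in>A. \<exists>b\<in>B. E a b)"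
  shows "con E (A \<union> B)"
proof (rule conI, rule ccontr)
  fix X assume X: "X \<subseteq> A \<union> B" "X \<noteq> {}" "X \<noteq> A \<union> B"
    and n: "\<not> (\<exists>a\<in>X. \<exists>b\<in>(A \<union> B) - X. E a b)"
  have "X \<inter> A = {} \<or> A \<subseteq> X" "X \<inter> B = {} \<or> B \<subseteq> X"
    using con_closed_subset[OF assms(1), of X] con_closed_subset[OF assms(2), of X] n by blast+
  then have "X \<inter> A = {} \<and> B \<subseteq> X \<or> X \<inter> B = {} \<and> A \<subseteq> X" using X by blast
  then show False using n assms(4) sympD[OF assms(3)] X by blast
qed

lemma con_insert:
  assumes "con E A" "symp E" "a \<in> A" "E x a"
  shows "con E (insert x A)"
  using con_Un[of E "{x}" A] assms by auto

text \<open>The component is the union of all connected subsets of \<open>U\<close> through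
  \<open>x\<close>. A cut of the union cannot cut any member, so one side contains \<open>x\<close>
  and with it everything; adding a neighbour in \<open>U\<close> produces a further member.\<close>

lemma obtain_component:
  assumes "x \<in> U" "symp E"
  obtains K where "K \<subseteq> U" "x \<in> K" "con E K" "\<forall>a\<in>K. \<forall>b\<in>U. E a b \<longrightarrow> b \<in> K"
proof
  let ?K = "\<Union>{A. A \<subseteq> U \<and> x \<in> A \<and> con E A}"
  have x: "{x} \<in> {A. A \<subseteq> U \<and> x \<in> A \<and> con E A}" using assms by simp
  show K: "?K \<subseteq> U" "x \<in> ?K" using x by blast+
  show c: "con E ?K"
  proof (rule conI, rule ccontr)
    fix X assume X: "X \<subseteq> ?K" "X \<noteq> {}" "X \<noteq> ?K" and n: "\<not> (\<exists>a\<in>X. \<exists>b\<in>?K - X. E a b)"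
    have sub: "X \<inter> A = {} \<or> A \<subseteq> X" if "A \<subseteq> U" "x \<in> A" "con E A" for A
      using con_closed_subset[OF that(3), of X] n that by blast
    obtain y where "y \<in> X" using X by blast
    then have "x \<in> X" using sub X(1) by blast
    then have "?K \<subseteq> X" using sub by blast
    then show False using X by blast
  qed
  show "\<forall>a\<in>?K. \<forall>b\<in>U. E a b \<longrightarrow> b \<in> ?K"
  proof (intro ballI impI)
    fix a b assume ab: "a \<in> ?K" "b \<in> U" "E a b"
    have "con E (insert b ?K)" by (rule con_insert[OF c assms(2) ab(1) sympD[OF assms(2) ab(3)]])
    then have "insert b ?K \<in> {A. A \<subseteq> U \<and> x \<in> A \<and> con E A}" using ab(2) K by blast
    then show "b \<in> ?K" by blast
  qed
qed

text \<open>A detour through \<open>x\<close> can be shortened, because its neighbours are adjacent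
  to each other. In terms of cuts: if \<open>X\<close> contains a neighbour \<open>n\<close> of
  \<open>x\<close>, then \<open>x\<close> is added to \<open>X\<close>, and an edge leaving from
  \<open>x\<close> is replaced by one from \<open>n\<close>.\<close>

lemma con_remove_simplicial:
  assumes "con E A" "symp E" and cl: "\<And>y z. y \<in> A \<Longrightarrow> z \<in> A \<Longrightarrow> E x y \<Longrightarrow> E x z \<Longrightarrow> y \<noteq> z \<Longrightarrow> E y z"
  shows "con E (A - {x})"
proof (rule conI)
  fix X assume X: "X \<subseteq> A - {x}" "X \<noteq> {}" "X \<noteq> A - {x}"
  show "\<exists>a\<in>X. \<exists>b\<in>A - {x} - X. E a b"
  proof (cases "x \<in> A \<and> (\<exists>n\<in>X. E x n)")
    case True
    then obtain n where n: "n \<in> X" "E x n" by blast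
    obtain a b where ab: "a \<in> insert x X" "b \<in> A" "b \<notin> insert x X" "E a b"
      using conE[OF assms(1), of "insert x X"] X True by blast
    show ?thesis
    proof (cases "a = x")
      case True
      then have "E n b" using cl[of n b] n ab X by blast
      then show ?thesis using n ab by blast
    next
      case False then show ?thesis using ab by blast
    qed
  next
    case False
    obtain a b where ab: "a \<in> X" "b \<in> A" "b \<notin> X" "E a b"
      using conE[OF assms(1), of X] X by blast
    then have "b \<noteq> x" using False sympD[OF assms(2)] by blast
    then show ?thesis using ab by blast
  qed
qed

section \<open>Induced cycles as indexed sequences\<close>

definition clique :: "('a \<Rightarrow> 'a \<Rightarrow> bool) \<Rightarrow> 'a set \<Rightarrow> bool" where
  "clique E Q \<longleftrightarrow> (\<forall>x\<in>Q. \<forall>y\<in>Q. x \<noteq> y \<longrightarrow> E x y)"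

text \<open>The equivalence forbids chords, so \<open>c\<close> enumerates an induced cycle;
  triangles are included. The wrap-around between 0 and \<open>n - 1\<close> is spelled out, which
  leaves adjacency to linear arithmetic instead of remainders.\<close>

definition cyc :: "('a \<Rightarrow> 'a \<Rightarrow> bool) \<Rightarrow> nat \<Rightarrow> (nat \<Rightarrow> 'a) \<Rightarrow> bool" where
  "cyc E n c \<longleftrightarrow> 3 \<le> n \<and> inj_on c {..<n} \<and> (\<forall>i<n. \<forall>j<n. E (c i) (c j) \<longleftrightarrow>
     Suc i = j \<or> Suc j = i \<or> i = 0 \<and> Suc j = n \<or> j = 0 \<and> Suc i = n)"

lemma cycD:
  assumes "cyc E n c"
  shows "3 \<le> n" "inj_on c {..<n}"
    "i < n \<Longrightarrow> j < n \<Longrightarrow> E (c i) (c j) \<longleftrightarrow> Suc i = j \<or> Suc j = i \<or> i = 0 \<and> Suc j = n \<or> j = 0 \<and> Suc i = n"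
  using assms unfolding cyc_def by auto

lemma cyc_inj: "cyc E n c \<Longrightarrow> i < n \<Longrightarrow> j < n \<Longrightarrow> c i = c j \<longleftrightarrow> i = j"
  using cycD(2) by (metis inj_on_eq_iff lessThan_iff)

lemma cyc_reindex:
  assumes "cyc E n c" "inj_on r {..<n}" "r ` {..<n} \<subseteq> {..<n}"
    and "\<And>i j. i < n \<Longrightarrow> j < n \<Longrightarrow>
      Suc (r i) = r j \<or> Suc (r j) = r i \<or> r i = 0 \<and> Suc (r j) = n \<or> r j = 0 \<and> Suc (r i) = n \<longleftrightarrow>
      Suc i = j \<or> Suc j = i \<or> i = 0 \<and> Suc j = n \<or> j = 0 \<and> Suc i = n"
  shows "cyc E n (c \<circ> r)" "(c \<circ> r) ` {..<n} = c ` {..<n}"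
proof -
  have im: "r ` {..<n} = {..<n}" by (rule endo_inj_surj[OF _ assms(3,2)]) simp
  then show "(c \<circ> r) ` {..<n} = c ` {..<n}" by (metis image_comp)
  show "cyc E n (c \<circ> r)"
    unfolding cyc_def
  proof (intro conjI allI impI)
    show "3 \<le> n" using cycD[OF assms(1)] by blast
    show "inj_on (c \<circ> r) {..<n}"
      using assms(2) im cycD(2)[OF assms(1)] by (intro comp_inj_on) auto
    fix i j assume ij: "i < n" "j < n"
    then have "r i < n" "r j < n" using assms(3) by auto
    from cycD(3)[OF assms(1) this] assms(4)[OF ij]
    show "E ((c \<circ> r) i) ((c \<circ> r) j) \<longleftrightarrow>
      Suc i = j \<or> Suc j = i \<or> i = 0 \<and> Suc j = n \<or> j = 0 \<and> Suc i = n" by simp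
  qed
qed

lemma cyc_rotate:
  assumes "cyc E n c" "p \<in> c ` {..<n}"
  obtains d where "cyc E n d" "d ` {..<n} = c ` {..<n}" "d 0 = p"
proof -
  obtain k where k: "k < n" "p = c k" using assms by blast
  let ?r = "\<lambda>i. if i + k < n then i + k else i + k - n"
  have "inj_on ?r {..<n}" using k by (auto simp: inj_on_def)
  moreover have "?r ` {..<n} \<subseteq> {..<n}" using k by auto
  moreover have "Suc (?r i) = ?r j \<or> Suc (?r j) = ?r i \<or> ?r i = 0 \<and> Suc (?r j) = n \<or> ?r j = 0 \<and> Suc (?r i) = n
    \<longleftrightarrow> Suc i = j \<or> Suc j = i \<or> i = 0 \<and> Suc j = n \<or> j = 0 \<and> Suc i = n" if "i < n" "j < n" for i j
    using that k by (auto split: if_splits)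
  ultimately have "cyc E n (c \<circ> ?r)" "(c \<circ> ?r) ` {..<n} = c ` {..<n}"
    using cyc_reindex[OF assms(1), of ?r] by blast+
  moreover have "(c \<circ> ?r) 0 = p" using k by simp
  ultimately show ?thesis using that by blast
qed

lemma cyc_reflect:
  assumes "cyc E n c"
  obtains d where "cyc E n d" "d ` {..<n} = c ` {..<n}" "d 0 = c 0" "d (Suc 0) = c (n - 1)"
proof -
  let ?r = "\<lambda>i. if i = 0 then 0 else n - i"
  have "inj_on ?r {..<n}" by (auto simp: inj_on_def split: if_splits)
  moreover have "?r ` {..<n} \<subseteq> {..<n}" by auto
  moreover have "Suc (?r i) = ?r j \<or> Suc (?r j) = ?r i \<or> ?r i = 0 \<and> Suc (?r j) = n \<or> ?r j = 0 \<and> Suc (?r i) = n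
    \<longleftrightarrow> Suc i = j \<or> Suc j = i \<or> i = 0 \<and> Suc j = n \<or> j = 0 \<and> Suc i = n" if "i < n" "j < n" for i j
    using that by (auto split: if_splits)
  ultimately have "cyc E n (c \<circ> ?r)" "(c \<circ> ?r) ` {..<n} = c ` {..<n}"
    using cyc_reindex[OF assms, of ?r] by blast+
  then show ?thesis using that[of "c \<circ> ?r"] cycD(1)[OF assms] by simp
qed

lemma cyc_start_edge:
  assumes "cyc E n c" "p \<in> c ` {..<n}" "q \<in> c ` {..<n}" "E p q"
  obtains d where "cyc E n d" "d ` {..<n} = c ` {..<n}" "d 0 = p" "d 1 = q"
proof -
  obtain d where d: "cyc E n d" "d ` {..<n} = c ` {..<n}" "d 0 = p" using cyc_rotate[OF assms(1,2)] .
  obtain k where k: "k < n" "q = d k" using assms(3) d(2) by (metis imageE lessThan_iff)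
  have n: "3 \<le> n" using cycD(1)[OF d(1)] .
  then have "k = 1 \<or> k = n - 1" using cycD(3)[OF d(1), of 0 k] k d(3) assms(4) by auto
  then show ?thesis
  proof
    assume "k = 1" then show ?thesis using that d k by simp
  next
    assume k': "k = n - 1"
    obtain d' where "cyc E n d'" "d' ` {..<n} = d ` {..<n}" "d' 0 = d 0" "d' (Suc 0) = d (n - 1)"
      using cyc_reflect[OF d(1)] .
    then show ?thesis using that[of d'] d k k' by simp
  qed
qed

lemma cyc_segment_con:
  assumes "cyc E n c" "b \<le> n" "symp E"
  shows "con E (c ` {a..<b})"
  using assms(2)
proof (induction b)
  case 0 then show ?case by simp
next
  case (Suc b)
  show ?case
  proof (cases "a < b")
    case True
    then have "c ` {a..<Suc b} = insert (c b) (c ` {a..<b})" by (auto simp: less_Suc_eq)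
    moreover have "con E (insert (c b) (c ` {a..<b}))"
    proof (rule con_insert[OF _ assms(3)])
      show "con E (c ` {a..<b})" using Suc by simp
      show "c (b - 1) \<in> c ` {a..<b}" using True by auto
      show "E (c b) (c (b - 1))" using cycD(3)[OF assms(1), of b "b - 1"] Suc(2) True by simp
    qed
    ultimately show ?thesis by simp
  next
    case False
    then have "{a..<Suc b} = {} \<or> {a..<Suc b} = {b}" by auto
    then show ?thesis by auto
  qed
qed

text \<open>A clique of at most two vertices meets the cycle in nothing, in one vertex or in the two
  ends of an edge. After a suitable rotation or reflection these are the first indices, and a
  segment remains.\<close>

lemma cyc_remove_clique_con:
  assumes "cyc E n c" "symp E" "clique E Q" "card Q \<le> 2" "finite Q"
  shows "con E (c ` {..<n} - Q)" "c ` {..<n} - Q \<noteq> {}"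
proof -
  let ?C = "c ` {..<n}"
  have n: "3 \<le> n" using cycD(1)[OF assms(1)] .
  have "card ?C = n" using cycD(2)[OF assms(1)] by (simp add: card_image)
  then show "?C - Q \<noteq> {}"
    using n assms(4,5) card_mono[of Q ?C] by force
  show "con E (?C - Q)"
  proof (cases "?C \<inter> Q = {}")
    case True
    then have "?C - Q = c ` {0..<n}" by (auto simp: lessThan_atLeast0)
    then show ?thesis using cyc_segment_con[OF assms(1) _ assms(2), of n 0] by simp
  next
    case False
    then obtain p where p: "p \<in> ?C" "p \<in> Q" by blast
    show ?thesis
    proof (cases "?C \<inter> Q = {p}")
      case True
      obtain d where d: "cyc E n d" "d ` {..<n} = ?C" "d 0 = p" using cyc_rotate[OF assms(1) p(1)] .
      have "?C - Q = ?C - {p}" using True by blast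
      also have "\<dots> = d ` {..<n} - d ` {0}" using d by simp
      also have "\<dots> = d ` ({..<n} - {0})"
        using n by (intro inj_on_image_set_diff[OF cycD(2)[OF d(1)], symmetric]) auto
      also have "{..<n} - {0} = {1..<n}" by auto
      finally show ?thesis using cyc_segment_con[OF d(1) _ assms(2), of n 1] by simp
    next
      case False
      then obtain q where q: "q \<in> ?C" "q \<in> Q" "q \<noteq> p" using p by blast
      then have "E p q" using assms(3) p by (auto simp: clique_def)
      obtain d where d: "cyc E n d" "d ` {..<n} = ?C" "d 0 = p" "d 1 = q"
        using cyc_start_edge[OF assms(1) p(1) q(1) \<open>E p q\<close>] .
      have "Q = {p, q}"
        using card_seteq[of Q "{p, q}"] assms(4,5) p q by simp
      then have "?C - Q = d ` {..<n} - d ` {0, 1}" using d by simp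
      also have "\<dots> = d ` ({..<n} - {0, 1})"
        using n by (intro inj_on_image_set_diff[OF cycD(2)[OF d(1)], symmetric]) auto
      also have "{..<n} - {0, 1} = {2..<n}" by auto
      finally show ?thesis using cyc_segment_con[OF d(1) _ assms(2), of n 2] by simp
    qed
  qed
qed

lemma cyc_con:
  assumes "cyc E n c" "symp E" shows "con E (c ` {..<n})"
  using cyc_remove_clique_con(1)[OF assms, of "{}"] by (simp add: clique_def)

lemma cyc_nbrs:
  assumes "cyc E n c" "p \<in> c ` {..<n}"
  shows "card {x \<in> c ` {..<n}. E p x} = 2"
proof -
  obtain d where d: "cyc E n d" "d ` {..<n} = c ` {..<n}" "d 0 = p" using cyc_rotate[OF assms] .
  have n: "3 \<le> n" using cycD(1)[OF d(1)] .
  have "{x \<in> d ` {..<n}. E p x} = {d 1, d (n - 1)}"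
    using cycD(3)[OF d(1), of 0] n d(3) by auto
  moreover have "d 1 \<noteq> d (n - 1)" using cyc_inj[OF d(1), of 1 "n - 1"] n by simp
  ultimately show ?thesis using d(2) by simp
qed

text \<open>Every vertex has exactly two neighbours on either cycle. The neighbours on the smaller
  one are therefore all its neighbours on the larger one, and the larger one is connected.\<close>

lemma cyc_subset_eq:
  assumes "cyc E n c" "cyc E m d" "d ` {..<m} \<subseteq> c ` {..<n}" "symp E"
  shows "d ` {..<m} = c ` {..<n}"
proof (rule con_closed_eq[OF cyc_con[OF assms(1,4)] assms(3)])
  show "d ` {..<m} \<noteq> {}" using cycD(1)[OF assms(2)] by (auto simp: lessThan_empty_iff)
  fix a b assume ab: "a \<in> d ` {..<m}" "b \<in> c ` {..<n}" "E a b"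
  have "{x \<in> d ` {..<m}. E a x} = {x \<in> c ` {..<n}. E a x}"
    using assms(3) cyc_nbrs[OF assms(2) ab(1)] cyc_nbrs[OF assms(1)] ab(1)
    by (intro card_seteq) auto
  then show "b \<in> d ` {..<m}" using ab by blast
qed

text \<open>A clique through \<open>p\<close> lies in \<open>p\<close> and its two neighbours on the
  cycle, and these two are not adjacent once the length is at least 4.\<close>

lemma cyc_clique:
  assumes "cyc E n c" "4 \<le> n" "clique E Q" "Q \<subseteq> c ` {..<n}"
  shows "card Q \<le> 2" "finite Q"
proof -
  show "finite Q" using finite_subset[OF assms(4)] by simp
  show "card Q \<le> 2"
  proof (rule ccontr)
    assume "\<not> card Q \<le> 2"
    then obtain p where p: "p \<in> Q" by fastforce
    obtain d where d: "cyc E n d" "d ` {..<n} = c ` {..<n}" "d 0 = p"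
      using cyc_rotate[OF assms(1)] p assms(4) by blast
    have Q: "Q \<subseteq> {d 0, d 1, d (n - 1)}"
    proof
      fix x assume x: "x \<in> Q"
      then obtain k where k: "k < n" "x = d k" using assms(4) d(2) by (metis imageE lessThan_iff subsetD)
      have "x = p \<or> E p x" using x p assms(3) by (auto simp: clique_def)
      then show "x \<in> {d 0, d 1, d (n - 1)}"
        using cycD(3)[OF d(1), of 0 k] k d(3) assms(2) by auto
    qed
    have "card {d 0, d 1, d (n - 1)} \<le> 3" by (simp add: card_insert_if)
    then have "Q = {d 0, d 1, d (n - 1)}"
      using Q \<open>\<not> card Q \<le> 2\<close> by (intro card_seteq) auto
    moreover have "d 1 \<noteq> d (n - 1)" using cyc_inj[OF d(1), of 1 "n - 1"] assms(2) by simp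
    ultimately have "E (d 1) (d (n - 1))" using assms(3) by (simp add: clique_def)
    then show False using cycD(3)[OF d(1), of 1 "n - 1"] assms(2) by simp
  qed
qed

lemma cyc_not_clique:
  assumes "cyc E n c" "4 \<le> n" shows "\<not> clique E (c ` {..<n})"
  using cyc_clique[OF assms, of "c ` {..<n}"] cycD(2)[OF assms(1)] assms(2) by (auto simp: card_image)

lemma theta_freeD:
  assumes "theta_free E V" "p \<in> V" "q \<in> V" "p \<noteq> q"
    "A \<subseteq> V - {p, q}" "B \<subseteq> V - {p, q}" "C \<subseteq> V - {p, q}"
    "A \<inter> B = {}" "A \<inter> C = {}" "B \<inter> C = {}" "con E A" "con E B" "con E C"
    "\<exists>x\<in>A. E p x" "\<exists>x\<in>A. E q x" "\<exists>x\<in>B. E p x" "\<exists>x\<in>B. E q x" "\<exists>x\<in>C. E p x" "\<exists>x\<in>C. E q x"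
  shows False
  using assms(1)[unfolded theta_free_def, rule_format, OF assms(2,3,4,5,6,7,8,9,10,11,12,13,14,15,16,17,18,19)] .

text \<open>Two nonadjacent vertices \<open>p\<close> and \<open>q\<close> cut the cycle into two
  nonempty segments. Together with \<open>K\<close> these are three disjoint connected sets, each
  having neighbours of both \<open>p\<close> and \<open>q\<close>.\<close>

lemma cyc_attachments_adjacent:
  assumes tf: "theta_free E V" and E: "symp E" and c: "cyc E n c" "c ` {..<n} \<subseteq> V"
    and K: "con E K" "K \<subseteq> V - c ` {..<n}"
    and p: "p \<in> c ` {..<n}" "\<exists>x\<in>K. E p x" and q: "q \<in> c ` {..<n}" "\<exists>x\<in>K. E q x" and "p \<noteq> q"
  shows "E p q"
proof (rule ccontr)
  assume npq: "\<not> E p q"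
  obtain d where d: "cyc E n d" "d ` {..<n} = c ` {..<n}" "d 0 = p" using cyc_rotate[OF c(1) p(1)] .
  obtain k where k: "k < n" "q = d k" using q(1) d(2) by (metis imageE lessThan_iff)
  have k': "1 < k" "Suc k < n"
  proof -
    have "0 < k" using k(2) d(3) assms(11) by (cases k) auto
    moreover have "k \<noteq> 1" "Suc k \<noteq> n" using cycD(3)[OF d(1), of 0 k] k d(3) npq by auto
    ultimately show "1 < k" "Suc k < n" using k(1) by auto
  qed
  have inj: "inj_on d {..<n}" using cycD(2)[OF d(1)] .
  have disj: "d ` A \<inter> d ` B = {}" if "A \<subseteq> {..<n}" "B \<subseteq> {..<n}" "A \<inter> B = {}" for A B
    using inj_on_image_Int[OF inj that(1,2)] that(3) by simp
  have V: "d ` A \<subseteq> V" if "A \<subseteq> {..<n}" for A using that c(2) d(2) by blast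
  have KC: "K \<inter> d ` A = {}" if "A \<subseteq> {..<n}" for A using that K(2) d(2) by blast
  have Vpq: "d ` A \<subseteq> V - {p, q}" if "A \<subseteq> {..<n}" "0 \<notin> A" "k \<notin> A" for A
  proof -
    have "d ` A \<inter> d ` {0, k} = {}" using that k by (intro disj) auto
    moreover have "{p, q} = d ` {0, k}" using k d(3) by simp
    ultimately show ?thesis using V[OF that(1)] by blast
  qed
  show False
  proof (rule theta_freeD[OF tf, of p q "d ` {1..<k}" "d ` {Suc k..<n}" K])
    show "p \<in> V" "q \<in> V" "p \<noteq> q" using p q c assms(11) by auto
    show "d ` {1..<k} \<subseteq> V - {p, q}"
      using k by (intro Vpq) auto
    show "d ` {Suc k..<n} \<subseteq> V - {p, q}"
      using k by (intro Vpq) auto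
    show "K \<subseteq> V - {p, q}" using K(2) p q by blast
    show "d ` {1..<k} \<inter> d ` {Suc k..<n} = {}" using k by (intro disj) auto
    show "d ` {1..<k} \<inter> K = {}" "d ` {Suc k..<n} \<inter> K = {}"
    proof -
      have "{1..<k} \<subseteq> {..<n}" "{Suc k..<n} \<subseteq> {..<n}" using k by auto
      from KC[OF this(1)] KC[OF this(2)] show "d ` {1..<k} \<inter> K = {}" "d ` {Suc k..<n} \<inter> K = {}" by blast+
    qed
    show "con E (d ` {1..<k})" "con E (d ` {Suc k..<n})" "con E K"
      using cyc_segment_con[OF d(1) _ E] k K by auto
    show "\<exists>x\<in>d ` {1..<k}. E p x"
      using cycD(3)[OF d(1), of 0 1] d(3) k' by (intro bexI[of _ "d 1"]) auto
    show "\<exists>x\<in>d ` {1..<k}. E q x"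
      using cycD(3)[OF d(1), of k "k - 1"] k k' by (intro bexI[of _ "d (k - 1)"]) auto
    show "\<exists>x\<in>d ` {Suc k..<n}. E p x"
      using cycD(3)[OF d(1), of 0 "n - 1"] d(3) k' by (intro bexI[of _ "d (n - 1)"]) auto
    show "\<exists>x\<in>d ` {Suc k..<n}. E q x"
      using cycD(3)[OF d(1), of k "Suc k"] k k' by (intro bexI[of _ "d (Suc k)"]) auto
  qed (use p q in auto)
qed

section \<open>Simplicial vertices\<close>

text \<open>A shortest walk is taken; minimality of its length excludes repeated vertices as well as
  chords.\<close>

lemma obtain_induced_path:
  assumes "con E A" "y \<in> A" "z \<in> A"
  obtains g m where "g 0 = y" "g m = z" "g ` {..m} \<subseteq> A" "inj_on g {..m}"
    "\<forall>i j. i < j \<longrightarrow> j \<le> m \<longrightarrow> E (g i) (g j) = (j = Suc i)"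
proof -
  define P where "P m g \<longleftrightarrow> g 0 = y \<and> g m = z \<and> (\<forall>i\<le>m. g i \<in> A) \<and> (\<forall>i<m. E (g i) (g (Suc i)))" for m :: nat and g
  have "(\<lambda>a b. E a b \<and> b \<in> A)\<^sup>*\<^sup>* y z" using assms by (auto simp: con_iff_rtranclp)
  then have "\<exists>m g. g 0 = y \<and> g m = z \<and> (\<forall>i\<le>m. g i \<in> A) \<and> (\<forall>i<(m::nat). E (g i) (g (Suc i)))"
  proof (induction rule: rtranclp_induct)
    case base
    show ?case by (intro exI[of _ 0] exI[of _ "\<lambda>_. y"]) (use assms in auto)
  next
    case (step u v)
    then obtain m g where g: "g 0 = y" "g m = u" "\<forall>i\<le>m. g i \<in> A" "\<forall>i<(m::nat). E (g i) (g (Suc i))" by blast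
    let ?g = "\<lambda>i. if i \<le> m then g i else v"
    have "?g 0 = y \<and> ?g (Suc m) = v \<and> (\<forall>i\<le>Suc m. ?g i \<in> A) \<and> (\<forall>i<Suc m. E (?g i) (?g (Suc i)))"
      using g step by (auto simp: less_Suc_eq)
    then show ?case by (intro exI[of _ "Suc m"] exI[of _ ?g])
  qed
  then have "\<exists>m. \<exists>g. P m g" by (simp add: P_def)
  then obtain m where m: "\<exists>g. P m g" "\<And>k. k < m \<Longrightarrow> \<not> (\<exists>g. P k g)"
    using exists_least_iff[of "\<lambda>m. \<exists>g. P m g"] by blast
  then obtain g where g: "P m g" by blast
  note gd = g[unfolded P_def]
  \<comment> \<open>Jumping from position \<open>i\<close> to \<open>Suc (i + k)\<close> gives a
    walk shorter by \<open>k\<close>. A chord is such a jump, and a repetition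
    \<open>g i = g j\<close> becomes one with \<open>k = j - i\<close>; only for
    \<open>j = m\<close> is there no further vertex, and then the walk is cut off at
    \<open>i\<close>.\<close>
  have short: False if k: "i + k < m" "0 < k" and j: "Suc (i + k) \<le> m \<Longrightarrow> E (g i) (g (Suc (i + k)))" for i k
  proof -
    let ?g = "\<lambda>l. if l \<le> i then g l else g (l + k)"
    have "E (?g l) (?g (Suc l))" if "l < m - k" for l
      using that gd j k by (cases "l = i") (auto simp: not_le)
    moreover have "?g (m - k) = z" using gd k by auto
    ultimately have "P (m - k) ?g" using gd k unfolding P_def by auto
    then show False using m(2)[of "m - k"] k by auto
  qed
  have loop: "g i \<noteq> g j" if ij: "i < j" "j \<le> m" for i j
  proof
    assume eq: "g i = g j"
    show False
    proof (cases "j = m")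
      case True
      have "P i g" using gd ij eq True unfolding P_def by auto
      then show False using m(2)[of i] ij True by blast
    next
      case False
      then have "E (g i) (g (Suc (i + (j - i))))" using gd eq ij by auto
      then show False using short[of i "j - i"] ij False by auto
    qed
  qed
  have inj: "inj_on g {..m}"
  proof (rule inj_onI)
    fix i j assume "i \<in> {..m}" "j \<in> {..m}" "g i = g j"
    then show "i = j" using loop[of i j] loop[of j i] by (metis atMost_iff linorder_neqE_nat)
  qed
  have "E (g i) (g j) \<longleftrightarrow> j = Suc i" if ij: "i < j" "j \<le> m" for i j
  proof
    assume e: "E (g i) (g j)"
    show "j = Suc i"
    proof (rule ccontr)
      assume "j \<noteq> Suc i"
      then have "0 < j - Suc i" "i + (j - Suc i) < m" "Suc (i + (j - Suc i)) = j" using ij by auto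
      then show False using short[of i "j - Suc i"] e by simp
    qed
  qed (use gd ij in auto)
  then have "\<forall>i j. i < j \<longrightarrow> j \<le> m \<longrightarrow> E (g i) (g j) = (j = Suc i)" by blast
  moreover have "g ` {..m} \<subseteq> A" using gd by auto
  ultimately show ?thesis using that[of g m] gd inj by blast
qed

text \<open>An induced path from \<open>y\<close> to \<open>z\<close> through \<open>D\<close> is
  closed up by \<open>x\<close>. Since \<open>x\<close> has no neighbour in \<open>D\<close>, no
  chord arises at \<open>x\<close>, and since \<open>y\<close> and \<open>z\<close> are not
  adjacent, the cycle is long.\<close>

lemma cyc_from_separation:
  assumes E: "symp E" "irreflp E" and xy: "E x y" "E x z" "\<not> E y z" "y \<noteq> z"
    and D: "con E D" "\<And>d. d \<in> D \<Longrightarrow> d \<noteq> x \<and> \<not> E x d" "\<exists>d\<in>D. E d y" "\<exists>d\<in>D. E d z"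
  obtains n c where "4 \<le> n" "cyc E n c" "c ` {..<n} \<subseteq> insert x (insert y (insert z D))"
proof -
  note sy = sympD[OF E(1)]
  have ir: "\<not> E a a" for a using E(2) by (simp add: irreflp_def)
  let ?A = "insert y (insert z D)"
  have cA: "con E ?A"
    using con_insert[OF con_insert[OF D(1) E(1)] E(1)] D(3,4) sy by blast
  obtain g m where g: "g 0 = y" "g m = z" "g ` {..m} \<subseteq> ?A" "inj_on g {..m}"
    "\<forall>i j. i < j \<longrightarrow> j \<le> m \<longrightarrow> E (g i) (g j) = (j = Suc i)"
    using obtain_induced_path[OF cA insertI1 insertI2[OF insertI1]] .
  have m: "2 \<le> m"
  proof (rule ccontr)
    assume "\<not> 2 \<le> m"
    then have "m = 0 \<or> m = 1" by auto
    then show False using g(1,2) xy g(5)[rule_format, of 0 1] by auto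
  qed
  have xA: "x \<notin> ?A" using D(2) xy ir by auto
  have Ex: "E x (g i) \<longleftrightarrow> i = 0 \<or> i = m" if "i \<le> m" for i
  proof -
    have "g i \<in> ?A" using g(3) that by auto
    moreover have "g i = y \<longleftrightarrow> i = 0" "g i = z \<longleftrightarrow> i = m"
      using g(1,2,4) that by (metis atMost_iff inj_on_eq_iff le0 order_refl)+
    ultimately show ?thesis using D(2) xy by auto
  qed
  have Eg: "E (g i) (g j) \<longleftrightarrow> j = Suc i \<or> i = Suc j" if "i \<le> m" "j \<le> m" for i j
  proof (cases i j rule: linorder_cases)
    case less then show ?thesis using g(5)[rule_format, of i j] that by auto
  next
    case equal then show ?thesis using ir by auto
  next
    case greater then show ?thesis using g(5)[rule_format, of j i] that sy[of "g i" "g j"] sy[of "g j" "g i"] by auto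
  qed
  \<comment> \<open>With \<open>x\<close> put in front of the \<open>m + 1\<close> vertices of the
    path, the length becomes \<open>m + 2\<close>, which is at least 4 because
    \<open>2 \<le> m\<close>.\<close>
  define c where "c i = (if i = 0 then x else g (i - 1))" for i :: nat
  have "cyc E (m + 2) c"
    unfolding cyc_def
  proof (intro conjI allI impI)
    show "3 \<le> m + 2" using m by simp
    show "inj_on c {..<m + 2}"
    proof (rule inj_onI)
      fix i j assume ij: "i \<in> {..<m + 2}" "j \<in> {..<m + 2}" "c i = c j"
      have gx: "g k \<noteq> x" if "k \<le> m" for k using g(3) xA that by auto
      show "i = j"
      proof (cases i)
        case 0
        then show ?thesis using ij gx[of "j - 1"] by (cases j) (auto simp: c_def)
      next
        case (Suc i')
        then show ?thesis using ij gx[of i'] g(4) by (cases j) (auto simp: c_def inj_on_def)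
      qed
    qed
    fix i j assume ij: "i < m + 2" "j < m + 2"
    show "E (c i) (c j) \<longleftrightarrow> Suc i = j \<or> Suc j = i \<or> i = 0 \<and> Suc j = m + 2 \<or> j = 0 \<and> Suc i = m + 2"
    proof (cases i)
      case 0
      show ?thesis
      proof (cases j)
        case 0 then show ?thesis using \<open>i = 0\<close> ir by (simp add: c_def)
      next
        case (Suc j') then show ?thesis using \<open>i = 0\<close> Ex[of j'] ij by (auto simp: c_def)
      qed
    next
      case i: (Suc i')
      show ?thesis
      proof (cases j)
        case 0
        then show ?thesis using i Ex[of i'] ij sy[of x "g i'"] sy[of "g i'" x] by (auto simp: c_def)
      next
        case (Suc j') then show ?thesis using i Eg[of i' j'] ij by (auto simp: c_def)
      qed
    qed
  qed
  moreover have "c ` {..<m + 2} \<subseteq> insert x ?A"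
    using g(3) by (auto simp: c_def image_subset_iff)
  ultimately show ?thesis using that[of "m + 2" c] m by simp
qed

section \<open>Dirac's argument and its extension to graphs with one hole\<close>

definition hole_free :: "('a \<Rightarrow> 'a \<Rightarrow> bool) \<Rightarrow> 'a set \<Rightarrow> bool" where
  "hole_free E V \<longleftrightarrow> (\<forall>n c. 4 \<le> n \<longrightarrow> cyc E n c \<longrightarrow> \<not> c ` {..<n} \<subseteq> V)"

text \<open>A variant of Dirac's theorem on chordal graphs. If a vertex \<open>v\<close> misses some vertex, take a
  component \<open>D\<close> of the graph without the closed neighbourhood of \<open>v\<close>; its attachments form a clique,
  and by induction \<open>D\<close> contains a simplicial vertex.\<close>

lemma hole_free_simplicial:
  assumes "finite V" "symp E" "irreflp E" "hole_free E V" "clique E Q" "Q \<subset> V"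
  shows "\<exists>x\<in>V - Q. clique E {y\<in>V. E x y}"
  using assms(1,4-6)
proof (induction V arbitrary: Q rule: finite_psubset_induct)
  case (psubset V)
  note sy = sympD[OF assms(2)]
  have ir: "\<not> E a a" for a using assms(3) by (simp add: irreflp_def)
  have far: "\<exists>x\<in>V. x \<noteq> v \<and> \<not> E v x \<and> clique E {y\<in>V. E x y}"
    if vw: "v \<in> V" "w \<in> V" "w \<noteq> v" "\<not> E v w" for v w
  proof -
    let ?U = "{u\<in>V. u \<noteq> v \<and> \<not> E v u}"
    have "w \<in> ?U" using vw by simp
    obtain D where D: "D \<subseteq> ?U" "w \<in> D" "con E D" "\<forall>a\<in>D. \<forall>b\<in>?U. E a b \<longrightarrow> b \<in> D"
      using obtain_component[OF \<open>w \<in> ?U\<close> assms(2)] .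
    let ?S = "{s\<in>V. E v s \<and> (\<exists>d\<in>D. E d s)}"
    have S: "clique E ?S"
      unfolding clique_def
    proof (intro ballI impI, rule ccontr)
      fix y z assume yz: "y \<in> ?S" "z \<in> ?S" "y \<noteq> z" "\<not> E y z"
      have *: "E v y" "E v z" "\<exists>d\<in>D. E d y" "\<exists>d\<in>D. E d z" using yz by auto
      have **: "d \<noteq> v \<and> \<not> E v d" if "d \<in> D" for d using D(1) that by blast
      obtain n c where nc: "4 \<le> n" "cyc E n c" "c ` {..<n} \<subseteq> insert v (insert y (insert z D))"
        using cyc_from_separation[OF assms(2,3) *(1,2) yz(4,3) D(3) ** *(3,4)] .
      have "insert v (insert y (insert z D)) \<subseteq> V" using yz D(1) vw by auto
      then show False using nc psubset.prems(1) unfolding hole_free_def by (meson subset_trans)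
    qed
    have sub: "D \<union> ?S \<subset> V" using D(1) vw(1) ir by blast
    have "hole_free E (D \<union> ?S)" using psubset.prems(1) sub unfolding hole_free_def by (meson psubset_imp_subset subset_trans)
    moreover have "?S \<subset> D \<union> ?S" using D(1,2) by blast
    \<comment> \<open>Choosing \<open>?S\<close> as the clique to be avoided forces the simplicial
      vertex into \<open>D\<close>. All neighbours of a vertex of \<open>D\<close> lie in
      \<open>D \<union> ?S\<close>, so it stays simplicial in \<open>V\<close>.\<close>
    ultimately obtain x where x: "x \<in> D \<union> ?S - ?S" "clique E {y\<in>D \<union> ?S. E x y}"
      using psubset.IH[OF sub _ S] by blast
    have "{y\<in>V. E x y} \<subseteq> {y\<in>D \<union> ?S. E x y}"
      using x(1) D(1) D(4) sy by blast
    then have "clique E {y\<in>V. E x y}" using x(2) unfolding clique_def by blast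
    then show ?thesis using x(1) D(1) by blast
  qed
  show ?case
  proof (cases "\<exists>v\<in>Q. \<exists>w\<in>V. w \<noteq> v \<and> \<not> E v w")
    case True
    then obtain v w where v: "v \<in> Q" "w \<in> V" "w \<noteq> v" "\<not> E v w" by blast
    then obtain x where x: "x \<in> V" "x \<noteq> v" "\<not> E v x" "clique E {y\<in>V. E x y}"
      using far[of v w] psubset.prems(3) by blast
    have "x \<notin> Q"
    proof
      assume "x \<in> Q"
      then have "E v x" using psubset.prems(2) v(1) x(2) unfolding clique_def by metis
      with x(3) show False ..
    qed
    then show ?thesis using x by blast
  next
    case univ: False
    \<comment> \<open>Vertices adjacent to all others can be put back without harm: a simplicial
      vertex of \<open>V - R\<close> remains simplicial in \<open>V\<close>. This is used for
      \<open>R = Q\<close>, and for a single universal vertex when \<open>Q\<close> is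
      empty.\<close>
    have step: "\<exists>x\<in>V - R. clique E {y\<in>V. E x y}"
      if R: "R \<subset> V" "R \<noteq> {}" "clique E R" "\<And>v w. v \<in> R \<Longrightarrow> w \<in> V \<Longrightarrow> w \<noteq> v \<Longrightarrow> E v w" for R
    proof -
      have sub: "V - R \<subset> V" "V - R \<noteq> {}" using R by blast+
      have "hole_free E (V - R)" using psubset.prems(1) unfolding hole_free_def by blast
      then obtain x where x: "x \<in> V - R" "clique E {y\<in>V - R. E x y}"
        using psubset.IH[OF sub(1), of "{}"] sub(2) by (auto simp: clique_def)
      have "clique E {y\<in>V. E x y}"
        unfolding clique_def
      proof (intro ballI impI)
        fix y z assume "y \<in> {y\<in>V. E x y}" "z \<in> {y\<in>V. E x y}" "y \<noteq> z"
        then show "E y z"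
          using x(2) R(4)[of y z] R(4)[of z y] sy unfolding clique_def by blast
      qed
      then show ?thesis using x by blast
    qed
    show ?thesis
    proof (cases "Q = {}")
      case False
      then show ?thesis using step[of Q] univ psubset.prems by blast
    next
      case True
      obtain v where v: "v \<in> V" using psubset.prems(3) by blast
      show ?thesis
      proof (cases "\<exists>w\<in>V. w \<noteq> v \<and> \<not> E v w")
        case True then show ?thesis using far[of v] v \<open>Q = {}\<close> by blast
      next
        case False
        show ?thesis
        proof (cases "V = {v}")
          case True
          then have "{y\<in>V. E v y} = {}" using ir by auto
          then have "clique E {y\<in>V. E v y}" unfolding clique_def by blast
          then show ?thesis using v \<open>Q = {}\<close> by blast
        next
          case False
          then have "\<exists>x\<in>V - {v}. clique E {y\<in>V. E x y}"
            using step[of "{v}"] v \<open>\<not> (\<exists>w\<in>V. w \<noteq> v \<and> \<not> E v w)\<close> by (auto simp: clique_def)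
          then show ?thesis using \<open>Q = {}\<close> by blast
        qed
      qed
    qed
  qed
qed

text \<open>Uniqueness without existence: a graph without holes qualifies. Holes are compared as
  vertex sets because rotations and reflections of \<open>c\<close> enumerate the same hole.\<close>

definition unique_hole :: "('a \<Rightarrow> 'a \<Rightarrow> bool) \<Rightarrow> 'a set \<Rightarrow> bool" where
  "unique_hole E V \<longleftrightarrow> (\<forall>n c m d. 4 \<le> n \<longrightarrow> cyc E n c \<longrightarrow> c ` {..<n} \<subseteq> V \<longrightarrow>
     4 \<le> m \<longrightarrow> cyc E m d \<longrightarrow> d ` {..<m} \<subseteq> V \<longrightarrow> c ` {..<n} = d ` {..<m})"

lemma K4_free_clique_nbrs:
  assumes "K4_free E V" "x \<in> V" "clique E {y\<in>V. E x y}" "finite V"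
  shows "card {y\<in>V. E x y} \<le> 2"
proof (rule ccontr)
  assume "\<not> ?thesis"
  then obtain T where T: "T \<subseteq> {y\<in>V. E x y}" "card T = 3"
    by (metis Suc_le_eq Suc_numeral not_le obtain_subset_with_card_n semiring_norm(5) semiring_norm(2))
  then obtain a b c where "T = {a, b, c}" "a \<noteq> b" "b \<noteq> c" "a \<noteq> c" by (auto simp: card_3_iff)
  then show False using T(1) assms(1-3) unfolding K4_free_def clique_def by blast
qed

lemma attachments_clique:
  assumes "theta_free E V" "symp E" "cyc E n c" "c ` {..<n} \<subseteq> V" "con E K" "K \<subseteq> V - c ` {..<n}"
  shows "clique E {q \<in> c ` {..<n}. \<exists>k\<in>K. E q k}"
  unfolding clique_def
proof (intro ballI impI)
  fix p q assume "p \<in> {q \<in> c ` {..<n}. \<exists>k\<in>K. E q k}" "q \<in> {q \<in> c ` {..<n}. \<exists>k\<in>K. E q k}" "p \<noteq> q"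
  then show "E p q" using cyc_attachments_adjacent[OF assms, of p q] by simp
qed

text \<open>If there is a hole that does not cover \<open>V\<close>, a component \<open>K\<close> of
  the rest is considered together with its attachments \<open>?Q\<close>. No hole fits into
  \<open>K \<union> ?Q\<close>, since the only one would then consist of \<open>?Q\<close> alone,
  which is a clique. A simplicial vertex off \<open>?Q\<close> has all its neighbours there.
  Connectedness makes the degree positive, and the absence of \<open>K_4\<close> makes it at most
  2.\<close>

lemma removable_vertex:
  assumes V: "finite V" "symp E" "irreflp E" "con E V" "theta_free E V" "K4_free E V" "unique_hole E V"
    and "2 \<le> card V" and nh: "\<And>n c. 4 \<le> n \<Longrightarrow> cyc E n c \<Longrightarrow> c ` {..<n} \<noteq> V"
  obtains x where "x \<in> V" "clique E {y\<in>V. E x y}" "{y\<in>V. E x y} \<noteq> {}" "card {y\<in>V. E x y} \<le> 2"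
proof -
  note sy = sympD[OF V(2)]
  have "\<exists>x\<in>V. clique E {y\<in>V. E x y}"
  proof (cases "hole_free E V")
    case True
    have "{} \<subset> V" using assms(8) by auto
    from hole_free_simplicial[OF V(1-3) True _ this] show ?thesis by (auto simp: clique_def)
  next
    case False
    then obtain n c where c: "4 \<le> n" "cyc E n c" "c ` {..<n} \<subseteq> V" by (auto simp: hole_free_def)
    let ?C = "c ` {..<n}"
    obtain w where w: "w \<in> V - ?C" using nh[OF c(1,2)] c(3) by blast
    obtain K where K: "K \<subseteq> V - ?C" "w \<in> K" "con E K" "\<forall>a\<in>K. \<forall>b\<in>V - ?C. E a b \<longrightarrow> b \<in> K"
      using obtain_component[OF w V(2)] .
    let ?Q = "{q \<in> ?C. \<exists>k\<in>K. E q k}"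
    have Q: "clique E ?Q" by (rule attachments_clique[OF V(5,2) c(2,3) K(3,1)])
    have "hole_free E (K \<union> ?Q)"
      unfolding hole_free_def
    proof (intro allI impI notI)
      fix m d assume d: "4 \<le> m" "cyc E m d" "d ` {..<m} \<subseteq> K \<union> ?Q"
      then have "d ` {..<m} \<subseteq> V" using K(1) c(3) by blast
      then have "d ` {..<m} = ?C" using V(7) c d(1,2) unfolding unique_hole_def by metis
      then have "?C = ?Q" using d(3) K(1) by blast
      then show False using cyc_not_clique[OF c(2,1)] Q by simp
    qed
    moreover have "finite (K \<union> ?Q)" using V(1) K(1) by (auto intro: finite_subset)
    moreover have "?Q \<subset> K \<union> ?Q" using K(1,2) by blast
    ultimately obtain x where x: "x \<in> K \<union> ?Q - ?Q" "clique E {y\<in>K \<union> ?Q. E x y}"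
      using hole_free_simplicial[OF _ V(2,3) _ Q, of "K \<union> ?Q"] by blast
    have "{y\<in>V. E x y} \<subseteq> {y\<in>K \<union> ?Q. E x y}" using x(1) K(4) sy by blast
    then have "clique E {y\<in>V. E x y}" using x(2) unfolding clique_def by blast
    then show ?thesis using x(1) K(1) by blast
  qed
  then obtain x where x: "x \<in> V" "clique E {y\<in>V. E x y}" by blast
  have "V \<noteq> {x}" using assms(8) by auto
  then obtain b where "b \<in> V" "E x b" using conE[OF V(4), of "{x}"] x(1) by blast
  then show ?thesis using that[OF x _ K4_free_clique_nbrs[OF V(6) x V(1)]] by blast
qed

text \<open>This prepares the side condition of (A2'). A vertex of the second cycle off the first
  lies in a component \<open>K\<close> of the rest. If \<open>v\<close> and \<open>w\<close> both
  attach to \<open>K\<close>, then \<open>{x}\<close>, \<open>K\<close> and the remainder of the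
  first cycle link \<open>v\<close> and \<open>w\<close> three times. Otherwise the attachments form
  a clique of at most two vertices, whose removal leaves the second cycle connected; so that cycle
  lies in \<open>K\<close> and its attachments and cannot contain both \<open>v\<close> and
  \<open>w\<close>.\<close>

lemma cycles_through_simplicial_edge:
  assumes V: "symp E" "theta_free E V" and x: "x \<in> V" "{y\<in>V. E x y} = {v, w}" "v \<noteq> w" "E v w"
    and c: "cyc E n c" "c ` {..<n} \<subseteq> V - {x}" "v \<in> c ` {..<n}" "w \<in> c ` {..<n}"
    and d: "cyc E m d" "d ` {..<m} \<subseteq> V - {x}" "v \<in> d ` {..<m}" "w \<in> d ` {..<m}"
  shows "c ` {..<n} = d ` {..<m}"
proof (rule ccontr)
  note sy = sympD[OF V(1)]
  let ?C = "c ` {..<n}" and ?D = "d ` {..<m}"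
  assume ne: "?C \<noteq> ?D"
  obtain y where y: "y \<in> ?D - ?C" using cyc_subset_eq[OF c(1) d(1) _ V(1)] ne by blast
  then have yU: "y \<in> V - {x} - ?C" using d(2) by blast
  obtain K where K: "K \<subseteq> V - {x} - ?C" "y \<in> K" "con E K" "\<forall>a\<in>K. \<forall>b\<in>V - {x} - ?C. E a b \<longrightarrow> b \<in> K"
    using obtain_component[OF yU V(1)] .
  let ?Q = "{q \<in> ?C. \<exists>k\<in>K. E q k}"
  have Q: "clique E ?Q"
    by (rule attachments_clique[OF V(2,1) c(1) _ K(3)]) (use c(2) K(1) in blast)+
  have vw: "clique E {v, w}" using x(4) sy by (auto simp: clique_def)
  have "\<not> (v \<in> ?Q \<and> w \<in> ?Q)"
  proof
    assume a: "v \<in> ?Q \<and> w \<in> ?Q"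
    obtain d' where d': "cyc E n d'" "d' ` {..<n} = ?C" "d' 0 = v" "d' 1 = w"
      using cyc_start_edge[OF c(1,3,4) x(4)] .
    have n: "3 \<le> n" using cycD(1)[OF c(1)] .
    have nb: "E v (d' (n - 1))" "E w (d' 2)" using cycD(3)[OF d'(1), of 0 "n - 1"] cycD(3)[OF d'(1), of 1 2] n d' by auto
    have "d' (n - 1) \<in> ?C - {v, w}" "d' 2 \<in> ?C - {v, w}"
      using cyc_inj[OF d'(1), of "n - 1" 0] cyc_inj[OF d'(1), of "n - 1" 1]
        cyc_inj[OF d'(1), of 2 0] cyc_inj[OF d'(1), of 2 1] n d'(2)[symmetric] d'(3,4) by auto
    note nb = this nb
    have xn: "E v x" "E w x" using x(2) sy by blast+
    have xvw: "x \<noteq> v" "x \<noteq> w" using c by blast+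
    have V': "v \<in> V" "w \<in> V" using x(2) by blast+
    show False
    proof (rule theta_freeD[OF V(2), of v w "{x}" K "?C - {v, w}"])
      show "con E (?C - {v, w})"
        using cyc_remove_clique_con(1)[OF c(1) V(1) vw] x(3) by simp
      show "v \<in> V" "w \<in> V" "v \<noteq> w" "con E {x}" "con E K" using V' x(3) K(3) by simp_all
      show "{x} \<subseteq> V - {v, w}" using x(1) xvw by simp
      show "K \<subseteq> V - {v, w}" using K(1) c(3,4) by blast
      show "?C - {v, w} \<subseteq> V - {v, w}" using c(2) by blast
      show "{x} \<inter> K = {}" "K \<inter> (?C - {v, w}) = {}" using K(1) by blast+
      show "{x} \<inter> (?C - {v, w}) = {}" using c(2) by blast
      show "\<exists>y\<in>{x}. E v y" "\<exists>y\<in>{x}. E w y" using xn by simp_all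
      show "\<exists>y\<in>K. E v y" "\<exists>y\<in>K. E w y" using a by simp_all
      show "\<exists>y\<in>?C - {v, w}. E v y" "\<exists>y\<in>?C - {v, w}. E w y" using nb by blast+
    qed
  qed
  then have Q2: "card ?Q \<le> 2" "finite ?Q"
  proof -
    assume nvw: "\<not> (v \<in> ?Q \<and> w \<in> ?Q)"
    show "finite ?Q" by simp
    show "card ?Q \<le> 2"
    \<comment> \<open>A triangle may have three vertices in a clique. There the bound comes from
      \<open>?Q\<close> missing \<open>v\<close> or \<open>w\<close>.\<close>
    proof (cases "4 \<le> n")
      case True then show ?thesis using cyc_clique(1)[OF c(1) _ Q] by blast
    next
      case False
      then have "card ?C \<le> 3" using card_image_le[of "{..<n}" c] by simp
      moreover have "?Q \<subset> ?C" using nvw c by blast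
      ultimately show ?thesis using psubset_card_mono[of ?C ?Q] by simp
    qed
  qed
  have "con E (?D - ?Q)" using cyc_remove_clique_con(1)[OF d(1) V(1) Q Q2] .
  then have "?D - ?Q \<subseteq> K"
  proof (rule con_closed_subset)
    show "(?D - ?Q) \<inter> K \<noteq> {}" using y K(1,2) by blast
    fix a b assume ab: "a \<in> (?D - ?Q) \<inter> K" "b \<in> ?D - ?Q" "E a b"
    then show "b \<in> K" using K(4) d(2) sy[of a b] by blast
  qed
  then show False using \<open>\<not> (v \<in> ?Q \<and> w \<in> ?Q)\<close> c d K(1) by blast
qed

section \<open>Two long induced cycles\<close>

definition touch :: "('a \<Rightarrow> 'a \<Rightarrow> bool) \<Rightarrow> 'a set \<Rightarrow> 'a set \<Rightarrow> bool" where
  "touch E A B \<longleftrightarrow> (\<exists>a\<in>A. \<exists>b\<in>B. E a b)"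

lemma touch_sym: "symp E \<Longrightarrow> touch E A B \<longleftrightarrow> touch E B A"
  unfolding touch_def symp_def by blast

text \<open>The sets \<open>\<beta> i\<close> are branch sets, to be contracted to single vertices.
  The equivalence for touching pairs, instead of an implication, is what makes the minor induced;
  vertices outside all branch sets get deleted.\<close>

definition minor_model :: "'b graph \<Rightarrow> ('b \<Rightarrow> 'a set) \<Rightarrow> ('a \<Rightarrow> 'a \<Rightarrow> bool) \<Rightarrow> 'a set \<Rightarrow> bool" where
  "minor_model H \<beta> E V \<longleftrightarrow> (\<forall>i\<in>fst H. \<beta> i \<noteq> {} \<and> \<beta> i \<subseteq> V \<and> con E (\<beta> i)) \<and>
     (\<forall>i\<in>fst H. \<forall>j\<in>fst H. i \<noteq> j \<longrightarrow> \<beta> i \<inter> \<beta> j = {} \<and> (adj H i j \<longleftrightarrow> touch E (\<beta> i) (\<beta> j)))"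

lemma minor_modelI:
  fixes H :: "'b::linorder graph"
  assumes "symp E" "\<And>i. i \<in> fst H \<Longrightarrow> \<beta> i \<noteq> {} \<and> \<beta> i \<subseteq> V \<and> con E (\<beta> i)"
    "\<And>i j. i \<in> fst H \<Longrightarrow> j \<in> fst H \<Longrightarrow> i < j \<Longrightarrow>
      \<beta> i \<inter> \<beta> j = {} \<and> (adj H i j \<longleftrightarrow> touch E (\<beta> i) (\<beta> j))"
  shows "minor_model H \<beta> E V"
  unfolding minor_model_def
proof (intro conjI ballI impI)
  fix i j assume ij: "i \<in> fst H" "j \<in> fst H" "i \<noteq> j"
  then consider "i < j" | "j < i" by fastforce
  then have "\<beta> i \<inter> \<beta> j = {} \<and> (adj H i j \<longleftrightarrow> touch E (\<beta> i) (\<beta> j))"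
  proof cases
    case 1 then show ?thesis using assms(3) ij by blast
  next
    case 2
    then show ?thesis
      using assms(3)[OF ij(2,1)] touch_sym[OF assms(1)] adj_sym[of H i j] by (simp add: Int_commute)
  qed
  then show "\<beta> i \<inter> \<beta> j = {}" "adj H i j \<longleftrightarrow> touch E (\<beta> i) (\<beta> j)" by auto
qed (use assms(2) in auto)

text \<open>\<open>Z\<close> and \<open>Y\<close> stand for \<open>c 0\<close> and
  \<open>c 1\<close>, possibly enlarged by vertices off the cycle; \<open>near\<close> says that the
  enlargement sees nothing new on the cycle. The remaining path is split into its last vertex
  \<open>P\<close> and the rest \<open>M\<close>, so that \<open>Z\<close>, \<open>P\<close>,
  \<open>M\<close>, \<open>Y\<close> form a four-cycle.\<close>

lemma hole_side_F1:
  assumes E: "symp E" and c: "cyc E n c" "4 \<le> n" and Z: "c 0 \<in> Z" "c 1 \<in> Y"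
    and near: "\<And>z x. z \<in> Z \<Longrightarrow> x \<in> c ` {2..<n} \<Longrightarrow> E z x \<Longrightarrow> E (c 0) x"
      "\<And>z x. z \<in> Y \<Longrightarrow> x \<in> c ` {2..<n} \<Longrightarrow> E z x \<Longrightarrow> E (c 1) x"
  obtains P M where "P \<subseteq> c ` {2..<n}" "M \<subseteq> c ` {2..<n}" "P \<noteq> {}" "M \<noteq> {}" "con E P" "con E M"
    "P \<inter> M = {}" "touch E P M" "touch E Z P" "touch E M Y" "\<not> touch E Y P" "\<not> touch E Z M"
proof -
  let ?P = "{c (n - 1)}" and ?M = "c ` {2..<n - 1}"
  note a = cycD(3)[OF c(1)]
  show ?thesis
  proof (rule that[of ?P ?M])
    show "?P \<subseteq> c ` {2..<n}" "?M \<subseteq> c ` {2..<n}" "?P \<noteq> {}" "?M \<noteq> {}" using c(2) by auto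
    show "con E ?P" "con E ?M" using cyc_segment_con[OF c(1) _ E, of "n - 1" 2] by simp_all
    have "c i \<noteq> c (n - 1)" if "i \<in> {2..<n - 1}" for i
    proof -
      have "i < n" "n - 1 < n" "i \<noteq> n - 1" using that by auto
      then show ?thesis using cyc_inj[OF c(1), of i "n - 1"] by simp
    qed
    then show "?P \<inter> ?M = {}" by force
    have "E (c (n - 1)) (c (n - 2))" "n - 2 \<in> {2..<n - 1}" using a[of "n - 1" "n - 2"] c(2) by auto
    then show "touch E ?P ?M" unfolding touch_def by blast
    show "touch E Z ?P" using a[of 0 "n - 1"] c(2) Z(1) unfolding touch_def by auto
    have "E (c 2) (c 1)" "2 \<in> {2..<n - 1}" using a[of 2 1] c(2) by auto
    then show "touch E ?M Y" using Z(2) unfolding touch_def by blast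
    show "\<not> touch E Y ?P"
    proof
      assume "touch E Y ?P"
      then obtain z where "z \<in> Y" "E z (c (n - 1))" by (auto simp: touch_def)
      moreover have "c (n - 1) \<in> c ` {2..<n}" using c(2) by auto
      ultimately have "E (c 1) (c (n - 1))" using near(2) by blast
      then show False using a[of 1 "n - 1"] c(2) by auto
    qed
    show "\<not> touch E Z ?M"
    proof
      assume "touch E Z ?M"
      then obtain z i where z: "z \<in> Z" "i \<in> {2..<n - 1}" "E z (c i)" by (auto simp: touch_def)
      moreover have "c i \<in> c ` {2..<n}" using z(2) by auto
      ultimately have "E (c 0) (c i)" using near(1) by blast
      moreover have "i < n" "2 \<le> i" "Suc i < n" using z(2) by auto
      ultimately show False using a[of 0 i] by auto
    qed
  qed
qed

text \<open>\<open>Z\<close> and \<open>Y\<close> become the two vertices of degree 3. The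
  remainders of the two holes are disjoint and have no edge between them, so the contracted
  four-cycles share exactly the edge between \<open>Z\<close> and \<open>Y\<close>.\<close>

lemma F1_model:
  assumes E: "symp E" and c: "cyc E n c" "4 \<le> n" "c ` {2..<n} \<subseteq> V" and d: "cyc E m d" "4 \<le> m" "d ` {2..<m} \<subseteq> V"
    and Z: "con E Z" "c 0 \<in> Z" "d 0 \<in> Z" "Z \<subseteq> V" and Y: "con E Y" "c 1 \<in> Y" "d 1 \<in> Y" "Y \<subseteq> V"
    and near: "\<And>z x. z \<in> Z \<Longrightarrow> x \<in> c ` {2..<n} \<Longrightarrow> E z x \<Longrightarrow> E (c 0) x"
      "\<And>z x. z \<in> Y \<Longrightarrow> x \<in> c ` {2..<n} \<Longrightarrow> E z x \<Longrightarrow> E (c 1) x"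
      "\<And>z x. z \<in> Z \<Longrightarrow> x \<in> d ` {2..<m} \<Longrightarrow> E z x \<Longrightarrow> E (d 0) x"
      "\<And>z x. z \<in> Y \<Longrightarrow> x \<in> d ` {2..<m} \<Longrightarrow> E z x \<Longrightarrow> E (d 1) x"
    and disj: "Z \<inter> Y = {}" "(Z \<union> Y) \<inter> c ` {2..<n} = {}" "(Z \<union> Y) \<inter> d ` {2..<m} = {}"
      "c ` {2..<n} \<inter> d ` {2..<m} = {}"
    and far: "\<And>x y. x \<in> c ` {2..<n} \<Longrightarrow> y \<in> d ` {2..<m} \<Longrightarrow> \<not> E x y"
  shows "\<exists>\<beta>. minor_model F1 \<beta> E V"
proof -
  obtain P M where C: "P \<subseteq> c ` {2..<n}" "M \<subseteq> c ` {2..<n}" "P \<noteq> {}" "M \<noteq> {}" "con E P" "con E M"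
    "P \<inter> M = {}" "touch E P M" "touch E Z P" "touch E M Y" "\<not> touch E Y P" "\<not> touch E Z M"
    using hole_side_F1[OF E c(1,2) Z(2) Y(2) near(1,2)] .
  obtain Q N where D: "Q \<subseteq> d ` {2..<m}" "N \<subseteq> d ` {2..<m}" "Q \<noteq> {}" "N \<noteq> {}" "con E Q" "con E N"
    "Q \<inter> N = {}" "touch E Q N" "touch E Z Q" "touch E N Y" "\<not> touch E Y Q" "\<not> touch E Z N"
    using hole_side_F1[OF E d(1,2) Z(3) Y(3) near(3,4)] .
  have nt: "\<not> touch E A B" if "A \<subseteq> c ` {2..<n}" "B \<subseteq> d ` {2..<m}" for A B
    using that far unfolding touch_def by blast
  have dj: "A \<inter> B = {}" if "A \<subseteq> c ` {2..<n}" "B \<subseteq> d ` {2..<m}" for A B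
    using that disj(4) by blast
  have djZ: "Z \<inter> A = {}" "Y \<inter> A = {}" if "A \<subseteq> c ` {2..<n} \<or> A \<subseteq> d ` {2..<m}" for A
    using that disj(2,3) by blast+
  have "touch E Z Y" using cycD(3)[OF c(1), of 0 1] c(2) Z(2) Y(2) unfolding touch_def by force
  note facts = this C(3-12) D(3-12) nt[OF C(1) D(1)] nt[OF C(1) D(2)] nt[OF C(2) D(1)] nt[OF C(2) D(2)]
    dj[OF C(1) D(1)] dj[OF C(1) D(2)] dj[OF C(2) D(1)] dj[OF C(2) D(2)] disj(1)
    djZ[OF disjI1[OF C(1)]] djZ[OF disjI1[OF C(2)]] djZ[OF disjI2[OF D(1)]] djZ[OF disjI2[OF D(2)]]
  have facts': "touch E N Q" "\<not> touch E P Y" "touch E Y N"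
    using D(8,10) C(11) touch_sym[OF E] by blast+
  have ne: "Z \<noteq> {}" "Y \<noteq> {}" using Z Y by auto
  have sub: "P \<subseteq> V" "M \<subseteq> V" "Q \<subseteq> V" "N \<subseteq> V" using C(1,2) D(1,2) c(3) d(3) by auto
  \<comment> \<open>The order follows the six-cycle of \<open>F1\<close>; its chord 0-3 is the pair
    \<open>Z\<close>, \<open>Y\<close>.\<close>
  have "minor_model F1 ((!) [Z, P, M, Y, N, Q]) E V"
  proof (rule minor_modelI[OF E])
    fix i :: nat assume "i \<in> fst F1"
    then have "i \<in> {0,1,2,3,4,5}" by (simp add: F1_def)
    then show "[Z, P, M, Y, N, Q] ! i \<noteq> {} \<and> [Z, P, M, Y, N, Q] ! i \<subseteq> V \<and> con E ([Z, P, M, Y, N, Q] ! i)"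
      using facts ne sub Z(1,4) Y(1,4) by auto
  next
    fix i j :: nat assume "i \<in> fst F1" "j \<in> fst F1" "i < j"
    then have "(i, j) \<in> {(0,1),(0,2),(0,3),(0,4),(0,5),(1,2),(1,3),(1,4),(1,5),(2,3),(2,4),(2,5),(3,4),(3,5),(4,5)}"
      by (simp add: F1_def) (elim disjE; simp)
    then show "[Z, P, M, Y, N, Q] ! i \<inter> [Z, P, M, Y, N, Q] ! j = {} \<and>
      (adj F1 i j \<longleftrightarrow> touch E ([Z, P, M, Y, N, Q] ! i) ([Z, P, M, Y, N, Q] ! j))"
      by (elim insertE emptyE) (simp_all add: adj_def F1_def doubleton_eq_iff facts facts' Int_commute[of P Y]
        Int_commute[of M Y] Int_commute[of N Q])
  qed
  then show ?thesis by blast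
qed

text \<open>Only \<open>c 0\<close> is enlarged here. The remaining path is split into its two end
  vertices and the middle, which is nonempty because \<open>4 \<le> n\<close>.\<close>

lemma hole_side_F2:
  assumes E: "symp E" and c: "cyc E n c" "4 \<le> n" and Z: "c 0 \<in> Z"
    and near: "\<And>z x. z \<in> Z \<Longrightarrow> x \<in> c ` {1..<n} \<Longrightarrow> E z x \<Longrightarrow> E (c 0) x"
  obtains P M Q where "P \<subseteq> c ` {1..<n}" "M \<subseteq> c ` {1..<n}" "Q \<subseteq> c ` {1..<n}" "P \<noteq> {}" "M \<noteq> {}" "Q \<noteq> {}"
    "con E P" "con E M" "con E Q"
    "P \<inter> M = {}" "P \<inter> Q = {}" "M \<inter> Q = {}"
    "touch E P M" "touch E M Q" "\<not> touch E P Q" "touch E Z P" "touch E Z Q" "\<not> touch E Z M"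
proof -
  let ?P = "{c 1}" and ?M = "c ` {2..<n - 1}" and ?Q = "{c (n - 1)}"
  note a = cycD(3)[OF c(1)]
  show ?thesis
  proof (rule that[of ?P ?M ?Q])
    show "?P \<subseteq> c ` {1..<n}" "?M \<subseteq> c ` {1..<n}" "?Q \<subseteq> c ` {1..<n}" "?P \<noteq> {}" "?M \<noteq> {}" "?Q \<noteq> {}" using c(2) by auto
    show "con E ?P" "con E ?M" "con E ?Q" using cyc_segment_con[OF c(1) _ E, of "n - 1" 2] by simp_all
    have ne: "c i \<noteq> c (n - 1)" "c i \<noteq> c 1" if "i \<in> {2..<n - 1}" for i
    proof -
      have "i < n" "n - 1 < n" "1 < n" "i \<noteq> n - 1" "i \<noteq> 1" using that c(2) by auto
      then show "c i \<noteq> c (n - 1)" "c i \<noteq> c 1"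
        using cyc_inj[OF c(1), of i "n - 1"] cyc_inj[OF c(1), of i 1] by simp_all
    qed
    show "?P \<inter> ?M = {}" "?M \<inter> ?Q = {}" using ne by force+
    show "?P \<inter> ?Q = {}" using cyc_inj[OF c(1), of 1 "n - 1"] c(2) by auto
    have "E (c (n - 2)) (c (n - 1))" "n - 2 \<in> {2..<n - 1}" using a[of "n - 2" "n - 1"] c(2) by auto
    then show "touch E ?M ?Q" unfolding touch_def by blast
    have "E (c 1) (c 2)" "2 \<in> {2..<n - 1}" using a[of 1 2] c(2) by auto
    then show "touch E ?P ?M" unfolding touch_def by blast
    show "touch E Z ?P" "touch E Z ?Q" using a[of 0 1] a[of 0 "n - 1"] c(2) Z(1) unfolding touch_def by auto
    show "\<not> touch E ?P ?Q" using a[of 1 "n - 1"] c(2) by (auto simp: touch_def)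
    show "\<not> touch E Z ?M"
    proof
      assume "touch E Z ?M"
      then obtain z i where z: "z \<in> Z" "i \<in> {2..<n - 1}" "E z (c i)" by (auto simp: touch_def)
      moreover have "c i \<in> c ` {1..<n}" using z(2) by auto
      ultimately have "E (c 0) (c i)" using near by blast
      moreover have "i < n" "2 \<le> i" "Suc i < n" using z(2) by auto
      ultimately show False using a[of 0 i] by auto
    qed
  qed
qed

text \<open>\<open>Z\<close> is contracted to the vertex common to both four-cycles. This treats
  holes that share a vertex and holes that are joined by a connecting set alike.\<close>

lemma F2_model:
  assumes E: "symp E" and c: "cyc E n c" "4 \<le> n" "c ` {1..<n} \<subseteq> V" and d: "cyc E m d" "4 \<le> m" "d ` {1..<m} \<subseteq> V"
    and Z: "con E Z" "c 0 \<in> Z" "d 0 \<in> Z" "Z \<subseteq> V"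
    and near: "\<And>z x. z \<in> Z \<Longrightarrow> x \<in> c ` {1..<n} \<Longrightarrow> E z x \<Longrightarrow> E (c 0) x"
      "\<And>z x. z \<in> Z \<Longrightarrow> x \<in> d ` {1..<m} \<Longrightarrow> E z x \<Longrightarrow> E (d 0) x"
    and disj: "Z \<inter> c ` {1..<n} = {}" "Z \<inter> d ` {1..<m} = {}" "c ` {1..<n} \<inter> d ` {1..<m} = {}"
    and far: "\<And>x y. x \<in> c ` {1..<n} \<Longrightarrow> y \<in> d ` {1..<m} \<Longrightarrow> \<not> E x y"
  shows "\<exists>\<beta>. minor_model F2 \<beta> E V"
proof -
  obtain P M Q where C: "P \<subseteq> c ` {1..<n}" "M \<subseteq> c ` {1..<n}" "Q \<subseteq> c ` {1..<n}" "P \<noteq> {}" "M \<noteq> {}" "Q \<noteq> {}"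
    "con E P" "con E M" "con E Q" "P \<inter> M = {}" "P \<inter> Q = {}" "M \<inter> Q = {}"
    "touch E P M" "touch E M Q" "\<not> touch E P Q" "touch E Z P" "touch E Z Q" "\<not> touch E Z M"
    using hole_side_F2[OF E c(1,2) Z(2) near(1)] .
  obtain P' M' Q' where D: "P' \<subseteq> d ` {1..<m}" "M' \<subseteq> d ` {1..<m}" "Q' \<subseteq> d ` {1..<m}" "P' \<noteq> {}" "M' \<noteq> {}" "Q' \<noteq> {}"
    "con E P'" "con E M'" "con E Q'" "P' \<inter> M' = {}" "P' \<inter> Q' = {}" "M' \<inter> Q' = {}"
    "touch E P' M'" "touch E M' Q'" "\<not> touch E P' Q'" "touch E Z P'" "touch E Z Q'" "\<not> touch E Z M'"
    using hole_side_F2[OF E d(1,2) Z(3) near(2)] .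
  have nt: "\<not> touch E A B" "A \<inter> B = {}" if "A \<subseteq> c ` {1..<n}" "B \<subseteq> d ` {1..<m}" for A B
    using that far disj(3) unfolding touch_def by blast+
  have djZ: "Z \<inter> A = {}" if "A \<subseteq> c ` {1..<n} \<or> A \<subseteq> d ` {1..<m}" for A
    using that disj(1,2) by blast
  note facts = C(4-) D(4-) nt[OF C(1) D(1)] nt[OF C(1) D(2)] nt[OF C(1) D(3)]
    nt[OF C(2) D(1)] nt[OF C(2) D(2)] nt[OF C(2) D(3)] nt[OF C(3) D(1)] nt[OF C(3) D(2)] nt[OF C(3) D(3)]
    djZ[OF disjI1[OF C(1)]] djZ[OF disjI1[OF C(2)]] djZ[OF disjI1[OF C(3)]]
    djZ[OF disjI2[OF D(1)]] djZ[OF disjI2[OF D(2)]] djZ[OF disjI2[OF D(3)]]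
  have ne: "Z \<noteq> {}" using Z by auto
  have sub: "P \<subseteq> V" "M \<subseteq> V" "Q \<subseteq> V" "P' \<subseteq> V" "M' \<subseteq> V" "Q' \<subseteq> V" using C(1-3) D(1-3) c(3) d(3) by auto
  let ?\<beta> = "(!) [Z, P, M, Q, P', M', Q']"
  have "minor_model F2 ?\<beta> E V"
  proof (rule minor_modelI[OF E])
    fix i :: nat assume "i \<in> fst F2"
    then have "i \<in> {0,1,2,3,4,5,6}" by (simp add: F2_def)
    then show "?\<beta> i \<noteq> {} \<and> ?\<beta> i \<subseteq> V \<and> con E (?\<beta> i)"
      using facts ne sub Z(1,4) by auto
  next
    fix i j :: nat assume "i \<in> fst F2" "j \<in> fst F2" "i < j"
    then have "(i, j) \<in> {(0,1),(0,2),(0,3),(0,4),(0,5),(0,6),(1,2),(1,3),(1,4),(1,5),(1,6),(2,3),(2,4),(2,5),(2,6),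
      (3,4),(3,5),(3,6),(4,5),(4,6),(5,6)}"
      by (simp add: F2_def) (elim disjE; simp)
    then show "?\<beta> i \<inter> ?\<beta> j = {} \<and> (adj F2 i j \<longleftrightarrow> touch E (?\<beta> i) (?\<beta> j))"
      by (elim insertE emptyE) (simp_all add: adj_def F2_def doubleton_eq_iff facts)
  qed
  then show ?thesis by blast
qed

section \<open>Linking two holes\<close>

lemma cyc_tail:
  assumes "cyc E n c"
  shows "c ` {1..<n} = c ` {..<n} - {c 0}" "c ` {2..<n} = c ` {..<n} - {c 0, c 1}"
proof -
  have n: "3 \<le> n" using cycD(1)[OF assms] .
  have "c ` {..<n} - c ` {0} = c ` ({..<n} - {0})" "c ` {..<n} - c ` {0, 1} = c ` ({..<n} - {0, 1})"
    using n by (intro inj_on_image_set_diff[OF cycD(2)[OF assms], symmetric]; auto)+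
  moreover have "{..<n} - {0} = {1..<n}" "{..<n} - {0, 1} = {2..<n}" by auto
  ultimately show "c ` {1..<n} = c ` {..<n} - {c 0}" "c ` {2..<n} = c ` {..<n} - {c 0, c 1}" by simp_all
qed

text \<open>The attachments of \<open>K\<close> to the hole form a clique of at most two vertices,
  and without them the second cycle is still connected. It has a vertex in \<open>K\<close> and can
  leave \<open>K\<close> only through an attachment.\<close>

lemma cycle_in_component:
  assumes V: "symp E" "theta_free E V" and c: "cyc E n c" "4 \<le> n" "c ` {..<n} \<subseteq> V"
    and d: "cyc E m d" "d ` {..<m} \<subseteq> V" "d ` {..<m} \<noteq> c ` {..<n}"
  obtains K where "con E K" "K \<subseteq> V - c ` {..<n}" "\<forall>a\<in>K. \<forall>b\<in>V - c ` {..<n}. E a b \<longrightarrow> b \<in> K"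
    "d ` {..<m} \<subseteq> K \<union> {q \<in> c ` {..<n}. \<exists>k\<in>K. E q k}" "K \<noteq> {}"
proof -
  note sy = sympD[OF V(1)]
  let ?C = "c ` {..<n}" and ?D = "d ` {..<m}"
  obtain y where y: "y \<in> ?D - ?C" using cyc_subset_eq[OF c(1) d(1) _ V(1)] d(3) by blast
  then have yU: "y \<in> V - ?C" using d(2) by blast
  obtain K where K: "K \<subseteq> V - ?C" "y \<in> K" "con E K" "\<forall>a\<in>K. \<forall>b\<in>V - ?C. E a b \<longrightarrow> b \<in> K"
    using obtain_component[OF yU V(1)] .
  let ?Q = "{q \<in> ?C. \<exists>k\<in>K. E q k}"
  have Q: "clique E ?Q" by (rule attachments_clique[OF V(2,1) c(1,3) K(3,1)])
  have "con E (?D - ?Q)"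
    by (rule cyc_remove_clique_con(1)[OF d(1) V(1) Q cyc_clique(1)[OF c(1,2) Q]]) auto
  then have "?D - ?Q \<subseteq> K"
  proof (rule con_closed_subset)
    show "(?D - ?Q) \<inter> K \<noteq> {}" using y K(1,2) by blast
    fix a b assume ab: "a \<in> (?D - ?Q) \<inter> K" "b \<in> ?D - ?Q" "E a b"
    then show "b \<in> K" using K(4) d(2) sy[of a b] by blast
  qed
  then have "?D \<subseteq> K \<union> ?Q" by blast
  then show ?thesis using that[OF K(3,1,4)] K(2) by blast
qed

text \<open>A shared vertex or an edge between the holes serves directly. Otherwise a part
  \<open>M\<close> of \<open>K - D\<close> is grown from an attachment \<open>q\<close> on
  \<open>C\<close>; being connected and off \<open>D\<close>, it stays in \<open>L\<close>, and
  connectedness of \<open>K\<close> leads from it to a vertex of \<open>D\<close>. That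
  \<open>Z\<close> lies in \<open>K\<close> off \<open>C\<close> and in \<open>L\<close> off
  \<open>D\<close> ensures that its inner vertices see only attachments of either hole.\<close>

lemma obtain_connector:
  assumes V: "symp E" "con E V" and C: "C \<subseteq> V" "C \<noteq> {}" and D: "D \<subseteq> V" "D \<noteq> {}"
    and K: "con E K" "K \<subseteq> V - C" "\<forall>a\<in>K. \<forall>b\<in>V - C. E a b \<longrightarrow> b \<in> K" "D - C \<subseteq> K" "K \<noteq> {}"
    and L: "L \<subseteq> V - D" "\<forall>a\<in>L. \<forall>b\<in>V - D. E a b \<longrightarrow> b \<in> L" "C - D \<subseteq> L"
    and CD: "\<And>x. x \<in> C \<Longrightarrow> x \<in> D \<Longrightarrow> (\<exists>k\<in>K. E x k) \<and> (\<exists>k\<in>L. E x k)"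
  obtains Z p r where "con E Z" "Z \<subseteq> V" "Z \<inter> C = {p}" "Z \<inter> D = {r}" "Z - C \<subseteq> K" "Z - D \<subseteq> L"
    "\<exists>k\<in>K. E p k" "\<exists>k\<in>L. E r k" "C \<inter> D \<noteq> {} \<longrightarrow> p = r"
proof (cases "C \<inter> D = {}")
  case False
  then obtain p where p: "p \<in> C" "p \<in> D" by blast
  then show ?thesis using that[of "{p}" p p] CD[OF p] C by auto
next
  case disj: True
  note sy = sympD[OF V(1)]
  show ?thesis
  proof (cases "\<exists>p\<in>C. \<exists>r\<in>D. E p r")
    case True
    then obtain p r where pr: "p \<in> C" "r \<in> D" "E p r" by blast
    have "con E {p, r}" using con_insert[of E "{r}" r p] V(1) pr by simp
    moreover have "{p, r} \<subseteq> V" "{p, r} \<inter> C = {p}" "{p, r} \<inter> D = {r}" "r \<in> K" "p \<in> L"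
      using pr disj K(4) L(3) C D by blast+
    moreover have "{p, r} - C \<subseteq> K" "{p, r} - D \<subseteq> L" using \<open>r \<in> K\<close> \<open>p \<in> L\<close> pr by blast+
    ultimately show ?thesis
      using that[of "{p, r}" p r] pr(3) sy[OF pr(3)] disj by blast
  next
    case no: False
    have "K \<noteq> V" using K(2) C by blast
    then obtain k q where k: "k \<in> K" "q \<in> V" "q \<notin> K" "E k q"
      using conE[OF V(2), of K] K(2,5) by blast
    then have q: "q \<in> C" using K(3) by blast
    have kD: "k \<in> K - D" using no k q sy by blast
    obtain M where M: "M \<subseteq> K - D" "k \<in> M" "con E M" "\<forall>a\<in>M. \<forall>b\<in>K - D. E a b \<longrightarrow> b \<in> M"
      using obtain_component[OF kD V(1)] .
    have qM: "con E (insert q M)" by (rule con_insert[OF M(3) V(1) M(2) sy[OF k(4)]])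
    have "insert q M \<subseteq> L"
    proof (rule con_closed_subset[OF qM])
      show "insert q M \<inter> L \<noteq> {}" using q disj L(3) by blast
      fix a b assume "a \<in> insert q M \<inter> L" "b \<in> insert q M" "E a b"
      then show "b \<in> L" using L(2,3) M(1) K(2) q disj by blast
    qed
    show ?thesis
    proof (cases "M = K")
      case True
      then show ?thesis using M(1) K(4) disj D by blast
    next
      case False
      then obtain a b where ab: "a \<in> M" "b \<in> K" "b \<notin> M" "E a b"
        using conE[OF K(1), of M] M(1,2) by blast
      then have b: "b \<in> D" using M(4) by blast
      have "con E (insert b (insert q M))"
        by (rule con_insert[OF qM V(1) _ sy[OF ab(4)]]) (use ab in simp)
      moreover have "insert b (insert q M) \<inter> C = {q}" using q b disj M(1) K(2) by blast
      moreover have "insert b (insert q M) \<inter> D = {b}" using q b disj M(1) by blast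
      moreover have "insert b (insert q M) \<subseteq> V" using ab k(2) M(1) K(2) by blast
      moreover have "insert b (insert q M) - C \<subseteq> K" using ab q M(1) by blast
      moreover have "insert b (insert q M) - D \<subseteq> L" using b \<open>insert q M \<subseteq> L\<close> by blast
      ultimately show ?thesis
        using that[of "insert b (insert q M)" q b] sy[OF k(4)] k(1) sy[OF ab(4)] ab(1) \<open>insert q M \<subseteq> L\<close> disj by blast
    qed
  qed
qed

text \<open>Apart from the connector \<open>Z\<close>, the holes have a second contact or not. A
  second contact is a shared vertex or an edge and is contracted to the other end of the common edge
  of \<open>F1\<close>. Without one, the remaining paths are separated and the result is
  \<open>F2\<close>.\<close>

lemma two_holes_model:
  assumes V: "symp E" "con E V" "theta_free E V"
    and c: "cyc E n c" "4 \<le> n" "c ` {..<n} \<subseteq> V" and d: "cyc E m d" "4 \<le> m" "d ` {..<m} \<subseteq> V"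
    and ne: "c ` {..<n} \<noteq> d ` {..<m}"
  shows "(\<exists>\<beta>. minor_model F1 \<beta> E V) \<or> (\<exists>\<beta>. minor_model F2 \<beta> E V)"
proof -
  note sy = sympD[OF V(1)]
  define C where "C = c ` {..<n}"
  define D where "D = d ` {..<m}"
  note CDdef = C_def[symmetric] D_def[symmetric]
  obtain K where K: "con E K" "K \<subseteq> V - C" "\<forall>a\<in>K. \<forall>b\<in>V - C. E a b \<longrightarrow> b \<in> K"
    "D \<subseteq> K \<union> {q \<in> C. \<exists>k\<in>K. E q k}" "K \<noteq> {}"
    using cycle_in_component[OF V(1,3) c d(1,3) ne[symmetric]] unfolding CDdef .
  obtain L where L: "con E L" "L \<subseteq> V - D" "\<forall>a\<in>L. \<forall>b\<in>V - D. E a b \<longrightarrow> b \<in> L"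
    "C \<subseteq> L \<union> {q \<in> D. \<exists>k\<in>L. E q k}" "L \<noteq> {}"
    using cycle_in_component[OF V(1,3) d c(1,3) ne] unfolding CDdef .
  define Q where "Q = {q \<in> C. \<exists>k\<in>K. E q k}"
  define R where "R = {q \<in> D. \<exists>k\<in>L. E q k}"
  have Qc: "clique E Q" "Q \<subseteq> C"
    unfolding Q_def C_def using attachments_clique[OF V(3,1) c(1,3) K(1)] K(2) unfolding C_def by auto
  have Rc: "clique E R" "R \<subseteq> D"
    unfolding R_def D_def using attachments_clique[OF V(3,1) d(1,3) L(1)] L(2) unfolding D_def by auto
  have Q2: "card Q \<le> 2" "finite Q" using cyc_clique[OF c(1,2) Qc(1)] Qc(2) unfolding C_def by auto
  have R2: "card R \<le> 2" "finite R" using cyc_clique[OF d(1,2) Rc(1)] Rc(2) unfolding D_def by auto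
  have DK: "D - C \<subseteq> K" and CL: "C - D \<subseteq> L" and CDQ: "C \<inter> D \<subseteq> Q" "C \<inter> D \<subseteq> R"
    using K(2,4) L(2,4) unfolding Q_def R_def by blast+
  have inQ: "x \<in> Q" if "x \<in> C" "z \<in> K" "E z x \<or> E x z" for x z using that sy unfolding Q_def by blast
  have inR: "x \<in> R" if "x \<in> D" "z \<in> L" "E z x \<or> E x z" for x z using that sy unfolding R_def by blast
  have CV: "C \<subseteq> V" "C \<noteq> {}" "D \<subseteq> V" "D \<noteq> {}"
    using c d unfolding C_def D_def by (auto simp: lessThan_empty_iff)
  have CDn: "(\<exists>k\<in>K. E x k) \<and> (\<exists>k\<in>L. E x k)" if "x \<in> C" "x \<in> D" for x
    using that CDQ unfolding Q_def R_def by blast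
  obtain Z p r where Z: "con E Z" "Z \<subseteq> V" "Z \<inter> C = {p}" "Z \<inter> D = {r}" "Z - C \<subseteq> K" "Z - D \<subseteq> L"
    "\<exists>k\<in>K. E p k" "\<exists>k\<in>L. E r k" "C \<inter> D \<noteq> {} \<longrightarrow> p = r"
    using obtain_connector[OF V(1,2) CV K(1-3) DK K(5) L(2,3) CL CDn] .
  have p: "p \<in> Q" "p \<in> C" "p \<in> Z" using Z(3,7) unfolding Q_def by auto
  have r: "r \<in> R" "r \<in> D" "r \<in> Z" using Z(4,8) unfolding R_def by auto
  show ?thesis
  proof (cases "\<exists>q\<in>C - {p}. \<exists>q'\<in>D - {r}. q = q' \<or> E q q'")
    case True
    \<comment> \<open>A second contact consists of attachments. Shared vertices are in
      \<open>Q\<close> and in \<open>R\<close> anyway; if \<open>q\<close> and \<open>q'\<close>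
      each lie on one hole only, then \<open>q'\<close> is in \<open>K\<close> and \<open>q\<close>
      in \<open>L\<close>, and the edge between them makes both attachments.\<close>
    have "\<exists>q q'. q \<in> Q \<and> q' \<in> R \<and> q \<noteq> p \<and> q' \<noteq> r \<and> (q = q' \<or> E q q')"
    proof -
      obtain q q' where q: "q \<in> C - {p}" "q' \<in> D - {r}" "q = q' \<or> E q q'" using True by blast
      consider "q \<in> D" | "q' \<in> C" | "q \<notin> D" "q' \<notin> C" by blast
      then show ?thesis
      proof cases
        case 1
        then have "q \<in> C \<inter> D" using q by blast
        then show ?thesis using CDQ Z(9) q(1) by blast
      next
        case 2
        then have "q' \<in> C \<inter> D" using q by blast
        then show ?thesis using CDQ Z(9) q(2) by blast
      next
        case 3
        then have "E q q'" "q' \<in> K" "q \<in> L" using q DK CL by blast+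
        then have "q \<in> Q" "q' \<in> R" using inQ[of q q'] inR[of q' q] q by blast+
        then show ?thesis using q by blast
      qed
    qed
    then obtain q q' where q: "q \<in> Q" "q' \<in> R" "q \<noteq> p" "q' \<noteq> r" "q = q' \<or> E q q'" by blast
    have Qe: "Q = {p, q}" using card_seteq[of Q "{p, q}"] Q2 p q by simp
    have Re: "R = {r, q'}" using card_seteq[of R "{r, q'}"] R2 r q by simp
    have "E p q" "E r q'" using Qc(1) Rc(1) p r q unfolding clique_def by metis+
    obtain c' where c': "cyc E n c'" "c' ` {..<n} = C" "c' 0 = p" "c' 1 = q"
      using cyc_start_edge[OF c(1) _ _ \<open>E p q\<close>] p q Qc(2) unfolding C_def by (metis subsetD)
    obtain d' where d': "cyc E m d'" "d' ` {..<m} = D" "d' 0 = r" "d' 1 = q'"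
      using cyc_start_edge[OF d(1) _ _ \<open>E r q'\<close>] r q Rc(2) unfolding D_def by (metis subsetD)
    have ct: "c' ` {2..<n} = C - {p, q}" using cyc_tail(2)[OF c'(1)] c' by simp
    have dt: "d' ` {2..<m} = D - {r, q'}" using cyc_tail(2)[OF d'(1)] d' by simp
    have qC: "q \<in> C" "q' \<in> D" using q Qc Rc by blast+
    \<comment> \<open>Shared vertices lie in both \<open>Q = {p, q}\<close> and
      \<open>R = {r, q'}\<close>, and then \<open>p = r\<close>. So if \<open>q\<close> or
      \<open>q'\<close> is shared, they coincide.\<close>
    have q'C: "q' = q \<or> q' \<notin> C \<and> q \<notin> D"
    proof (cases "q' \<in> C \<or> q \<in> D")
      case True
      then show ?thesis using CDQ[unfolded Qe Re] qC Z(9) q by blast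
    qed simp
    have "\<exists>\<beta>. minor_model F1 \<beta> E V"
    proof (rule F1_model[OF V(1) c'(1) c(2) _ d'(1) d(2), where Z = Z and Y = "{q, q'}"])
      show "c' ` {2..<n} \<subseteq> V" "d' ` {2..<m} \<subseteq> V" unfolding ct dt using CV by blast+
      show "con E Z" "c' 0 \<in> Z" "d' 0 \<in> Z" "Z \<subseteq> V" using Z p r c' d' by simp_all
      show "con E {q, q'}" using con_insert[of E "{q'}" q' q] V(1) q(5) by auto
      show "c' 1 \<in> {q, q'}" "d' 1 \<in> {q, q'}" using c' d' by simp_all
      show "{q, q'} \<subseteq> V" using qC CV by blast
      show "Z \<inter> {q, q'} = {}" using Z(3,4) qC q by blast
      show "(Z \<union> {q, q'}) \<inter> c' ` {2..<n} = {}" unfolding ct using Z(3) q'C by blast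
      show "(Z \<union> {q, q'}) \<inter> d' ` {2..<m} = {}" unfolding dt using Z(4) q'C by blast
      show "c' ` {2..<n} \<inter> d' ` {2..<m} = {}" unfolding ct dt using CDQ Qe by blast
      show "E (c' 0) x" if "z \<in> Z" "x \<in> c' ` {2..<n}" "E z x" for z x
      proof (cases "z \<in> C")
        case True
        then have "z = p" using Z(3) that(1) by blast
        then show ?thesis using that(3) c'(3) by simp
      next
        case False then show ?thesis using inQ[of x z] Z(5) that unfolding ct Qe by blast
      qed
      show "E (d' 0) x" if "z \<in> Z" "x \<in> d' ` {2..<m}" "E z x" for z x
      proof (cases "z \<in> D")
        case True
        then have "z = r" using Z(4) that(1) by blast
        then show ?thesis using that(3) d'(3) by simp
      next
        case False then show ?thesis using inR[of x z] Z(6) that unfolding dt Re by blast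
      qed
      show "E (c' 1) x" if "z \<in> {q, q'}" "x \<in> c' ` {2..<n}" "E z x" for z x
      proof (cases "z = q")
        case True then show ?thesis using that c'(4) by simp
      next
        case False
        then have "z \<in> K" using that(1) q'C qC DK by blast
        then show ?thesis using inQ[of x z] that unfolding ct Qe by blast
      qed
      show "E (d' 1) x" if "z \<in> {q, q'}" "x \<in> d' ` {2..<m}" "E z x" for z x
      proof (cases "z = q'")
        case True then show ?thesis using that d'(4) by simp
      next
        case False
        then have "z \<in> L" using that(1) q'C qC CL by blast
        then show ?thesis using inR[of x z] that unfolding dt Re by blast
      qed
      show "\<not> E x y" if "x \<in> c' ` {2..<n}" "y \<in> d' ` {2..<m}" for x y
      proof
        assume e: "E x y"
        have "y \<notin> C" using that(2) CDQ(2) unfolding dt Re by blast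
        then have "y \<in> K" using that(2) DK unfolding dt by blast
        then show False using inQ[of x y] e that(1) unfolding ct Qe by blast
      qed
    qed
    then show ?thesis ..
  next
    case False
    obtain c' where c': "cyc E n c'" "c' ` {..<n} = C" "c' 0 = p"
      using cyc_rotate[OF c(1)] p unfolding C_def by metis
    obtain d' where d': "cyc E m d'" "d' ` {..<m} = D" "d' 0 = r"
      using cyc_rotate[OF d(1)] r unfolding D_def by metis
    have ct: "c' ` {1..<n} = C - {p}" using cyc_tail(1)[OF c'(1)] c' by simp
    have dt: "d' ` {1..<m} = D - {r}" using cyc_tail(1)[OF d'(1)] d' by simp
    have "\<exists>\<beta>. minor_model F2 \<beta> E V"
    proof (rule F2_model[OF V(1) c'(1) c(2) _ d'(1) d(2), where Z = Z])
      show "c' ` {1..<n} \<subseteq> V" "d' ` {1..<m} \<subseteq> V" unfolding ct dt using CV by blast+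
      show "con E Z" "c' 0 \<in> Z" "d' 0 \<in> Z" "Z \<subseteq> V" using Z p r c' d' by simp_all
      show "Z \<inter> c' ` {1..<n} = {}" unfolding ct using Z(3) by blast
      show "Z \<inter> d' ` {1..<m} = {}" unfolding dt using Z(4) by blast
      show "c' ` {1..<n} \<inter> d' ` {1..<m} = {}" unfolding ct dt using False by blast
      show "E (c' 0) x" if "z \<in> Z" "x \<in> c' ` {1..<n}" "E z x" for z x
      proof (cases "z \<in> C")
        case True
        then have "z = p" using Z(3) that(1) by blast
        then show ?thesis using that(3) c'(3) by simp
      next
        case False
        then have "x \<in> Q" "x \<noteq> p" using inQ[of x z] Z(5) that unfolding ct by blast+
        then show ?thesis using Qc(1) p(1) c'(3) unfolding clique_def by metis
      qed
      show "E (d' 0) x" if "z \<in> Z" "x \<in> d' ` {1..<m}" "E z x" for z x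
      proof (cases "z \<in> D")
        case True
        then have "z = r" using Z(4) that(1) by blast
        then show ?thesis using that(3) d'(3) by simp
      next
        case False
        then have "x \<in> R" "x \<noteq> r" using inR[of x z] Z(6) that unfolding dt by blast+
        then show ?thesis using Rc(1) r(1) d'(3) unfolding clique_def by metis
      qed
      show "\<not> E x y" if "x \<in> c' ` {1..<n}" "y \<in> d' ` {1..<m}" for x y
        using that False unfolding ct dt by blast
    qed
    then show ?thesis ..
  qed
qed

section \<open>Induced minors and orientations\<close>

lemma con_cong: "con E A \<Longrightarrow> (\<And>a b. a \<in> A \<Longrightarrow> b \<in> A \<Longrightarrow> E a b \<Longrightarrow> F a b) \<Longrightarrow> con F A"
proof (rule conI)
  fix X assume c: "con E A" and EF: "\<And>a b. a \<in> A \<Longrightarrow> b \<in> A \<Longrightarrow> E a b \<Longrightarrow> F a b"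
    and X: "X \<subseteq> A" "X \<noteq> {}" "X \<noteq> A"
  obtain a b where "a \<in> X" "b \<in> A" "b \<notin> X" "E a b" using conE[OF c X] .
  then show "\<exists>a\<in>X. \<exists>b\<in>A - X. F a b" using EF[of a b] X(1) by blast
qed

lemma graph_edge_doubleton:
  assumes "graph G" "e \<in> snd G"
  obtains a b where "e = {a, b}" "adj G a b" "a \<in> fst G" "b \<in> fst G" "a \<noteq> b"
proof -
  obtain a b where "a \<noteq> b" "a \<in> fst G" "b \<in> fst G" "e = {a, b}"
    using assms unfolding graph_def by blast
  then show ?thesis using that[of a b] assms(2) by (simp add: adj_def)
qed

lemma graph_iff_card: "graph G \<longleftrightarrow> finite (fst G) \<and> (\<forall>e\<in>snd G. card e = 2 \<and> e \<subseteq> fst G)"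
  unfolding graph_def card_2_iff by (rule conj_cong[OF refl], rule ball_cong[OF refl]) auto

lemma not_adj_self: "graph G \<Longrightarrow> \<not> adj G a a"
  using graph_adj(3) by fastforce

lemma adj_delete_vertex: "adj (delete_vertex G v) a b \<longleftrightarrow> adj G a b \<and> a \<noteq> v \<and> b \<noteq> v"
  by (auto simp: adj_def delete_vertex_def)

lemma graph_delete_vertex:
  assumes "graph G" shows "graph (delete_vertex G v)"
  using assms unfolding graph_iff_card delete_vertex_def by auto

lemma adj_contract_edge:
  assumes "graph G" "u \<noteq> v"
  shows "adj (contract_edge G u v) a b \<longleftrightarrow> a \<noteq> v \<and> b \<noteq> v \<and>
    (adj G a b \<or> a = u \<and> b \<noteq> u \<and> adj G v b \<or> b = u \<and> a \<noteq> u \<and> adj G v a)"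
proof -
  have "w \<noteq> v" if "{v, w} \<in> snd G" for w using not_adj_self[OF assms(1), of v] that by (auto simp: adj_def)
  then show ?thesis using assms(2)
    by (auto simp: adj_def contract_edge_def doubleton_eq_iff insert_commute)
qed

lemma graph_contract_edge:
  assumes "graph G" "adj G u v"
  shows "graph (contract_edge G u v)"
  unfolding graph_def
proof (intro conjI ballI)
  show "finite (fst (contract_edge G u v))" using assms(1) by (simp add: graph_def contract_edge_def)
  have uv: "u \<in> fst G" "u \<noteq> v" using graph_adj[OF assms] by auto
  fix e assume "e \<in> snd (contract_edge G u v)"
  then consider "e \<in> snd G" "v \<notin> e" | w where "e = {u, w}" "adj G v w" "w \<noteq> u"
    by (auto simp: contract_edge_def adj_def)
  then show "\<exists>x y. x \<noteq> y \<and> x \<in> fst (contract_edge G u v) \<and> y \<in> fst (contract_edge G u v) \<and> e = {x, y}"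
  proof cases
    case 1
    obtain a b where "e = {a, b}" "a \<in> fst G" "b \<in> fst G" "a \<noteq> b"
      using graph_edge_doubleton[OF assms(1) 1(1)] by metis
    then show ?thesis using 1(2) by (intro exI[of _ a] exI[of _ b]) (auto simp: contract_edge_def)
  next
    case 2
    then have "w \<in> fst G" "w \<noteq> v" using graph_adj[OF assms(1) 2(2)] by auto
    then show ?thesis using 2 uv by (intro exI[of _ u] exI[of _ w]) (auto simp: contract_edge_def)
  qed
qed

text \<open>A cut of the contracted set is lifted by putting \<open>v\<close> on the side of
  \<open>u\<close>; a crossing edge at \<open>v\<close> then turns into one at
  \<open>u\<close>.\<close>

lemma con_contract_edge:
  assumes G: "graph G" "adj G u v" and A: "con (adj G) A" "v \<in> A \<longrightarrow> u \<in> A"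
  shows "con (adj (contract_edge G u v)) (A - {v})"
proof (rule conI)
  have uv: "u \<noteq> v" using graph_adj(3)[OF G] .
  note a = adj_contract_edge[OF G(1) uv]
  fix X assume X: "X \<subseteq> A - {v}" "X \<noteq> {}" "X \<noteq> A - {v}"
  show "\<exists>x\<in>X. \<exists>y\<in>A - {v} - X. adj (contract_edge G u v) x y"
  proof (cases "v \<in> A \<and> u \<in> X")
    case True
    obtain x y where xy: "x \<in> insert v X" "y \<in> A" "y \<notin> insert v X" "adj G x y"
      using conE[OF A(1), of "insert v X"] X True by blast
    show ?thesis
    proof (cases "x = v")
      case True
      then have "adj (contract_edge G u v) u y" using a xy \<open>v \<in> A \<and> u \<in> X\<close> uv by auto
      then show ?thesis using xy \<open>v \<in> A \<and> u \<in> X\<close> by blast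
    next
      case False
      then have "adj (contract_edge G u v) x y" using a xy by auto
      then show ?thesis using xy False by blast
    qed
  next
    case False
    obtain x y where xy: "x \<in> X" "y \<in> A" "y \<notin> X" "adj G x y"
      using conE[OF A(1), of X] X by blast
    show ?thesis
    proof (cases "y = v")
      case True
      then have "u \<in> A" "u \<notin> X" using False A(2) xy by auto
      moreover have "adj (contract_edge G u v) x u"
        using a xy True X uv \<open>u \<notin> X\<close> adj_sym[of G x v] by auto
      ultimately show ?thesis using xy uv by blast
    next
      case False
      then have "adj (contract_edge G u v) x y" using a xy X by auto
      then show ?thesis using xy False by blast
    qed
  qed
qed

lemma touch_contract_edge:
  assumes G: "graph G" "adj G u v" and AB: "A \<inter> B = {}" "u \<in> A \<longleftrightarrow> v \<in> A" "u \<in> B \<longleftrightarrow> v \<in> B"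
  shows "touch (adj (contract_edge G u v)) (A - {v}) (B - {v}) \<longleftrightarrow> touch (adj G) A B"
proof
  have uv: "u \<noteq> v" using graph_adj(3)[OF G] .
  note a = adj_contract_edge[OF G(1) uv]
  show "touch (adj G) A B" if t: "touch (adj (contract_edge G u v)) (A - {v}) (B - {v})"
  proof -
    obtain x y where xy: "x \<in> A" "y \<in> B" "adj (contract_edge G u v) x y" using t by (auto simp: touch_def)
    then consider "adj G x y" | "x = u" "adj G v y" | "y = u" "adj G x v" using a adj_sym[of G] by auto
    then show ?thesis using xy AB unfolding touch_def by cases blast+
  qed
  show "touch (adj (contract_edge G u v)) (A - {v}) (B - {v})" if t: "touch (adj G) A B"
  proof -
    obtain x y where xy: "x \<in> A" "y \<in> B" "adj G x y" using t by (auto simp: touch_def)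
    have e: "adj (contract_edge G u v) (if x = v then u else x) (if y = v then u else y)"
      using xy AB uv unfolding a by (auto simp: adj_sym[of G x v])
    have "(if x = v then u else x) \<in> A - {v}" "(if y = v then u else y) \<in> B - {v}"
      using xy AB uv by auto
    with e show ?thesis unfolding touch_def by blast
  qed
qed

text \<open>The number of vertices decreases: a vertex in no branch set is deleted, and an edge
  within a branch set is contracted. When neither is possible, the branch sets are singletons that
  cover the graph, and the model is an isomorphism.\<close>

lemma minor_model_induced_minor:
  assumes "graph H" "graph G" "minor_model H \<beta> (adj G) (fst G)"
  shows "induced_minor H G"
  using assms(2,3)
proof (induction "card (fst G)" arbitrary: G \<beta> rule: less_induct)
  case less
  note m = less.prems(2)[unfolded minor_model_def]
  have fin: "finite (fst G)" using less.prems(1) by (simp add: graph_def)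
  have step: ?case if s: "minor_step G G'" "graph G'" "card (fst G') < card (fst G)" "minor_model H \<beta>' (adj G') (fst G')" for G' \<beta>'
  proof -
    have "induced_minor H G'" using less.hyps[OF s(3,2,4)] .
    then show ?thesis using s(1) unfolding induced_minor_def by (meson converse_rtranclp_into_rtranclp)
  qed
  have smaller: "card (fst G - {v}) < card (fst G)" if "v \<in> fst G" for v
    using fin that by (rule card_Diff1_less)
  show ?case
  proof (cases "\<exists>v\<in>fst G. \<forall>i\<in>fst H. v \<notin> \<beta> i")
    case True
    then obtain v where v: "v \<in> fst G" "\<forall>i\<in>fst H. v \<notin> \<beta> i" by blast
    have "minor_model H \<beta> (adj (delete_vertex G v)) (fst (delete_vertex G v))"
      unfolding minor_model_def
    proof (intro conjI ballI impI)
      fix i assume i: "i \<in> fst H"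
      show "\<beta> i \<noteq> {}" using m i by blast
      show "\<beta> i \<subseteq> fst (delete_vertex G v)" using m i v(2) by (auto simp: delete_vertex_def)
      have "con (adj G) (\<beta> i)" using m i by blast
      then show "con (adj (delete_vertex G v)) (\<beta> i)"
        by (rule con_cong) (use v(2) i in \<open>auto simp: adj_delete_vertex\<close>)
      fix j assume j: "j \<in> fst H" "i \<noteq> j"
      show "\<beta> i \<inter> \<beta> j = {}" using m i j by blast
      have "touch (adj (delete_vertex G v)) (\<beta> i) (\<beta> j) \<longleftrightarrow> touch (adj G) (\<beta> i) (\<beta> j)"
        unfolding touch_def adj_delete_vertex using v(2) i j by blast
      then show "adj H i j \<longleftrightarrow> touch (adj (delete_vertex G v)) (\<beta> i) (\<beta> j)" using m i j by blast
    qed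
    then show ?thesis
      using step[OF minor_step.del[OF v(1)] graph_delete_vertex[OF less.prems(1)]] smaller[OF v(1)]
      by (simp add: delete_vertex_def)
  next
    case cover: False
    show ?thesis
    proof (cases "\<exists>i\<in>fst H. \<exists>u\<in>\<beta> i. \<beta> i \<noteq> {u}")
      case True
      then obtain k u where k: "k \<in> fst H" "u \<in> \<beta> k" "\<beta> k \<noteq> {u}" by blast
      then have "con (adj G) (\<beta> k)" using m by blast
      then obtain v where v: "v \<in> \<beta> k" "adj G u v" using conE[of "adj G" "\<beta> k" "{u}"] k by blast
      have uv: "u \<noteq> v" "v \<in> fst G" using graph_adj[OF less.prems(1) v(2)] by auto
      let ?G = "contract_edge G u v"
      have same: "u \<in> \<beta> i \<longleftrightarrow> v \<in> \<beta> i" if "i \<in> fst H" for i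
        using m that k v by (cases "i = k") blast+
      have "minor_model H (\<lambda>i. \<beta> i - {v}) (adj ?G) (fst ?G)"
        unfolding minor_model_def
      proof (intro conjI ballI impI)
        fix i assume i: "i \<in> fst H"
        have "\<beta> i \<noteq> {}" using m i by blast
        then show "\<beta> i - {v} \<noteq> {}" using same[OF i] uv by blast
        show "\<beta> i - {v} \<subseteq> fst ?G" using m i by (auto simp: contract_edge_def)
        show "con (adj ?G) (\<beta> i - {v})"
          by (rule con_contract_edge[OF less.prems(1) v(2)]) (use m i same in blast)+
        fix j assume j: "j \<in> fst H" "i \<noteq> j"
        then show "(\<beta> i - {v}) \<inter> (\<beta> j - {v}) = {}" using m i by blast
        have "\<beta> i \<inter> \<beta> j = {}" using m i j by blast
        from touch_contract_edge[OF less.prems(1) v(2) this same[OF i] same[OF j(1)]]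
        show "adj H i j \<longleftrightarrow> touch (adj ?G) (\<beta> i - {v}) (\<beta> j - {v})" using m i j by blast
      qed
      moreover have "minor_step G ?G" using v(2) uv by (intro minor_step.con) (auto simp: adj_def)
      ultimately show ?thesis
        using step[OF _ graph_contract_edge[OF less.prems(1) v(2)]] smaller[OF uv(2)]
        by (simp add: contract_edge_def)
    next
      case single: False
      define f where "f i = (SOME u. u \<in> \<beta> i)" for i
      have f: "\<beta> i = {f i}" if "i \<in> fst H" for i
      proof -
        have "\<beta> i \<noteq> {}" using m that by blast
        then have "f i \<in> \<beta> i" unfolding f_def by (simp add: some_in_eq)
        then show ?thesis using single that by blast
      qed
      have inj: "inj_on f (fst H)"
      proof (rule inj_onI, rule ccontr)
        fix i j assume ij: "i \<in> fst H" "j \<in> fst H" "f i = f j" "i \<noteq> j"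
        then have "\<beta> i \<inter> \<beta> j = {}" using m by blast
        then show False using f ij by simp
      qed
      have "f ` fst H = fst G"
      proof
        show "f ` fst H \<subseteq> fst G" using m f by blast
        show "fst G \<subseteq> f ` fst H" using cover f by blast
      qed
      then have "bij_betw f (fst H) (fst G)" using inj by (simp add: bij_betw_def)
      moreover have "{x, y} \<in> snd H \<longleftrightarrow> {f x, f y} \<in> snd G" if "x \<in> fst H" "y \<in> fst H" for x y
      proof (cases "x = y")
        case True
        then show ?thesis
          using not_adj_self[OF assms(1), of x] not_adj_self[OF less.prems(1), of "f x"] by (simp add: adj_def)
      next
        case False
        then have "adj H x y \<longleftrightarrow> touch (adj G) (\<beta> x) (\<beta> y)" using m that by blast
        then show ?thesis using f[OF that(1)] f[OF that(2)] by (simp add: touch_def adj_def)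
      qed
      ultimately have "graph_iso H G" unfolding graph_iso_def by blast
      then show ?thesis unfolding induced_minor_def by blast
    qed
  qed
qed

section \<open>1-perfect orientations of induced minors\<close>

lemma one_perfect_orientation_iff:
  assumes "graph G"
  shows "one_perfect_orientation G D \<longleftrightarrow> (\<forall>u v. (u, v) \<in> D \<longrightarrow> adj G u v) \<and>
    (\<forall>u v. adj G u v \<longrightarrow> (u, v) \<in> D \<or> (v, u) \<in> D) \<and> (\<forall>u v. (u, v) \<in> D \<longrightarrow> (v, u) \<notin> D) \<and>
    (\<forall>v x y. (v, x) \<in> D \<longrightarrow> (v, y) \<in> D \<longrightarrow> x \<noteq> y \<longrightarrow> adj G x y)"
proof -
  have "v \<in> fst G" if "adj G v x" for v x using graph_adj(1)[OF assms that] .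
  then show ?thesis
    unfolding one_perfect_orientation_def orientation_def adj_def[symmetric] by blast
qed

lemmas one_perfect_orientationD =
  one_perfect_orientation_iff[THEN iffD1, THEN conjunct1, rule_format]
  one_perfect_orientation_iff[THEN iffD1, THEN conjunct2, THEN conjunct1, rule_format]
  one_perfect_orientation_iff[THEN iffD1, THEN conjunct2, THEN conjunct2, THEN conjunct1, rule_format]
  one_perfect_orientation_iff[THEN iffD1, THEN conjunct2, THEN conjunct2, THEN conjunct2, rule_format]

lemma one_perfectly_orientableI:
  assumes "graph G" "\<And>u v. (u, v) \<in> D \<Longrightarrow> adj G u v" "\<And>u v. adj G u v \<Longrightarrow> (u, v) \<in> D \<or> (v, u) \<in> D"
    "\<And>u v. (u, v) \<in> D \<Longrightarrow> (v, u) \<notin> D" "\<And>v x y. (v, x) \<in> D \<Longrightarrow> (v, y) \<in> D \<Longrightarrow> x \<noteq> y \<Longrightarrow> adj G x y"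
  shows "one_perfectly_orientable G"
proof -
  have "one_perfect_orientation G D"
    unfolding one_perfect_orientation_iff[OF assms(1)]
    by (intro conjI allI impI) (fact assms(2-5))+
  then show ?thesis unfolding one_perfectly_orientable_def by blast
qed

lemma one_perfectly_orientable_delete:
  assumes "graph G" "one_perfectly_orientable G"
  shows "one_perfectly_orientable (delete_vertex G v)"
proof -
  obtain D where D: "one_perfect_orientation G D" using assms(2) by (auto simp: one_perfectly_orientable_def)
  note D = one_perfect_orientationD[OF assms(1) D]
  show ?thesis
    by (rule one_perfectly_orientableI[OF graph_delete_vertex[OF assms(1)], of "{(a, b)\<in>D. a \<noteq> v \<and> b \<noteq> v}"])
      (use D in \<open>auto simp: adj_delete_vertex\<close>)
qed

text \<open>If \<open>uv\<close> is oriented from \<open>t\<close> to \<open>s\<close>, the contracted vertex keeps exactly the out-neighbours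
  of \<open>s\<close>; all other edges at the contracted vertex point to it.\<close>

lemma one_perfectly_orientable_contract:
  assumes G: "graph G" "one_perfectly_orientable G" and uv: "adj G u v"
  shows "one_perfectly_orientable (contract_edge G u v)"
proof -
  obtain D where D0: "one_perfect_orientation G D" using G(2) by (auto simp: one_perfectly_orientable_def)
  note D = one_perfect_orientationD[OF G(1) D0]
  have ne: "u \<noteq> v" using graph_adj(3)[OF G(1) uv] .
  have "(u, v) \<in> D \<or> (v, u) \<in> D" using D(2) uv by blast
  then obtain s t where st: "(t, s) \<in> D" "{s, t} = {u, v}" by blast
  then have ts: "adj G t s" "t \<noteq> s" "(s, t) \<notin> D" using D(1,3) graph_adj(3)[OF G(1)] by blast+
  define N where "N x \<longleftrightarrow> (adj G x s \<or> adj G x t) \<and> x \<notin> {s, t}" for x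
  have N: "N x \<longleftrightarrow> (adj G x u \<or> adj G x v) \<and> x \<notin> {u, v}" for x
    using st(2) unfolding N_def by (auto simp: doubleton_eq_iff)
  define D' where "D' = {(a, b). a \<noteq> v \<and> b \<noteq> v \<and>
    (if a = u then b \<noteq> u \<and> (s, b) \<in> D else if b = u then N a \<and> (s, a) \<notin> D else (a, b) \<in> D)}"
  have D': "(a, b) \<in> D' \<longleftrightarrow> a \<noteq> v \<and> b \<noteq> v \<and>
    (if a = u then b \<noteq> u \<and> (s, b) \<in> D else if b = u then N a \<and> (s, a) \<notin> D else (a, b) \<in> D)" for a b
    by (simp add: D'_def)
  have a': "adj (contract_edge G u v) a b \<longleftrightarrow> a \<noteq> v \<and> b \<noteq> v \<and>
    (if a = u then N b else if b = u then N a else adj G a b)" for a b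
    unfolding adj_contract_edge[OF G(1) ne] N
    using not_adj_self[OF G(1)] adj_sym[of G] by auto
  have out: "(s, b) \<in> D \<Longrightarrow> b \<noteq> u \<Longrightarrow> b \<noteq> v \<Longrightarrow> N b" for b
    using D(1)[of s b] adj_sym[of G s b] D(3)[OF st(1)] st(2) unfolding N_def by (cases "b = t") auto
  \<comment> \<open>Needed when \<open>w\<close> points both to the contracted vertex and to
    \<open>y\<close>. It suffices that \<open>w\<close> already pointed to \<open>s\<close> or
    \<open>t\<close>. If \<open>w\<close> is adjacent to \<open>t\<close> only, the reverse edge
    from \<open>t\<close> to \<open>w\<close>, next to the one from \<open>t\<close> to
    \<open>s\<close>, would make \<open>w\<close> adjacent to \<open>s\<close>.\<close>
  have near: "N y" if w: "N w" "(s, w) \<notin> D" "(w, y) \<in> D" "y \<noteq> u" "y \<noteq> v" for w y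
  proof -
    have y: "y \<noteq> s" "y \<noteq> t" using w st(2) by blast+
    have "(w, s) \<in> D \<or> (w, t) \<in> D"
    proof (cases "adj G w s")
      case True then show ?thesis using D(2) w(2) by blast
    next
      case False
      then have wt: "adj G w t" "w \<noteq> s" using w(1) unfolding N_def by blast+
      show ?thesis
      proof (rule ccontr)
        assume "\<not> ?thesis"
        then have "(t, w) \<in> D" using D(2) wt(1) by blast
        then have "adj G w s" using D(4) st(1) wt(2) by blast
        with False show False ..
      qed
    qed
    then have "adj G y s \<or> adj G y t" using D(4) w(3) y by blast
    then show ?thesis using y unfolding N_def by blast
  qed
  show ?thesis
  proof (rule one_perfectly_orientableI[OF graph_contract_edge[OF G(1) uv]])
    fix a b assume "(a, b) \<in> D'"
    then show "adj (contract_edge G u v) a b" using out[of b] D(1)[of a b] unfolding D' a' by (auto split: if_splits)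
  next
    fix a b assume ab: "adj (contract_edge G u v) a b"
    have "a \<noteq> b" using graph_adj(3)[OF graph_contract_edge[OF G(1) uv] ab] .
    then show "(a, b) \<in> D' \<or> (b, a) \<in> D'" using ab D(2)[of a b] unfolding D' a' by (auto split: if_splits)
  next
    fix a b assume "(a, b) \<in> D'"
    then show "(b, a) \<notin> D'" using D(3)[of a b] unfolding D' by (auto split: if_splits)
  next
    fix w x y assume wxy: "(w, x) \<in> D'" "(w, y) \<in> D'" "x \<noteq> y"
    show "adj (contract_edge G u v) x y"
    proof (cases "w = u")
      case True then show ?thesis using wxy D(4)[of s x y] unfolding D' a' by auto
    next
      case False
      consider "x = u" "y \<noteq> u" | "y = u" "x \<noteq> u" | "x \<noteq> u" "y \<noteq> u" using wxy(3) by blast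
      then show ?thesis
      proof cases
        case 1
        then show ?thesis using wxy False near[of w y] unfolding D' a' by auto
      next
        case 2
        then show ?thesis using wxy False near[of w x] unfolding D' a' by auto
      next
        case 3
        then show ?thesis using wxy False D(4)[of w x y] unfolding D' a' by auto
      qed
    qed
  qed
qed

lemma one_perfectly_orientable_iso:
  assumes "graph H" "graph G" "graph_iso H G" "one_perfectly_orientable G"
  shows "one_perfectly_orientable H"
proof -
  obtain D where D0: "one_perfect_orientation G D" using assms(4) by (auto simp: one_perfectly_orientable_def)
  note D = one_perfect_orientationD[OF assms(2) D0]
  obtain f where f: "inj_on f (fst H)" "\<forall>x\<in>fst H. \<forall>y\<in>fst H. adj H x y \<longleftrightarrow> adj G (f x) (f y)"
    using assms(3) unfolding graph_iso_def adj_def bij_betw_def by blast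
  note V = graph_adj(1,2)[OF assms(1)]
  let ?D = "{(x, y). x \<in> fst H \<and> y \<in> fst H \<and> (f x, f y) \<in> D}"
  show ?thesis
  proof (rule one_perfectly_orientableI[OF assms(1), of ?D])
    fix u v assume "(u, v) \<in> ?D"
    then show "adj H u v" "(v, u) \<notin> ?D" using D(1)[of "f u" "f v"] D(3)[of "f u" "f v"] f(2) by auto
  next
    fix u v assume uv: "adj H u v"
    then show "(u, v) \<in> ?D \<or> (v, u) \<in> ?D" using D(2)[of "f u" "f v"] f(2) V[OF uv] by auto
  next
    fix w x y assume "(w, x) \<in> ?D" "(w, y) \<in> ?D" "x \<noteq> y"
    then have "x \<in> fst H" "y \<in> fst H" "(f w, f x) \<in> D" "(f w, f y) \<in> D" "f x \<noteq> f y"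
      using f(1) by (auto dest: inj_onD)
    then show "adj H x y" using D(4)[of "f w" "f x" "f y"] f(2) by blast
  qed
qed

lemma one_perfectly_orientable_induced_minor:
  assumes "graph G" "one_perfectly_orientable G" "graph H" "induced_minor H G"
  shows "one_perfectly_orientable H"
proof -
  obtain G' where G': "minor_step\<^sup>*\<^sup>* G G'" "graph_iso H G'" using assms(4) by (auto simp: induced_minor_def)
  from G'(1) have "graph G' \<and> one_perfectly_orientable G'"
  proof (induction rule: rtranclp_induct)
    case base then show ?case using assms by simp
  next
    case (step y z)
    from step(2) show ?case
    proof cases
      case (del v)
      then show ?thesis using step(3) graph_delete_vertex[of y v] one_perfectly_orientable_delete[of y v] by simp
    next
      case (con u v)
      then have "adj y u v" by (simp add: adj_def)
      then show ?thesis
        using con(1) step(3) graph_contract_edge[of y u v] one_perfectly_orientable_contract[of y u v] by simp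
    qed
  qed
  then show ?thesis using one_perfectly_orientable_iso[OF assms(3) _ G'(2)] by blast
qed

text \<open>In a triangle-free graph, a 1-perfect orientation has out-degree at most one.\<close>

lemma bipartite_one_perfectly_orientable_card:
  assumes "graph G" "one_perfectly_orientable G" and A: "\<And>x y. adj G x y \<Longrightarrow> x \<in> A \<longleftrightarrow> y \<notin> A"
  shows "card (snd G) \<le> card (fst G)"
proof -
  obtain D where D0: "one_perfect_orientation G D" using assms(2) by (auto simp: one_perfectly_orientable_def)
  note D = one_perfect_orientationD[OF assms(1) D0]
  have inj: "inj_on fst D"
  proof (rule inj_onI)
    fix e e' assume e: "e \<in> D" "e' \<in> D" "fst e = fst e'"
    obtain v x y where vxy: "e = (v, x)" "e' = (v, y)" using e(3) by (cases e; cases e') auto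
    have "x = y"
    proof (rule ccontr)
      assume "x \<noteq> y"
      then have "adj G v x" "adj G v y" "adj G x y" using D(1,4) e vxy by blast+
      then show False using A by blast
    qed
    then show "e = e'" using vxy by simp
  qed
  have img: "fst ` D \<subseteq> fst G" using D(1) graph_adj(1)[OF assms(1)] by force
  have finV: "finite (fst G)" using assms(1) by (simp add: graph_def)
  have finD: "finite D" using finite_imageD[OF finite_subset[OF img finV] inj] .
  have "snd G \<subseteq> (\<lambda>(a, b). {a, b}) ` D"
  proof
    fix e assume "e \<in> snd G"
    then obtain a b where ab: "e = {a, b}" "adj G a b" using graph_edge_doubleton[OF assms(1)] by metis
    then have "(a, b) \<in> D \<or> (b, a) \<in> D" using D(2) by blast
    then show "e \<in> (\<lambda>(a, b). {a, b}) ` D" using ab(1) by (force simp: insert_commute)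
  qed
  then have "card (snd G) \<le> card D" using finD by (meson card_image_le card_mono finite_imageI le_trans)
  also have "\<dots> = card (fst ` D)" using inj by (simp add: card_image)
  also have "\<dots> \<le> card (fst G)" using img finV by (rule card_mono[rotated])
  finally show ?thesis .
qed

lemma K23_edges: "snd K23 = {{0,2},{0,3},{0,4},{1,2},{1,3},{1,4}}"
  unfolding K23_def by auto

lemma graph_K23: "graph K23" and graph_F1: "graph F1" and graph_F2: "graph F2"
proof -
  have "fst K23 = {0,1,2,3,4}" by (simp add: K23_def)
  then show "graph K23" unfolding graph_iff_card K23_edges by simp
  show "graph F1" "graph F2" unfolding graph_iff_card F1_def F2_def by simp_all
qed

text \<open>All three graphs are bipartite and have one edge more than vertices: 6 against 5, 7
  against 6 and 8 against 7. The sets written out in the proof are colour classes.\<close>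

lemma not_one_perfectly_orientable:
  "\<not> one_perfectly_orientable K23" "\<not> one_perfectly_orientable F1" "\<not> one_perfectly_orientable F2"
proof -
  have "x \<in> {0, 1} \<longleftrightarrow> y \<notin> {0, 1}" if "adj K23 x y" for x y
    using that unfolding adj_def K23_edges by (auto simp: doubleton_eq_iff)
  then have "one_perfectly_orientable K23 \<Longrightarrow> card (snd K23) \<le> card (fst K23)"
    using bipartite_one_perfectly_orientable_card[OF graph_K23] by blast
  moreover have "card (snd K23) = 6" unfolding K23_edges by (simp add: doubleton_eq_iff)
  moreover have "card (fst K23) = 5" by (simp add: K23_def)
  ultimately show "\<not> one_perfectly_orientable K23" by auto
  have "x \<in> {0, 2, 4} \<longleftrightarrow> y \<notin> {0, 2, 4}" if "adj F1 x y" for x y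
    using that unfolding adj_def F1_def by (auto simp: doubleton_eq_iff)
  then have "one_perfectly_orientable F1 \<Longrightarrow> card (snd F1) \<le> card (fst F1)"
    using bipartite_one_perfectly_orientable_card[OF graph_F1] by blast
  moreover have "card (snd F1) = 7" "card (fst F1) = 6" by (simp_all add: F1_def doubleton_eq_iff)
  ultimately show "\<not> one_perfectly_orientable F1" by auto
  have "x \<in> {0, 2, 5} \<longleftrightarrow> y \<notin> {0, 2, 5}" if "adj F2 x y" for x y
    using that unfolding adj_def F2_def by (auto simp: doubleton_eq_iff)
  then have "one_perfectly_orientable F2 \<Longrightarrow> card (snd F2) \<le> card (fst F2)"
    using bipartite_one_perfectly_orientable_card[OF graph_F2] by blast
  moreover have "card (snd F2) = 8" "card (fst F2) = 7" by (simp_all add: F2_def doubleton_eq_iff)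
  ultimately show "\<not> one_perfectly_orientable F2" by auto
qed

section \<open>Constructible graphs\<close>

lemma symp_adj: "symp (adj G)"
  by (simp add: symp_def adj_sym)

lemma irreflp_adj: "graph G \<Longrightarrow> irreflp (adj G)"
  by (simp add: irreflp_def not_adj_self)

lemma cyc_cong:
  assumes "cyc E n c" "\<And>a b. a \<in> c ` {..<n} \<Longrightarrow> b \<in> c ` {..<n} \<Longrightarrow> E a b \<longleftrightarrow> F a b"
  shows "cyc F n c"
proof -
  have "E (c i) (c j) \<longleftrightarrow> F (c i) (c j)" if "i < n" "j < n" for i j
    using assms(2) that by blast
  then show ?thesis using assms(1) unfolding cyc_def by simp
qed

lemma cycle_graph_imp_cyc:
  assumes "cycle_graph G n"
  obtains c where "cyc (adj G) n c" "fst G = c ` {..<n}"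
proof -
  obtain xs where n: "3 \<le> n" and xs: "distinct xs" "length xs = n"
    "G = (set xs, {{xs ! i, xs ! (Suc i mod n)} | i. i < n})"
    using assms unfolding cycle_graph_def by blast
  have m: "Suc i mod n = (if Suc i = n then 0 else Suc i)" if "i < n" for i using that by auto
  have eq: "xs ! i = xs ! j \<longleftrightarrow> i = j" if "i < n" "j < n" for i j
    using nth_eq_iff_index_eq[OF xs(1)] xs(2) that by simp
  have "cyc (adj G) n ((!) xs)"
    unfolding cyc_def
  proof (intro conjI allI impI)
    show "3 \<le> n" by (rule n)
    show "inj_on ((!) xs) {..<n}" using eq by (auto simp: inj_on_def)
    fix i j assume ij: "i < n" "j < n"
    have "adj G (xs ! i) (xs ! j) \<longleftrightarrow> (\<exists>k<n. {xs ! i, xs ! j} = {xs ! k, xs ! (Suc k mod n)})"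
      unfolding adj_def xs(3) by auto
    also have "\<dots> \<longleftrightarrow> (\<exists>k<n. i = k \<and> j = Suc k mod n \<or> j = k \<and> i = Suc k mod n)"
    proof (rule ex_cong1, rule conj_cong[OF refl])
      fix k assume "k < n"
      then have "Suc k mod n < n" by simp
      then show "{xs ! i, xs ! j} = {xs ! k, xs ! (Suc k mod n)} \<longleftrightarrow>
        i = k \<and> j = Suc k mod n \<or> j = k \<and> i = Suc k mod n"
        using \<open>k < n\<close> ij eq unfolding doubleton_eq_iff by blast
    qed
    also have "\<dots> \<longleftrightarrow> j = Suc i mod n \<or> i = Suc j mod n" using ij by blast
    also have "\<dots> \<longleftrightarrow> Suc i = j \<or> Suc j = i \<or> i = 0 \<and> Suc j = n \<or> j = 0 \<and> Suc i = n"
      using m[OF ij(1)] m[OF ij(2)] ij by auto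
    finally show "adj G (xs ! i) (xs ! j) \<longleftrightarrow>
      Suc i = j \<or> Suc j = i \<or> i = 0 \<and> Suc j = n \<or> j = 0 \<and> Suc i = n" .
  qed
  moreover have "fst G = (!) xs ` {..<n}"
    using xs by (auto simp: set_conv_nth)
  ultimately show ?thesis using that by blast
qed

lemma cycle_graph_graph:
  assumes "cycle_graph G n" shows "graph G"
proof -
  obtain xs where n: "3 \<le> n" and xs: "distinct xs" "length xs = n"
    "G = (set xs, {{xs ! i, xs ! (Suc i mod n)} | i. i < n})"
    using assms unfolding cycle_graph_def by blast
  have "xs ! i \<noteq> xs ! (Suc i mod n) \<and> xs ! i \<in> set xs \<and> xs ! (Suc i mod n) \<in> set xs" if "i < n" for i
  proof -
    have "Suc i mod n < n" "i \<noteq> Suc i mod n" using that n by (auto simp: mod_Suc)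
    then show ?thesis using nth_eq_iff_index_eq[OF xs(1)] xs(2) that by simp
  qed
  then show ?thesis unfolding graph_def xs(3) by auto
qed

lemma cyc_imp_cycle_graph:
  assumes G: "graph G" and c: "cyc (adj G) n c" "fst G = c ` {..<n}"
  shows "cycle_graph G n"
proof -
  let ?xs = "map c [0..<n]"
  have n: "3 \<le> n" using cycD(1)[OF c(1)] .
  have m: "Suc i mod n = (if Suc i = n then 0 else Suc i)" if "i < n" for i using that by auto
  have E: "snd G = {{?xs ! i, ?xs ! (Suc i mod n)} | i. i < n}"
  proof
    show "snd G \<subseteq> {{?xs ! i, ?xs ! (Suc i mod n)} | i. i < n}"
    proof
      fix e assume "e \<in> snd G"
      then obtain a b where ab: "e = {a, b}" "adj G a b" "a \<in> fst G" "b \<in> fst G"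
        using graph_edge_doubleton[OF G] by metis
      then obtain i j where ij: "i < n" "j < n" "a = c i" "b = c j" using c(2) by auto
      have "j = Suc i mod n \<or> i = Suc j mod n"
        using cycD(3)[OF c(1) ij(1,2)] ab(2) ij m by auto
      then show "e \<in> {{?xs ! i, ?xs ! (Suc i mod n)} | i. i < n}"
      proof
        assume "j = Suc i mod n"
        then show ?thesis using ij ab(1) by (intro CollectI exI[of _ i]) simp
      next
        assume "i = Suc j mod n"
        then show ?thesis using ij ab(1) by (intro CollectI exI[of _ j]) (simp add: insert_commute)
      qed
    qed
    show "{{?xs ! i, ?xs ! (Suc i mod n)} | i. i < n} \<subseteq> snd G"
    proof
      fix e assume "e \<in> {{?xs ! i, ?xs ! (Suc i mod n)} | i. i < n}"
      then obtain i where i: "i < n" "e = {?xs ! i, ?xs ! (Suc i mod n)}" by blast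
      have "Suc i mod n < n" using i by simp
      then have "e = {c i, c (Suc i mod n)}" "adj G (c i) (c (Suc i mod n))"
        using i cycD(3)[OF c(1) i(1), of "Suc i mod n"] m[OF i(1)] by auto
      then show "e \<in> snd G" by (simp add: adj_def)
    qed
  qed
  have "distinct ?xs" using cycD(2)[OF c(1)] by (simp add: distinct_map lessThan_atLeast0)
  moreover have "fst G = set ?xs" using c(2) by (simp add: lessThan_atLeast0)
  ultimately show ?thesis
    unfolding cycle_graph_def using n E by (intro conjI exI[of _ ?xs]) (simp_all add: prod_eq_iff)
qed

lemma adj_induced_subgraph: "adj (induced_subgraph G S) a b \<longleftrightarrow> adj G a b \<and> a \<in> S \<and> b \<in> S"
  by (auto simp: adj_def induced_subgraph_def)

lemma graph_induced_subgraph: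
  assumes "graph G" "S \<subseteq> fst G" shows "graph (induced_subgraph G S)"
  using assms finite_subset[of S "fst G"] unfolding graph_iff_card induced_subgraph_def by auto

lemma cycle_graph_induced_iff:
  assumes "graph G" "S \<subseteq> fst G"
  shows "cycle_graph (induced_subgraph G S) n \<longleftrightarrow> (\<exists>c. cyc (adj G) n c \<and> c ` {..<n} = S)"
proof
  assume "cycle_graph (induced_subgraph G S) n"
  then obtain c where c: "cyc (adj (induced_subgraph G S)) n c" "fst (induced_subgraph G S) = c ` {..<n}"
    using cycle_graph_imp_cyc by metis
  have S: "c ` {..<n} = S" using c(2) by (simp add: induced_subgraph_def)
  have "cyc (adj G) n c" by (rule cyc_cong[OF c(1)]) (simp add: adj_induced_subgraph S)
  with S show "\<exists>c. cyc (adj G) n c \<and> c ` {..<n} = S" by blast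
next
  assume "\<exists>c. cyc (adj G) n c \<and> c ` {..<n} = S"
  then obtain c where c: "cyc (adj G) n c" "c ` {..<n} = S" by blast
  have "cyc (adj (induced_subgraph G S)) n c"
    by (rule cyc_cong[OF c(1)]) (simp add: adj_induced_subgraph c(2))
  moreover have "fst (induced_subgraph G S) = c ` {..<n}" using c(2) by (simp add: induced_subgraph_def)
  ultimately show "cycle_graph (induced_subgraph G S) n"
    by (rule cyc_imp_cycle_graph[OF graph_induced_subgraph[OF assms]])
qed

section \<open>Orienting constructible graphs\<close>

lemma adj_add_vertex:
  "adj (add_vertex G x N) a b \<longleftrightarrow> adj G a b \<or> a = x \<and> b \<in> N \<or> b = x \<and> a \<in> N"
  by (auto simp: adj_def add_vertex_def doubleton_eq_iff)

lemma graph_add_vertex: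
  assumes "graph G" "x \<notin> fst G" "N \<subseteq> fst G"
  shows "graph (add_vertex G x N)"
  unfolding graph_def
proof (intro conjI ballI)
  show "finite (fst (add_vertex G x N))" using assms(1) by (simp add: graph_def add_vertex_def)
  fix e assume "e \<in> snd (add_vertex G x N)"
  then consider "e \<in> snd G" | w where "w \<in> N" "e = {x, w}" by (auto simp: add_vertex_def)
  then show "\<exists>u v. u \<noteq> v \<and> u \<in> fst (add_vertex G x N) \<and> v \<in> fst (add_vertex G x N) \<and> e = {u, v}"
  proof cases
    case 1
    obtain a b where "e = {a, b}" "a \<in> fst G" "b \<in> fst G" "a \<noteq> b"
      using graph_edge_doubleton[OF assms(1) 1] by metis
    then show ?thesis by (intro exI[of _ a] exI[of _ b]) (simp add: add_vertex_def)
  next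
    case 2
    then show ?thesis using assms(2,3) by (intro exI[of _ x] exI[of _ w]) (auto simp: add_vertex_def)
  qed
qed

text \<open>All new edges are directed away from \<open>x\<close>. Its out-neighbourhood is the
  clique \<open>N\<close>, and those of the old vertices do not change.\<close>

lemma one_perfectly_orientable_add_vertex:
  assumes G: "graph G" "one_perfectly_orientable G" and x: "x \<notin> fst G" and N: "N \<subseteq> fst G" "clique (adj G) N"
  shows "one_perfectly_orientable (add_vertex G x N)"
proof -
  obtain D where D0: "one_perfect_orientation G D" using G(2) by (auto simp: one_perfectly_orientable_def)
  note D = one_perfect_orientationD[OF G(1) D0]
  have V: "u \<in> fst G" "v \<in> fst G" if "(u, v) \<in> D" for u v
    using graph_adj[OF G(1) D(1)[OF that]] by auto
  show ?thesis
  proof (rule one_perfectly_orientableI[OF graph_add_vertex[OF G(1) x N(1)], of "D \<union> {x} \<times> N"])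
    fix u v assume uv: "(u, v) \<in> D \<union> {x} \<times> N"
    then show "adj (add_vertex G x N) u v" using D(1) by (auto simp: adj_add_vertex)
    show "(v, u) \<notin> D \<union> {x} \<times> N" using uv D(3)[of u v] V[of u v] V[of v u] x N(1) by auto
  next
    fix u v assume "adj (add_vertex G x N) u v"
    then show "(u, v) \<in> D \<union> {x} \<times> N \<or> (v, u) \<in> D \<union> {x} \<times> N"
      using D(2)[of u v] by (auto simp: adj_add_vertex)
  next
    fix w a b assume w: "(w, a) \<in> D \<union> {x} \<times> N" "(w, b) \<in> D \<union> {x} \<times> N" "a \<noteq> b"
    have "adj G a b"
    proof (cases "w = x")
      case True
      then have "a \<in> N" "b \<in> N" using w V[of x] x by auto
      then show ?thesis using N(2) w(3) by (simp add: clique_def)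
    next
      case False
      then show ?thesis using w D(4)[of w a b] by auto
    qed
    then show "adj (add_vertex G x N) a b" by (simp add: adj_add_vertex)
  qed
qed

text \<open>The cyclic orientation has out-degree one everywhere.\<close>

lemma one_perfectly_orientable_cycle:
  assumes "cycle_graph G n" shows "one_perfectly_orientable G"
proof -
  obtain c where c: "cyc (adj G) n c" "fst G = c ` {..<n}" using cycle_graph_imp_cyc[OF assms] .
  note G = cycle_graph_graph[OF assms]
  have n: "3 \<le> n" using cycD(1)[OF c(1)] .
  define s where "s i = (if Suc i = n then 0 else Suc i)" for i
  have s: "s i < n" if "i < n" for i using that n by (simp add: s_def)
  note eq = cyc_inj[OF c(1)]
  have a: "adj G (c i) (c j) \<longleftrightarrow> j = s i \<or> i = s j" if "i < n" "j < n" for i j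
    using cycD(3)[OF c(1) that] that by (auto simp: s_def)
  let ?D = "{(c i, c (s i)) | i. i < n}"
  show ?thesis
  proof (rule one_perfectly_orientableI[OF G, of ?D])
    fix u v assume "(u, v) \<in> ?D"
    then obtain i where i: "i < n" "u = c i" "v = c (s i)" by blast
    then show "adj G u v" using a[of i "s i"] s by simp
    show "(v, u) \<notin> ?D"
    proof
      assume "(v, u) \<in> ?D"
      then obtain j where "j < n" "v = c j" "u = c (s j)" by blast
      then have "j = s i" "i = s j" using i eq[of j "s i"] eq[of i "s j"] s by auto
      then show False using n i by (auto simp: s_def split: if_splits)
    qed
  next
    fix u v assume uv: "adj G u v"
    then obtain i j where "i < n" "j < n" "u = c i" "v = c j"
      using graph_adj(1,2)[OF G uv] c(2) by auto
    then show "(u, v) \<in> ?D \<or> (v, u) \<in> ?D" using a[of i j] uv by blast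
  next
    fix w x y assume "(w, x) \<in> ?D" "(w, y) \<in> ?D" "x \<noteq> y"
    then show "adj G x y" using eq by blast
  qed
qed

lemma constructible_one_perfectly_orientable:
  "constructible G \<Longrightarrow> graph G \<and> one_perfectly_orientable G"
proof (induction rule: constructible.induct)
  case (K1 v)
  have "graph ({v}, {})" by (simp add: graph_def)
  moreover have "one_perfectly_orientable ({v}, {})"
    by (rule one_perfectly_orientableI[OF calculation, of "{}"]) (simp_all add: adj_def)
  ultimately show ?case ..
next
  case (cycle G n)
  then show ?case using cycle_graph_graph one_perfectly_orientable_cycle by blast
next
  case (A1 G x v)
  then show ?case
    using graph_add_vertex[of G x "{v}"] one_perfectly_orientable_add_vertex[of G x "{v}"] by (simp add: clique_def)
next
  case (A2' G x v w)
  then have "adj G v w" by (simp add: adj_def)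
  then have "{v, w} \<subseteq> fst G" "clique (adj G) {v, w}"
    using A2' graph_adj[of G v w] by (auto simp: clique_def adj_sym)
  then show ?case
    using A2' graph_add_vertex[of G x "{v, w}"] one_perfectly_orientable_add_vertex[of G x "{v, w}"] by simp
qed

section \<open>Building a graph with at most one hole\<close>

lemma theta_free_mono:
  assumes "theta_free E V" "S \<subseteq> V" shows "theta_free E S"
  unfolding theta_free_def
proof (intro ballI allI impI)
  fix p q A B C
  assume pq: "p \<in> S" "q \<in> S" "p \<noteq> q" and sub: "A \<subseteq> S - {p, q}" "B \<subseteq> S - {p, q}" "C \<subseteq> S - {p, q}"
    and rest: "A \<inter> B = {}" "A \<inter> C = {}" "B \<inter> C = {}" "con E A" "con E B" "con E C"
      "\<exists>x\<in>A. E p x" "\<exists>x\<in>A. E q x" "\<exists>x\<in>B. E p x" "\<exists>x\<in>B. E q x" "\<exists>x\<in>C. E p x" "\<exists>x\<in>C. E q x"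
  have "p \<in> V" "q \<in> V" "A \<subseteq> V - {p, q}" "B \<subseteq> V - {p, q}" "C \<subseteq> V - {p, q}" using assms(2) pq sub by auto
  from theta_freeD[OF assms(1) this(1,2) pq(3) this(3-5) rest] show False .
qed

lemma K4_free_mono: "K4_free E V \<Longrightarrow> S \<subseteq> V \<Longrightarrow> K4_free E S"
  unfolding K4_free_def by (meson subsetD)

lemma unique_hole_mono:
  assumes "unique_hole E V" "S \<subseteq> V" shows "unique_hole E S"
  unfolding unique_hole_def
proof (intro allI impI)
  fix n c m d assume "4 \<le> n" "cyc E n c" "c ` {..<n} \<subseteq> S" "4 \<le> m" "cyc E m d" "d ` {..<m} \<subseteq> S"
  then show "c ` {..<n} = d ` {..<m}"
    using assms unfolding unique_hole_def by (meson subset_trans)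
qed

lemma induced_subgraph_add_vertex:
  assumes "graph G" "x \<in> S" "S \<subseteq> fst G" "N = {y\<in>S. adj G x y}"
  shows "induced_subgraph G S = add_vertex (induced_subgraph G (S - {x})) x N"
proof -
  have "{e \<in> snd G. e \<subseteq> S} = {e \<in> snd G. e \<subseteq> S - {x}} \<union> {{x, w} | w. w \<in> N}"
  proof (intro set_eqI iffI)
    fix e assume e: "e \<in> {e \<in> snd G. e \<subseteq> S}"
    then obtain a b where ab: "e = {a, b}" "adj G a b" using graph_edge_doubleton[OF assms(1)] by blast
    show "e \<in> {e \<in> snd G. e \<subseteq> S - {x}} \<union> {{x, w} | w. w \<in> N}"
    proof (cases "x \<in> e")
      case True
      then have "e = {x, if a = x then b else a}" "adj G x (if a = x then b else a)"
        using ab adj_sym[of G a b] by auto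
      moreover have "(if a = x then b else a) \<in> S" using e ab by auto
      ultimately show ?thesis unfolding assms(4) by blast
    next
      case False then show ?thesis using e by blast
    qed
  next
    fix e assume "e \<in> {e \<in> snd G. e \<subseteq> S - {x}} \<union> {{x, w} | w. w \<in> N}"
    then show "e \<in> {e \<in> snd G. e \<subseteq> S}" using assms(2) unfolding assms(4) adj_def by blast
  qed
  then show ?thesis using assms(2) unfolding induced_subgraph_def add_vertex_def by auto
qed

lemma induced_subgraph_induced:
  "Z \<subseteq> S \<Longrightarrow> induced_subgraph (induced_subgraph G S) Z = induced_subgraph G Z"
  unfolding induced_subgraph_def by auto

text \<open>Speaking of induced subgraphs of a fixed \<open>G\<close> keeps a single adjacency
  relation throughout the induction. The vertex from \<open>removable_vertex\<close> is put back
  last, by (A1) if it has one neighbour and by (A2') if it has two. Single vertices and spanning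
  holes are the base; triangles arise from an edge by (A2').\<close>

lemma unique_hole_constructible_induced:
  assumes G: "graph G" "theta_free (adj G) (fst G)" "K4_free (adj G) (fst G)"
    and S: "S \<subseteq> fst G" "S \<noteq> {}" "con (adj G) S" "unique_hole (adj G) S"
  shows "constructible (induced_subgraph G S)"
  using S
proof (induction "card S" arbitrary: S rule: less_induct)
  case less
  have finS: "finite S" using G(1) less.prems(1) finite_subset by (auto simp: graph_def)
  consider "card S = 1" | "2 \<le> card S" "\<exists>n c. 4 \<le> n \<and> cyc (adj G) n c \<and> c ` {..<n} = S"
    | "2 \<le> card S" "\<not> (\<exists>n c. 4 \<le> n \<and> cyc (adj G) n c \<and> c ` {..<n} = S)"
    using less.prems(2) finS by (metis One_nat_def Suc_1 Suc_leI card_gt_0_iff le_antisym not_less_eq_eq)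
  then show ?case
  proof cases
    case 1
    then obtain v where "S = {v}" using card_1_singletonE by blast
    moreover have "{e \<in> snd G. e \<subseteq> {v}} = {}"
      using graph_edge_doubleton[OF G(1)] by (metis (no_types, lifting) empty_Collect_eq insert_subset singletonD)
    ultimately have "induced_subgraph G S = ({v}, {})" by (simp only: induced_subgraph_def)
    then show ?thesis using constructible.K1[of v] by simp
  next
    case 2
    then show ?thesis using cycle_graph_induced_iff[OF G(1) less.prems(1)] constructible.cycle by metis
  next
    case 3
    have nh: "c ` {..<n} \<noteq> S" if "4 \<le> n" "cyc (adj G) n c" for n c using 3(2) that by blast
    obtain x where x: "x \<in> S" "clique (adj G) {y\<in>S. adj G x y}" "{y\<in>S. adj G x y} \<noteq> {}" "card {y\<in>S. adj G x y} \<le> 2"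
      using removable_vertex[OF finS symp_adj irreflp_adj[OF G(1)] less.prems(3) theta_free_mono[OF G(2) less.prems(1)]
          K4_free_mono[OF G(3) less.prems(1)] less.prems(4) 3(1) nh] by blast
    let ?N = "{y\<in>S. adj G x y}" and ?T = "S - {x}"
    have NT: "?N \<subseteq> ?T" using not_adj_self[OF G(1)] by auto
    have TV: "?T \<subseteq> fst G" using less.prems(1) by blast
    have cT: "constructible (induced_subgraph G ?T)"
    proof (rule less.hyps)
      show "card ?T < card S" using finS x(1) by (rule card_Diff1_less)
      show "con (adj G) ?T"
        by (rule con_remove_simplicial[OF less.prems(3) symp_adj]) (use x(2) in \<open>simp add: clique_def\<close>)
      show "unique_hole (adj G) ?T" by (rule unique_hole_mono[OF less.prems(4)]) blast
    qed (use TV NT x(3) in auto)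
    have fT: "fst (induced_subgraph G ?T) = ?T" by (simp add: induced_subgraph_def)
    note eq = induced_subgraph_add_vertex[OF G(1) x(1) less.prems(1) refl]
    have "card ?N \<noteq> 0" using x(3) finS by simp
    with x(4) consider "card ?N = 1" | "card ?N = 2" by linarith
    then show ?thesis
    proof cases
      case 1
      then obtain v where v: "?N = {v}" using card_1_singletonE by blast
      then have "constructible (add_vertex (induced_subgraph G ?T) x {v})"
        using NT by (intro constructible.A1[OF cT]) (auto simp: fT)
      then show ?thesis unfolding eq v .
    next
      case 2
      then obtain v w where vw: "?N = {v, w}" "v \<noteq> w" by (auto simp: card_2_iff)
      have "v \<in> ?N" "w \<in> ?N" using vw(1) by blast+
      then have a: "adj G v w" "v \<in> ?T" "w \<in> ?T" using x(2) vw(2) NT unfolding clique_def by blast+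
      let ?Z = "{Z. induced_cycle (induced_subgraph G ?T) Z \<and> v \<in> Z \<and> w \<in> Z}"
      have cyc: "Z \<subseteq> ?T \<and> (\<exists>n c. cyc (adj G) n c \<and> c ` {..<n} = Z)" if "Z \<in> ?Z" for Z
      proof -
        have Z: "Z \<subseteq> ?T" "\<exists>n. cycle_graph (induced_subgraph (induced_subgraph G ?T) Z) n"
          using that unfolding induced_cycle_def fT by blast+
        then show ?thesis
          unfolding induced_subgraph_induced[OF Z(1)] using cycle_graph_induced_iff[OF G(1), of Z] TV by blast
      qed
      have "Z = Z'" if ZZ: "Z \<in> ?Z" "Z' \<in> ?Z" for Z Z'
      proof -
        obtain n c where c: "cyc (adj G) n c" "c ` {..<n} = Z" using cyc[OF ZZ(1)] by blast
        obtain m d where d: "cyc (adj G) m d" "d ` {..<m} = Z'" using cyc[OF ZZ(2)] by blast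
        have "c ` {..<n} = d ` {..<m}"
          by (rule cycles_through_simplicial_edge[OF symp_adj theta_free_mono[OF G(2) less.prems(1)] x(1) vw a(1) c(1) _ _ _ d(1)])
            (use cyc[OF ZZ(1)] cyc[OF ZZ(2)] ZZ c(2) d(2) in auto)
        then show ?thesis using c d by simp
      qed
      \<comment> \<open>The cardinality of an infinite set is 0 by convention, so that case is
        harmless.\<close>
      then have "card ?Z \<le> 1" by (cases "finite ?Z") (auto simp: card_le_Suc0_iff_eq)
      moreover have "{v, w} \<in> snd (induced_subgraph G ?T)"
        using a adj_induced_subgraph[of G ?T v w] by (simp add: adj_def)
      ultimately have "constructible (add_vertex (induced_subgraph G ?T) x {v, w})"
        by (intro constructible.A2'[OF cT]) (auto simp: fT)
      then show ?thesis unfolding eq vw(1) .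
    qed
  qed
qed

section \<open>Blocks\<close>

lemma connected_graph_iff:
  assumes "graph G"
  shows "connected_graph G \<longleftrightarrow> fst G \<noteq> {} \<and> con (adj G) (fst G)"
proof -
  have "(\<lambda>a b. adj G a b \<and> b \<in> fst G) = adj G"
    using graph_adj(2)[OF assms] by blast
  then show ?thesis unfolding connected_graph_def con_iff_rtranclp by simp
qed

lemma con_delete_vertex_iff:
  assumes "graph G"
  shows "con (adj G) (fst G - {v}) \<longleftrightarrow> (\<forall>u\<in>fst G - {v}. \<forall>w\<in>fst G - {v}. (adj (delete_vertex G v))\<^sup>*\<^sup>* u w)"
proof -
  have "con (adj G) (fst G - {v}) \<longleftrightarrow> con (adj (delete_vertex G v)) (fst G - {v})"
    using con_cong[of "adj G" "fst G - {v}" "adj (delete_vertex G v)"]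
      con_cong[of "adj (delete_vertex G v)" "fst G - {v}" "adj G"] by (auto simp: adj_delete_vertex)
  moreover have "(\<lambda>a b. adj (delete_vertex G v) a b \<and> b \<in> fst G - {v}) = adj (delete_vertex G v)"
    using graph_adj(2)[OF assms] unfolding adj_delete_vertex by (intro ext) blast
  ultimately show ?thesis unfolding con_iff_rtranclp[of "adj (delete_vertex G v)"] by simp
qed

text \<open>Deleting a \<open>v\<close> outside the graph changes nothing, so the condition without
  cut vertices may range over all \<open>v\<close>.\<close>

lemma biconnected_iff:
  assumes "graph G"
  shows "biconnected G \<longleftrightarrow> fst G \<noteq> {} \<and> con (adj G) (fst G) \<and> (\<forall>v. con (adj G) (fst G - {v}))"
proof -
  have "(\<forall>v. \<not> cut_vertex G v) \<longleftrightarrow> (\<forall>v. con (adj G) (fst G - {v}))" if c: "con (adj G) (fst G)"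
  proof -
    have r: "(adj G)\<^sup>*\<^sup>* u w" if "u \<in> fst G" "w \<in> fst G" for u w
      using connected_graph_iff[OF assms] c that unfolding connected_graph_def by blast
    have "cut_vertex G v \<longleftrightarrow> v \<in> fst G \<and> \<not> con (adj G) (fst G - {v})" for v
      unfolding cut_vertex_def con_delete_vertex_iff[OF assms] using r by blast
    moreover have "v \<notin> fst G \<Longrightarrow> con (adj G) (fst G - {v})" for v using c by simp
    ultimately show ?thesis by blast
  qed
  then show ?thesis unfolding biconnected_def connected_graph_iff[OF assms] by blast
qed

lemma biconnected_cycle:
  assumes "graph G" "cyc (adj G) n c" "S = c ` {..<n}" "S \<subseteq> fst G"
  shows "biconnected (induced_subgraph G S)"
proof -
  have c': "cyc (adj (induced_subgraph G S)) n c"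
    by (rule cyc_cong[OF assms(2)]) (simp add: adj_induced_subgraph assms(3))
  have f: "fst (induced_subgraph G S) = c ` {..<n}" by (simp add: induced_subgraph_def assms(3))
  have "c ` {..<n} \<noteq> {}" using cycD(1)[OF assms(2)] by (auto simp: lessThan_empty_iff)
  then show ?thesis
    unfolding biconnected_iff[OF graph_induced_subgraph[OF assms(1,4)]] f
    using cyc_con[OF c' symp_adj] cyc_remove_clique_con(1)[OF c' symp_adj, of "{v}" for v]
    by (simp add: clique_def)
qed

text \<open>Among the biconnected subgraphs containing \<open>H\<close>, one with the largest number
  of vertices plus edges is taken; counting both makes it maximal as a subgraph.\<close>

lemma biconnected_subgraph_in_block:
  assumes "graph G" "subgraph H G" "biconnected H"
  obtains B where "block G B" "subgraph H B"
proof -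
  have fin: "finite (fst G)" "finite (snd G)" using assms(1) graph_finite_edges[OF assms(1)] by (simp_all add: graph_def)
  let ?P = "\<lambda>B. subgraph B G \<and> biconnected B \<and> subgraph H B"
  let ?f = "\<lambda>B::'a graph. card (fst B) + card (snd B)"
  have PH: "?P H" using assms unfolding subgraph_def by simp
  have "?f B \<le> ?f G" if "?P B" for B
    using that fin unfolding subgraph_def by (intro add_mono card_mono) auto
  then have bd: "\<forall>B. ?P B \<longrightarrow> ?f B < Suc (?f G)" using le_imp_less_Suc by blast
  obtain B where B: "?P B" "\<forall>B'. ?P B' \<longrightarrow> ?f B' \<le> ?f B"
    using ex_has_greatest_nat[of ?P H ?f, OF PH bd] by blast
  have "B' = B" if B': "subgraph B' G" "biconnected B'" "subgraph B B'" for B'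
  proof -
    have s: "fst B \<subseteq> fst B'" "snd B \<subseteq> snd B'" using B'(3) by (auto simp: subgraph_def)
    have fB: "finite (fst B')" "finite (snd B')"
      using B'(1) fin finite_subset unfolding subgraph_def by blast+
    have "subgraph H B'" using B(1) B'(3) unfolding subgraph_def by blast
    then have "?f B' \<le> ?f B" using B(2) B' by blast
    moreover have "card (fst B) \<le> card (fst B')" "card (snd B) \<le> card (snd B')"
      using s fB card_mono by blast+
    ultimately have "card (fst B') \<le> card (fst B)" "card (snd B') \<le> card (snd B)" by linarith+
    then show ?thesis using s fB card_seteq by (metis prod_eq_iff)
  qed
  then have "block G B" using B(1) unfolding block_def by blast
  then show ?thesis using that B(1) by blast
qed

text \<open>Of two common vertices at least one survives the deletion of any \<open>v\<close>, and
  it holds the two remainders together. So the union is biconnected, and maximality makes it equal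
  to the block.\<close>

lemma block_absorbs:
  assumes G: "graph G" and B: "block G B" and H: "subgraph H G" "biconnected H"
    and ab: "a \<in> fst B" "a \<in> fst H" "b \<in> fst B" "b \<in> fst H" "a \<noteq> b"
  shows "subgraph H B"
proof -
  have gB: "graph B" "graph H" using B H by (auto simp: block_def subgraph_def)
  let ?U = "(fst B \<union> fst H, snd B \<union> snd H)"
  have gU: "graph ?U" using gB unfolding graph_iff_card by auto
  have bB: "biconnected B" using B by (simp add: block_def)
  have cU: "con (adj ?U) (A \<union> A')" if c: "con (adj B) A" "con (adj H) A'" "A \<inter> A' \<noteq> {}" for A A'
  proof (rule con_Un[OF _ _ symp_adj])
    show "con (adj ?U) A" by (rule con_cong[OF c(1)]) (simp add: adj_def)
    show "con (adj ?U) A'" by (rule con_cong[OF c(2)]) (simp add: adj_def)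
  qed (use c(3) in blast)
  have "biconnected ?U"
    unfolding biconnected_iff[OF gU]
  proof (intro conjI allI)
    show "fst ?U \<noteq> {}" using ab by auto
    show "con (adj ?U) (fst ?U)"
      using cU[of "fst B" "fst H"] bB H(2) ab unfolding biconnected_iff[OF gB(1)] biconnected_iff[OF gB(2)] by auto
    fix v
    have "(fst B - {v}) \<inter> (fst H - {v}) \<noteq> {}" using ab by blast
    then have "con (adj ?U) ((fst B - {v}) \<union> (fst H - {v}))"
      using cU bB H(2) unfolding biconnected_iff[OF gB(1)] biconnected_iff[OF gB(2)] by blast
    then show "con (adj ?U) (fst ?U - {v})" by (simp add: Un_Diff)
  qed
  moreover have "subgraph ?U G" using gU B H(1) unfolding block_def subgraph_def by auto
  moreover have "subgraph B ?U" using gB by (simp add: subgraph_def)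
  ultimately have "?U = B" using B unfolding block_def by blast
  then have "fst H \<subseteq> fst B" "snd H \<subseteq> snd B" by (metis Un_upper2 fst_conv snd_conv)+
  then show ?thesis using gB by (simp add: subgraph_def)
qed

lemma biconnected_edge:
  assumes "a \<noteq> b" shows "graph ({a, b}, {{a, b}})" "biconnected ({a, b}, {{a, b}})"
proof -
  show g: "graph ({a, b}, {{a, b}})" unfolding graph_iff_card using assms by simp
  have "con (adj ({a, b}, {{a, b}})) {a, b}"
    using con_insert[of "adj ({a, b}, {{a, b}})" "{b}" b a] by (simp add: symp_adj adj_def)
  moreover have "con (adj ({a, b}, {{a, b}})) ({a, b} - {v})" for v
  proof -
    have "{a, b} - {v} = {a, b} \<or> {a, b} - {v} = {a} \<or> {a, b} - {v} = {b} \<or> {a, b} - {v} = {}" by auto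
    then show ?thesis using calculation by (elim disjE) simp_all
  qed
  ultimately show "biconnected ({a, b}, {{a, b}})" unfolding biconnected_iff[OF g] by simp
qed

text \<open>A single edge is biconnected. With both ends in the block it shares two vertices with it
  and is absorbed.\<close>

lemma block_induced:
  assumes "graph G" "block G B"
  shows "B = induced_subgraph G (fst B)"
proof -
  have sB: "fst B \<subseteq> fst G" "snd B \<subseteq> snd G" "graph B" using assms(2) by (auto simp: block_def subgraph_def)
  have "{e \<in> snd G. e \<subseteq> fst B} \<subseteq> snd B"
  proof
    fix e assume e: "e \<in> {e \<in> snd G. e \<subseteq> fst B}"
    then have "e \<in> snd G" by blast
    then obtain a b where ab: "e = {a, b}" "a \<in> fst G" "b \<in> fst G" "a \<noteq> b"
      using graph_edge_doubleton[OF assms(1)] by metis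
    have "subgraph ({a, b}, {{a, b}}) G" using biconnected_edge(1)[OF ab(4)] ab e by (simp add: subgraph_def)
    then have "subgraph ({a, b}, {{a, b}}) B"
      using block_absorbs[OF assms _ biconnected_edge(2)[OF ab(4)], of a b] ab e by auto
    then show "e \<in> snd B" using ab by (simp add: subgraph_def)
  qed
  moreover have "snd B \<subseteq> {e \<in> snd G. e \<subseteq> fst B}"
  proof
    fix e assume "e \<in> snd B"
    then show "e \<in> {e \<in> snd G. e \<subseteq> fst B}" using sB(2) graph_edge_doubleton[OF sB(3), of e] by auto
  qed
  ultimately show ?thesis by (simp add: induced_subgraph_def prod_eq_iff)
qed

section \<open>Blocks as 2-trees and hollowed 2-trees\<close>

lemma cyc_avoids_simplicial:
  assumes "cyc E n c" "4 \<le> n" "\<And>y z. y \<in> c ` {..<n} \<Longrightarrow> z \<in> c ` {..<n} \<Longrightarrow> E x y \<Longrightarrow> E x z \<Longrightarrow> y \<noteq> z \<Longrightarrow> E y z"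
  shows "x \<notin> c ` {..<n}"
proof
  assume "x \<in> c ` {..<n}"
  then obtain d where d: "cyc E n d" "d ` {..<n} = c ` {..<n}" "d 0 = x" using cyc_rotate[OF assms(1)] by metis
  have "E x (d 1)" "E x (d (n - 1))" "\<not> E (d 1) (d (n - 1))"
    using cycD(3)[OF d(1), of 0 1] cycD(3)[OF d(1), of 0 "n - 1"] cycD(3)[OF d(1), of 1 "n - 1"] d(3) assms(2) by auto
  moreover have "d 1 \<in> d ` {..<n}" "d (n - 1) \<in> d ` {..<n}" "d 1 \<noteq> d (n - 1)"
    using cyc_inj[OF d(1), of 1 "n - 1"] assms(2) by auto
  ultimately show False using assms(3)[of "d 1" "d (n - 1)"] d(2) by metis
qed

text \<open>The new vertex is simplicial, and a vertex of a hole never is, since its two neighbours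
  on the hole are distinct and not adjacent. So the step of either kind of 2-tree creates no
  hole.\<close>

lemma hole_add_vertex:
  assumes G: "graph G" "x \<notin> fst G" "adj G u v"
    and c: "cyc (adj (add_vertex G x {u, v})) n c" "4 \<le> n" "c ` {..<n} \<subseteq> fst (add_vertex G x {u, v})"
  shows "cyc (adj G) n c" "c ` {..<n} \<subseteq> fst G"
proof -
  have nx: "\<not> adj G x y" for y using graph_adj(1)[OF G(1)] G(2) by blast
  have x: "x \<notin> c ` {..<n}"
  proof (rule cyc_avoids_simplicial[OF c(1,2)])
    fix y z assume "adj (add_vertex G x {u, v}) x y" "adj (add_vertex G x {u, v}) x z" "y \<noteq> z"
    moreover have "x \<notin> {u, v}" using G graph_adj(1,2)[OF G(1,3)] by auto
    ultimately have "{y, z} = {u, v}" using nx by (auto simp: adj_add_vertex)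
    then show "adj (add_vertex G x {u, v}) y z" using G(3) unfolding adj_add_vertex by (metis adj_def)
  qed
  then show "c ` {..<n} \<subseteq> fst G" using c(3) by (auto simp: add_vertex_def)
  show "cyc (adj G) n c" by (rule cyc_cong[OF c(1)]) (use x in \<open>auto simp: adj_add_vertex\<close>)
qed

lemma two_tree_hole_free: "two_tree B \<Longrightarrow> graph B \<and> hole_free (adj B) (fst B)"
proof (induction rule: two_tree.induct)
  case (base u v)
  have "\<not> c ` {..<n} \<subseteq> {u, v}" if "4 \<le> n" "cyc (adj ({u, v}, {{u, v}})) n c" for n c
  proof
    assume "c ` {..<n} \<subseteq> {u, v}"
    then have "card (c ` {..<n}) \<le> card {u, v}" by (intro card_mono) auto
    then show False using that cycD(2)[OF that(2)] base by (simp add: card_image)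
  qed
  then show ?case using biconnected_edge(1)[OF base] unfolding hole_free_def by simp
next
  case (step G x u v)
  have uv: "adj G u v" using step by (simp add: adj_def)
  have "graph (add_vertex G x {u, v})"
    using step graph_adj[OF _ uv] by (intro graph_add_vertex) auto
  moreover have "hole_free (adj (add_vertex G x {u, v})) (fst (add_vertex G x {u, v}))"
    unfolding hole_free_def
  proof (intro allI impI notI)
    fix n c assume "4 \<le> n" "cyc (adj (add_vertex G x {u, v})) n c" "c ` {..<n} \<subseteq> fst (add_vertex G x {u, v})"
    then show False using hole_add_vertex[of G x u v n c] step uv unfolding hole_free_def by blast
  qed
  ultimately show ?case ..
qed

lemma hollowed_two_tree_unique_hole: "hollowed_two_tree B \<Longrightarrow> graph B \<and> unique_hole (adj B) (fst B)"
proof (induction rule: hollowed_two_tree.induct)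
  case (base G n)
  obtain c where c: "cyc (adj G) n c" "fst G = c ` {..<n}" using cycle_graph_imp_cyc[OF base(1)] .
  have "unique_hole (adj G) (fst G)"
    unfolding unique_hole_def c(2) using cyc_subset_eq[OF c(1) _ _ symp_adj] by metis
  then show ?case using cycle_graph_graph[OF base(1)] by simp
next
  case (step G x u v)
  have uv: "adj G u v" using step by (simp add: adj_def)
  have "graph (add_vertex G x {u, v})"
    using step graph_adj[OF _ uv] by (intro graph_add_vertex) auto
  moreover have "unique_hole (adj (add_vertex G x {u, v})) (fst (add_vertex G x {u, v}))"
    unfolding unique_hole_def
  proof (intro allI impI)
    let ?G = "add_vertex G x {u, v}"
    fix n c m d assume a: "4 \<le> n" "cyc (adj ?G) n c" "c ` {..<n} \<subseteq> fst ?G" "4 \<le> m" "cyc (adj ?G) m d" "d ` {..<m} \<subseteq> fst ?G"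
    have "graph G" "x \<notin> fst G" using step by blast+
    from hole_add_vertex[OF this uv a(2,1,3)] hole_add_vertex[OF this uv a(5,4,6)]
    show "c ` {..<n} = d ` {..<m}" using step a(1,4) unfolding unique_hole_def by blast
  qed
  ultimately show ?case ..
qed

text \<open>The removal of vertices is the same as for constructibility, but from three vertices on
  a single neighbour would be a cut vertex, so exactly two remain. The hole in the second
  alternative is recorded in order to compare different blocks later.\<close>

lemma biconnected_unique_hole_tree:
  assumes G: "graph G" "theta_free (adj G) (fst G)" "K4_free (adj G) (fst G)"
    and S: "S \<subseteq> fst G" "2 \<le> card S" "con (adj G) S" "\<forall>v. con (adj G) (S - {v})" "unique_hole (adj G) S"
  shows "two_tree (induced_subgraph G S) \<or>
    hollowed_two_tree (induced_subgraph G S) \<and> \<not> hole_free (adj G) S"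
  using S
proof (induction "card S" arbitrary: S rule: less_induct)
  case less
  have finS: "finite S" using G(1) less.prems(1) finite_subset by (auto simp: graph_def)
  show ?case
  proof (cases "\<exists>n c. 4 \<le> n \<and> cyc (adj G) n c \<and> c ` {..<n} = S")
    case True
    then obtain n c where c: "4 \<le> n" "cyc (adj G) n c" "c ` {..<n} = S" by blast
    then have "cycle_graph (induced_subgraph G S) n" using cycle_graph_induced_iff[OF G(1) less.prems(1)] by blast
    then have "hollowed_two_tree (induced_subgraph G S)" using c(1) by (rule hollowed_two_tree.base)
    moreover have "\<not> hole_free (adj G) S" using c unfolding hole_free_def by blast
    ultimately show ?thesis by blast
  next
    case False
    then have nh: "c ` {..<n} \<noteq> S" if "4 \<le> n" "cyc (adj G) n c" for n c using that by blast
    obtain x where x: "x \<in> S" "clique (adj G) {y\<in>S. adj G x y}" "{y\<in>S. adj G x y} \<noteq> {}" "card {y\<in>S. adj G x y} \<le> 2"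
      using removable_vertex[OF finS symp_adj irreflp_adj[OF G(1)] less.prems(3) theta_free_mono[OF G(2) less.prems(1)]
          K4_free_mono[OF G(3) less.prems(1)] less.prems(5,2) nh] by blast
    let ?N = "{y\<in>S. adj G x y}" and ?T = "S - {x}"
    have NT: "?N \<subseteq> ?T" using not_adj_self[OF G(1)] by auto
    have TV: "?T \<subseteq> fst G" using less.prems(1) by blast
    have cT: "card S = Suc (card ?T)" using finS x(1) by (rule card.remove)
    note eq = induced_subgraph_add_vertex[OF G(1) x(1) less.prems(1) refl]
    show ?thesis
    proof (cases "card S = 2")
      case True
      then obtain y where y: "?T = {y}" using cT by (metis One_nat_def Suc_1 Suc_inject card_1_singletonE)
      have S: "S = {x, y}" using y x(1) by blast
      obtain z where "z \<in> ?N" using x(3) by blast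
      moreover from this have "z = y" using NT y by blast
      ultimately have xy: "adj G x y" by blast
      have xny: "x \<noteq> y" using y by blast
      have "{e \<in> snd G. e \<subseteq> {x, y}} = {{x, y}}"
      proof (intro equalityI subsetI)
        fix e assume e: "e \<in> {e \<in> snd G. e \<subseteq> {x, y}}"
        then have "e \<in> snd G" by blast
        then obtain a b where "e = {a, b}" "a \<noteq> b" using graph_edge_doubleton[OF G(1)] by metis
        then show "e \<in> {{x, y}}" using e by auto
      qed (use xy in \<open>auto simp: adj_def\<close>)
      then have "induced_subgraph G S = ({x, y}, {{x, y}})" unfolding S by (simp only: induced_subgraph_def)
      then show ?thesis using two_tree.base[OF xny] by simp
    next
      case c3: False
      have "card ?N \<noteq> 1"
      proof
        assume "card ?N = 1"
        then obtain v where v: "?N = {v}" using card_1_singletonE by blast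
        then have vT: "v \<in> ?T" using NT by blast
        have ne: "S - {v} \<noteq> {x}"
        proof
          assume "S - {v} = {x}"
          then have "S \<subseteq> {x, v}" by blast
          then have "card S \<le> card {x, v}" by (intro card_mono) auto
          then show False using c3 less.prems(2) by (simp add: card_insert_if split: if_splits)
        qed
        have xv: "x \<in> S - {v}" using x(1) vT by blast
        obtain b where "b \<in> S - {v}" "adj G x b"
          using conE[OF spec[OF less.prems(4), of v], of "{x}"] xv ne by blast
        then show False using v by blast
      qed
      moreover have "card ?N \<noteq> 0" using x(3) finS by simp
      ultimately have "card ?N = 2" using x(4) by linarith
      then obtain v w where vw: "?N = {v, w}" "v \<noteq> w" by (auto simp: card_2_iff)
      have "v \<in> ?N" "w \<in> ?N" using vw(1) by blast+
      then have a: "adj G v w" "v \<in> ?T" "w \<in> ?T" using x(2) vw(2) NT unfolding clique_def by blast+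
      have "two_tree (induced_subgraph G ?T) \<or> hollowed_two_tree (induced_subgraph G ?T) \<and> \<not> hole_free (adj G) ?T"
      proof (rule less.hyps)
        show "card ?T < card S" using cT by simp
        show "?T \<subseteq> fst G" by (rule TV)
        show "2 \<le> card ?T" using cT c3 less.prems(2) by simp
        show "con (adj G) ?T" using less.prems(4) by blast
        show "unique_hole (adj G) ?T" by (rule unique_hole_mono[OF less.prems(5)]) blast
        show "\<forall>v. con (adj G) (?T - {v})"
        proof
          fix v
          have "con (adj G) (S - {v} - {x})"
            by (rule con_remove_simplicial[OF spec[OF less.prems(4)] symp_adj]) (use x(2) in \<open>simp add: clique_def\<close>)
          then show "con (adj G) (?T - {v})" by (simp add: Diff_insert2[symmetric] insert_commute)
        qed
      qed
      moreover have e: "{v, w} \<in> snd (induced_subgraph G ?T)" "x \<notin> fst (induced_subgraph G ?T)"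
        using a by (auto simp: induced_subgraph_def adj_def)
      moreover have "hole_free (adj G) S \<Longrightarrow> hole_free (adj G) ?T" unfolding hole_free_def by blast
      ultimately show ?thesis
        unfolding eq vw(1) using two_tree.step[OF _ e(2,1)] hollowed_two_tree.step[OF _ e(2,1)] by blast
    qed
  qed
qed

text \<open>A hole is biconnected and hence lies in one block, and neither a 2-tree nor
  \<open>K_1\<close> contains one. So two holes lie in the same exceptional block, a hollowed
  2-tree, which has only one.\<close>

lemma unique_hole_if_blocks:
  assumes G: "graph G"
    and bl: "(\<forall>B. block G B \<longrightarrow> two_tree B) \<or> (\<exists>B0. block G B0 \<and> (is_K1 B0 \<or> hollowed_two_tree B0) \<and>
      (\<forall>B. block G B \<and> B \<noteq> B0 \<longrightarrow> two_tree B))"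
  shows "unique_hole (adj G) (fst G)"
proof -
  have inB: "\<exists>B. block G B \<and> cyc (adj B) n c \<and> c ` {..<n} \<subseteq> fst B"
    if c: "cyc (adj G) n c" "c ` {..<n} \<subseteq> fst G" for n c
  proof -
    let ?S = "c ` {..<n}"
    have "subgraph (induced_subgraph G ?S) G"
      using graph_induced_subgraph[OF G c(2)] c(2) by (auto simp: subgraph_def induced_subgraph_def)
    then obtain B where B: "block G B" "subgraph (induced_subgraph G ?S) B"
      using biconnected_subgraph_in_block[OF G _ biconnected_cycle[OF G c(1) refl c(2)]] by blast
    have sub: "?S \<subseteq> fst B" using B(2) by (simp add: subgraph_def induced_subgraph_def)
    have "adj G a b \<longleftrightarrow> adj B a b" if "a \<in> ?S" "b \<in> ?S" for a b
      using that sub adj_induced_subgraph[of G "fst B" a b] block_induced[OF G B(1)] by auto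
    then have "cyc (adj B) n c" using cyc_cong[OF c(1)] by blast
    then show ?thesis using B(1) sub by blast
  qed
  have notree: "\<not> two_tree B" "\<not> is_K1 B" if "4 \<le> n" "cyc (adj B) n c" "c ` {..<n} \<subseteq> fst B" for B :: "'a graph" and n c
  proof -
    show "\<not> two_tree B" using two_tree_hole_free[of B] that unfolding hole_free_def by blast
    show "\<not> is_K1 B"
    proof
      assume "is_K1 B"
      then obtain v where "fst B = {v}" by (auto simp: is_K1_def)
      then have "card (c ` {..<n}) \<le> card {v}" using that(3) by (intro card_mono) auto
      then show False using cycD(2)[OF that(2)] that(1) by (simp add: card_image)
    qed
  qed
  show ?thesis
    unfolding unique_hole_def
  proof (intro allI impI)
    fix n c m d
    assume c: "4 \<le> n" "cyc (adj G) n c" "c ` {..<n} \<subseteq> fst G" and d: "4 \<le> m" "cyc (adj G) m d" "d ` {..<m} \<subseteq> fst G"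
    obtain B where B: "block G B" "cyc (adj B) n c" "c ` {..<n} \<subseteq> fst B" using inB[OF c(2,3)] by blast
    obtain B' where B': "block G B'" "cyc (adj B') m d" "d ` {..<m} \<subseteq> fst B'" using inB[OF d(2,3)] by blast
    note nB = notree[OF c(1) B(2,3)] and nB' = notree[OF d(1) B'(2,3)]
    have "B = B'" "hollowed_two_tree B" using bl B(1) B'(1) nB nB' by metis+
    then show "c ` {..<n} = d ` {..<m}"
      using hollowed_two_tree_unique_hole[of B] c(1) d(1) B B' unfolding unique_hole_def by metis
  qed
qed

text \<open>Two blocks that are not 2-trees both contain the only hole, hence share two vertices,
  and so they are equal. The alternative \<open>K_1\<close> occurs exactly when the whole graph is a
  single vertex.\<close>

lemma blocks_if_unique_hole:
  assumes G: "graph G" "connected_graph G" "theta_free (adj G) (fst G)" "K4_free (adj G) (fst G)"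
    and uh: "unique_hole (adj G) (fst G)"
  shows "(\<forall>B. block G B \<longrightarrow> two_tree B) \<or> (\<exists>B0. block G B0 \<and> (is_K1 B0 \<or> hollowed_two_tree B0) \<and>
      (\<forall>B. block G B \<and> B \<noteq> B0 \<longrightarrow> two_tree B))"
proof -
  have V: "fst G \<noteq> {}" "con (adj G) (fst G)" "finite (fst G)"
    using G(1,2) connected_graph_iff[OF G(1)] by (auto simp: graph_def)
  have sub: "subgraph B G" "graph B" "biconnected B" "fst B \<subseteq> fst G" "fst B \<noteq> {}" if "block G B" for B
  proof -
    show "subgraph B G" "graph B" "biconnected B" "fst B \<subseteq> fst G" using that by (auto simp: block_def subgraph_def)
    then show "fst B \<noteq> {}" using biconnected_iff[of B] by blast
  qed
  show ?thesis
  proof (cases "\<exists>v. fst G = {v}")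
    case True
    then obtain v where v: "fst G = {v}" by blast
    have E: "snd G = {}"
      using graph_edge_doubleton[OF G(1)] v by (metis equals0I singletonD)
    then have GK: "G = ({v}, {})" using v by (simp add: prod_eq_iff)
    have BK: "B = G" if "block G B" for B
      using sub[OF that] v E unfolding subgraph_def by (metis prod_eq_iff subset_empty subset_singletonD)
    have "con (adj G) ({v} - {u})" for u by (cases "v = u") simp_all
    then have "biconnected G" unfolding biconnected_iff[OF G(1)] v by simp
    then have "block G G" using G(1) unfolding block_def subgraph_def by (auto simp: prod_eq_iff)
    moreover have "is_K1 G" unfolding is_K1_def GK by blast
    ultimately show ?thesis using BK by blast
  next
    case False
    \<comment> \<open>By connectedness a one-vertex block would be properly contained in an edge at
      its vertex.\<close>
    have two: "2 \<le> card (fst B)" if B: "block G B" for B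
    proof (rule ccontr)
      assume "\<not> 2 \<le> card (fst B)"
      moreover have "finite (fst B)" using sub(4)[OF B] V(3) finite_subset by blast
      ultimately have "card (fst B) = 1" using sub(5)[OF B] card_gt_0_iff[of "fst B"] by linarith
      then obtain v where v: "fst B = {v}" using card_1_singletonE by blast
      obtain w where w: "w \<in> fst G" "adj G v w" "v \<noteq> w"
      proof -
        have "{v} \<subseteq> fst G" "{v} \<noteq> fst G" using v sub(4)[OF B] False by auto
        then obtain w where "w \<in> fst G" "w \<notin> {v}" "adj G v w" using conE[OF V(2), of "{v}"] by blast
        then show ?thesis using that by blast
      qed
      have "snd B = {}" using graph_edge_doubleton[OF sub(2)[OF B]] v by (metis equals0I singletonD)
      have "subgraph ({v, w}, {{v, w}}) G"
        using biconnected_edge(1)[OF w(3)] w v sub(4)[OF B] by (simp add: subgraph_def adj_def)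
      moreover have "subgraph B ({v, w}, {{v, w}})"
        using sub(2)[OF B] v \<open>snd B = {}\<close> by (simp add: subgraph_def)
      ultimately have "({v, w}, {{v, w}}) = B" using B biconnected_edge(2)[OF w(3)] unfolding block_def by blast
      then have "{v, w} = {v}" using v by (metis fst_conv)
      then show False using w(3) by blast
    qed
    have tree: "two_tree B \<or> hollowed_two_tree B \<and> \<not> hole_free (adj G) (fst B)" if B: "block G B" for B
    proof -
      have bi: "B = induced_subgraph G (fst B)" by (rule block_induced[OF G(1) B])
      have cc: "con (adj G) A" if "con (adj B) A" for A
        by (rule con_cong[OF that]) (use sub(1)[OF B] in \<open>auto simp: subgraph_def adj_def\<close>)
      have "con (adj G) (fst B)" "\<forall>v. con (adj G) (fst B - {v})"
        using cc sub(3)[OF B] unfolding biconnected_iff[OF sub(2)[OF B]] by blast+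
      from biconnected_unique_hole_tree[OF G(1,3,4) sub(4)[OF B] two[OF B] this unique_hole_mono[OF uh sub(4)[OF B]]]
      show ?thesis using bi by simp
    qed
    show ?thesis
    proof (cases "\<forall>B. block G B \<longrightarrow> two_tree B")
      case False
      then obtain B0 where B0: "block G B0" "\<not> two_tree B0" by blast
      have "two_tree B" if B: "block G B" "B \<noteq> B0" for B
      proof (rule ccontr)
        assume nt: "\<not> two_tree B"
        obtain n c where c: "4 \<le> n" "cyc (adj G) n c" "c ` {..<n} \<subseteq> fst B0"
          using tree[OF B0(1)] B0(2) unfolding hole_free_def by blast
        obtain m d where d: "4 \<le> m" "cyc (adj G) m d" "d ` {..<m} \<subseteq> fst B"
          using tree[OF B(1)] nt unfolding hole_free_def by blast
        have "c ` {..<n} = d ` {..<m}"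
          using uh c d sub(4)[OF B0(1)] sub(4)[OF B(1)] unfolding unique_hole_def by (meson subset_trans)
        moreover have "c 0 \<in> c ` {..<n}" "c 1 \<in> c ` {..<n}" using c(1) by auto
        ultimately have mem: "c 0 \<in> fst B0" "c 0 \<in> fst B" "c 1 \<in> fst B0" "c 1 \<in> fst B"
          using c(3) d(3) by blast+
        have ne: "c 0 \<noteq> c 1" using cyc_inj[OF c(2), of 0 1] c(1) by simp
        have "subgraph B B0" using block_absorbs[OF G(1) B0(1) sub(1,3)[OF B(1)] mem ne] .
        then have "B0 = B" using B(1) sub(1,3)[OF B0(1)] unfolding block_def by blast
        then show False using B(2) by simp
      qed
      then show ?thesis using B0 tree[OF B0(1)] by blast
    qed blast
  qed
qed

theorem theorem6p1:
  fixes G :: "'a graph"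
  assumes "graph G" and "connected_graph G" and "outerplanar G"
  shows "(one_perfectly_orientable G \<longleftrightarrow>
            \<not> induced_minor K23 G \<and> \<not> induced_minor F1 G \<and> \<not> induced_minor F2 G)
       \<and> (one_perfectly_orientable G \<longleftrightarrow>
            (\<forall>B. block G B \<longrightarrow> two_tree B) \<or>
            (\<exists>B0. block G B0 \<and> (is_K1 B0 \<or> hollowed_two_tree B0) \<and>
                  (\<forall>B. block G B \<and> B \<noteq> B0 \<longrightarrow> two_tree B)))
       \<and> (one_perfectly_orientable G \<longleftrightarrow> constructible G)"
proof -
  note tf = outerplanar_theta_free[OF assms(1,3)] and k4 = outerplanar_K4_free[OF assms(1,3)]
  have V: "fst G \<noteq> {}" "con (adj G) (fst G)" using assms(2) connected_graph_iff[OF assms(1)] by auto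
  have 1: "\<not> induced_minor K23 G \<and> \<not> induced_minor F1 G \<and> \<not> induced_minor F2 G" if "one_perfectly_orientable G"
    using one_perfectly_orientable_induced_minor[OF assms(1) that] graph_K23 graph_F1 graph_F2
      not_one_perfectly_orientable by blast
  have 2: "unique_hole (adj G) (fst G)" if "\<not> induced_minor F1 G" "\<not> induced_minor F2 G"
    unfolding unique_hole_def
  proof (intro allI impI, rule ccontr)
    fix n c m d
    assume c: "4 \<le> n" "cyc (adj G) n c" "c ` {..<n} \<subseteq> fst G" and d: "4 \<le> m" "cyc (adj G) m d" "d ` {..<m} \<subseteq> fst G"
      and ne: "c ` {..<n} \<noteq> d ` {..<m}"
    show False
      using two_holes_model[OF symp_adj V(2) tf c(2,1,3) d(2,1,3) ne]
        minor_model_induced_minor[OF graph_F1 assms(1)] minor_model_induced_minor[OF graph_F2 assms(1)] that by blast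
  qed
  have 3: "constructible G" if "unique_hole (adj G) (fst G)"
  proof -
    have "snd G \<subseteq> Pow (fst G)" using assms(1) by (auto simp: graph_iff_card)
    then have "induced_subgraph G (fst G) = G" by (auto simp: induced_subgraph_def prod_eq_iff)
    then show ?thesis
      using unique_hole_constructible_induced[OF assms(1) tf k4 order_refl V that] by simp
  qed
  have 4: "one_perfectly_orientable G" if "constructible G"
    using constructible_one_perfectly_orientable[OF that] by blast
  \<comment> \<open>The facts \<open>1\<close> to \<open>4\<close> close a circle from orientability
    through the excluded minors, the uniqueness of the hole and the construction back to
    orientability. The block condition is attached to the uniqueness of the hole in both
    directions.\<close>
  show ?thesis
    using 1 2 3 4 unique_hole_if_blocks[OF assms(1)] blocks_if_unique_hole[OF assms(1,2) tf k4] by blast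
qed

end
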